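(* Let $\Phi=\{\phi_i\}_{i\in\mathcal{D}}$ be an iterated function system with attractor $X\subset\mathbb{R}^d$. (1) If $\Psi:\mathcal{D}^{*}\to\mathbb{R}_{\geq 0}$ satisfies $$\sum_{n=1}^{\infty}\sum_{I\in\mathcal{D}^{n}}\Psi(I)^{\dim_{H}(X)}<\infty,$$ then $\mathcal{H}^{\dim_{H}(X)}(W(\Psi,z))=0$ for all $z\in X$. (2) If $\Phi$ is a conformal iterated function system and satisfies the open set condition, then $\Phi$ is an approximation regular iterated function system.
   Context: An iterated function system (IFS) on a closed set $V\subset\mathbb{R}^d$ is a finite set of contractions $\Phi=\{\phi_i\}_{i\in\mathcal{D}}$, $\phi_i:V\to V$ (i.e. for some $r_i\in(0,1)$, $|\phi_i(x)-\phi_i(y)|\le r_i|x-y|$ for all $x,y\in V$). Its attractor is the unique non-empty compact set $X$ with $X=\bigcup_{i\in\mathcal{D}}\phi_i(X)$. Write $\mathcal{D}^n$ for words of length $n$ over $\mathcal{D}$, $\mathcal{D}^*=\bigcup_{n\ge1}\mathcal{D}^n$; for $I=(i_1,\dots,i_n)$, $|I|=n$, $\phi_I=\phi_{i_1}\circ\cdots\circ\phi_{i_n}$, $X_I=\phi_I(X)$. $\dim_H$ and $\mathcal{H}^s$ denote Hausdorff dimension and $s$-dimensional Hausdorff measure, $Diam$ denotes diameter, and $B(x,r)$ is the closed Euclidean ball of centre $x$ and radius $r$. For $z\in X$ and $\Psi:\mathcal{D}^*\to\mathbb{R}_{\ge0}$, $$W(\Psi,z):=\{x\in X: x\in B(\phi_I(z),\Psi(I))\text{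 for infinitely many } I\in\mathcal{D}^*\}.$$ Conformal IFS: an IFS $\Phi$ on a compact set $Y\subset\mathbb{R}^d$ such that each $\phi_i$ extends to an injective conformal contraction on some open connected neighbourhood $V$ of $Y$ (conformal: $C^1$ with $|\phi_i'(x)y|=|\phi_i'(x)||y|$ for all $x\in V$, $y\in\mathbb{R}^d$), with $0<\inf_{x\in V}|\phi_i'(x)|\le\sup_{x\in V}|\phi_i'(x)|<1$, and such that for some $\alpha,c>0$, $||\phi_i'(x)|-|\phi_i'(y)||\le c|x-y|^\alpha$ for all $x,y\in V$, $i\in\mathcal{D}$. Open set condition: there is a non-empty open set $O\subset\mathbb{R}^d$ (in the domain of the maps) with $\phi_i(O)\subset O$ for all $i\in\mathcal{D}$ and $\phi_i(O)\cap\phi_j(O)=\emptyset$ for all $i\ne j$. Similarity dimension $\dim_S(X)$ of a conformal IFS $\Phi$ (it depends on $\Phi$): the unique $s\in\mathbb{R}$ with $P(s)=0$, where $P(s)=\lim_{n\to\infty}\frac1n\log\inf_{x\in X}\sum_{I\in\mathcal{D}^n}|\phi_I'(x)|^s=\lim_{n\to\infty}\frac1n\log\sup_{x\in X}\sum_{I\in\mathcal{D}^n}|\phi_I'(x)|^s$. Approximation regularity (it is implicit that $\dim_H(X)>0$): let $\Phi$ be a conformal IFS, $z\in X$, and for $\theta:\mathbb{N}\to\mathbb{R}_{\ge0}$ put $\Psi_\theta(I)=Diam(X_I)^{\dim_S(X)/\dim_H(X)}\theta(|I|)$. Consider the divergence condition $$(\ast)\quad\sum_{n=1}^\infty\sum_{I\in\mathcal{D}^n}\big(Diam(X_I)^{\dim_S(X)/\dim_H(X)}\theta(n)\big)^{\dim_H(X)}=\infty.$$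 If $\mathcal{H}^{\dim_H(X)}(X)>0$, then $(\Phi,z)$ is an approximation regular pair if for every decreasing $\theta:\mathbb{N}\to\mathbb{R}_{\ge0}$ satisfying $(\ast)$, $\mathcal{H}^{\dim_H(X)}$-almost every $x\in X$ lies in $W(\Psi_\theta,z)$. If $\mathcal{H}^{\dim_H(X)}(X)=0$, then $(\Phi,z)$ is an approximation regular pair if for every decreasing $\theta:\mathbb{N}\to\mathbb{R}_{\ge0}$ satisfying $(\ast)$, $\dim_H(W(\Psi_\theta,z))=\dim_H(X)$. $\Phi$ is an approximation regular IFS if $(\Phi,z)$ is an approximation regular pair for every $z\in X$. *)

theory Defs
  imports "HOL-Analysis.Analysis"
begin

section \<open>Hausdorff measure and dimension\<close>

text \<open>Real power of a non-negative base with \<open>0\<^sup>0 = 1\<close>, whereas \<open>0 powr 0 = 0\<close>.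
  With the latter, convergence of \<open>\<Sum>\<Psi>(I)\<^sup>s\<close> would not imply that the limsup set is null
  when \<open>s = 0\<close> (one-point attractor, \<open>\<Psi> = 0\<close>).\<close>

definition rpow :: "real \<Rightarrow> real \<Rightarrow> real" where
  "rpow x s = (if s = 0 then 1 else x powr s)"

text \<open>Empty members of a cover contribute \<open>0\<close> for every \<open>s\<close>, including \<open>s = 0\<close>, so finite covers
  are included and the \<open>0\<close>-dimensional measure is counting measure. Boundedness is required because
  \<open>diameter\<close> is meaningless on unbounded sets.\<close>

definition hausdorff_content :: "real \<Rightarrow> real \<Rightarrow> 'a::metric_space set \<Rightarrow> ennreal" where
  "hausdorff_content s \<delta> E =
     (INF U \<in> {U :: nat \<Rightarrow> 'a set. E \<subseteq> (\<Union>k. U k) \<and> (\<forall>k. bounded (U k) \<and> diameter (U k) \<le> \<delta>)}.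
        \<Sum>k. if U k = {} then 0 else ennreal (rpow (diameter (U k)) s))"

definition hausdorff_measure :: "real \<Rightarrow> 'a::metric_space set \<Rightarrow> ennreal" where
  "hausdorff_measure s E = (SUP \<delta>\<in>{0<..}. hausdorff_content s \<delta> E)"

definition hausdorff_dim :: "'a::euclidean_space set \<Rightarrow> real" where
  "hausdorff_dim E = Inf {s. 0 \<le> s \<and> hausdorff_measure s E = 0}"


section \<open>Words\<close>

definition words :: "'i set \<Rightarrow> nat \<Rightarrow> 'i list set" where
  "words D n = {I. set I \<subseteq> D \<and> length I = n}"

definition words_star :: "'i set \<Rightarrow> 'i list set" where
  "words_star D = (\<Union>n\<in>{1..}. words D n)"

definition word_map :: "('i \<Rightarrow> 'a \<Rightarrow> 'a) \<Rightarrow> 'i list \<Rightarrow> 'a \<Rightarrow> 'a" where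
  "word_map \<phi> I = foldr (\<lambda>i f. \<phi> i \<circ> f) I id"


section \<open>Iterated function systems\<close>

definition contraction_on :: "'a::metric_space set \<Rightarrow> ('a \<Rightarrow> 'a) \<Rightarrow> bool" where
  "contraction_on K f \<longleftrightarrow> (\<exists>r. 0 < r \<and> r < 1 \<and> r-lipschitz_on K f)"

definition ifs :: "'i set \<Rightarrow> ('i \<Rightarrow> 'a \<Rightarrow> 'a) \<Rightarrow> 'a::euclidean_space set \<Rightarrow> bool" where
  "ifs D \<phi> K \<longleftrightarrow> finite D \<and> closed K \<and> (\<forall>i\<in>D. \<phi> i ` K \<subseteq> K \<and> contraction_on K (\<phi> i))"

definition attractor ::
  "'i set \<Rightarrow> ('i \<Rightarrow> 'a \<Rightarrow> 'a) \<Rightarrow> 'a::euclidean_space set \<Rightarrow> 'a set \<Rightarrow> bool" where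
  "attractor D \<phi> K X \<longleftrightarrow> X \<noteq> {} \<and> compact X \<and> X \<subseteq> K \<and> X = (\<Union>i\<in>D. \<phi> i ` X)"

definition limsup_set ::
  "'i set \<Rightarrow> ('i \<Rightarrow> 'a \<Rightarrow> 'a) \<Rightarrow> 'a::euclidean_space set \<Rightarrow> ('i list \<Rightarrow> real) \<Rightarrow> 'a \<Rightarrow> 'a set" where
  "limsup_set D \<phi> X \<Psi> z =
     {x \<in> X. infinite {I \<in> words_star D. x \<in> cball (word_map \<phi> I z) (\<Psi> I)}}"

definition word_series :: "'i set \<Rightarrow> ('i list \<Rightarrow> real) \<Rightarrow> real \<Rightarrow> ennreal" where
  "word_series D \<Psi> s = (\<Sum>n. \<Sum>I\<in>words D (Suc n). ennreal (rpow (\<Psi> I) s))"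


section \<open>Conformal iterated function systems\<close>

definition conformal_on :: "'a::euclidean_space set \<Rightarrow> ('a \<Rightarrow> 'a) \<Rightarrow> bool" where
  "conformal_on V f \<longleftrightarrow>
     (\<exists>f' :: 'a \<Rightarrow> ('a \<Rightarrow>\<^sub>L 'a). continuous_on V f' \<and>
        (\<forall>x\<in>V. (f has_derivative blinfun_apply (f' x)) (at x)) \<and>
        (\<forall>x\<in>V. \<forall>y. norm (blinfun_apply (f' x) y) = norm (f' x) * norm y))"

definition deriv_norm :: "('a \<Rightarrow> 'a) \<Rightarrow> 'a::euclidean_space \<Rightarrow> real" where
  "deriv_norm f x = onorm (frechet_derivative f (at x))"

text \<open>An IFS on the compact set \<open>Y\<close>; on the neighbourhood \<open>V\<close> of \<open>Y\<close> the total function \<open>\<phi> i\<close>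
  is the conformal extension (its values outside \<open>V\<close> are irrelevant). The extension need not
  map \<open>V\<close> into itself. The contraction property bounds \<open>deriv_norm\<close> above on \<open>V\<close>, so that
  the supremum is meaningful.\<close>

definition conformal_ifs ::
  "'i set \<Rightarrow> ('i \<Rightarrow> 'a \<Rightarrow> 'a) \<Rightarrow> 'a::euclidean_space set \<Rightarrow> 'a set \<Rightarrow> bool" where
  "conformal_ifs D \<phi> Y V \<longleftrightarrow>
     compact Y \<and> ifs D \<phi> Y \<and> open V \<and> connected V \<and> Y \<subseteq> V \<and>
     (\<forall>i\<in>D. inj_on (\<phi> i) V \<and> conformal_on V (\<phi> i) \<and> contraction_on V (\<phi> i) \<and>
        0 < (INF x\<in>V. deriv_norm (\<phi> i) x) \<and> (SUP x\<in>V. deriv_norm (\<phi> i) x) < 1) \<and>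
     (\<exists>\<alpha>>0. \<exists>c>0. \<forall>i\<in>D. \<forall>x\<in>V. \<forall>y\<in>V.
        \<bar>deriv_norm (\<phi> i) x - deriv_norm (\<phi> i) y\<bar> \<le> c * dist x y powr \<alpha>)"

definition open_set_condition ::
  "'i set \<Rightarrow> ('i \<Rightarrow> 'a \<Rightarrow> 'a) \<Rightarrow> 'a::euclidean_space set \<Rightarrow> bool" where
  "open_set_condition D \<phi> V \<longleftrightarrow>
     (\<exists>U. U \<noteq> {} \<and> open U \<and> U \<subseteq> V \<and> (\<forall>i\<in>D. \<phi> i ` U \<subseteq> U) \<and>
        (\<forall>i\<in>D. \<forall>j\<in>D. i \<noteq> j \<longrightarrow> \<phi> i ` U \<inter> \<phi> j ` U = {}))"

text \<open>\<open>has_pressure D \<phi> X s p\<close> states \<open>P(s) = p\<close>: both limits defining \<open>P(s)\<close> exist and equal \<open>p\<close>.\<close>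

definition has_pressure ::
  "'i set \<Rightarrow> ('i \<Rightarrow> 'a \<Rightarrow> 'a) \<Rightarrow> 'a::euclidean_space set \<Rightarrow> real \<Rightarrow> real \<Rightarrow> bool" where
  "has_pressure D \<phi> X s p \<longleftrightarrow>
     (\<lambda>n. 1 / real n * ln (INF x\<in>X. \<Sum>I\<in>words D n. deriv_norm (word_map \<phi> I) x powr s))
        \<longlonglongrightarrow> p \<and>
     (\<lambda>n. 1 / real n * ln (SUP x\<in>X. \<Sum>I\<in>words D n. deriv_norm (word_map \<phi> I) x powr s))
        \<longlonglongrightarrow> p"

definition similarity_dim ::
  "'i set \<Rightarrow> ('i \<Rightarrow> 'a \<Rightarrow> 'a) \<Rightarrow> 'a::euclidean_space set \<Rightarrow> real" where
  "similarity_dim D \<phi> X = (THE s. has_pressure D \<phi> X s 0)"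


section \<open>Approximation regularity\<close>

definition psi_theta ::
  "'i set \<Rightarrow> ('i \<Rightarrow> 'a \<Rightarrow> 'a) \<Rightarrow> 'a::euclidean_space set \<Rightarrow> (nat \<Rightarrow> real) \<Rightarrow> 'i list \<Rightarrow> real" where
  "psi_theta D \<phi> X \<theta> I =
     diameter (word_map \<phi> I ` X) powr (similarity_dim D \<phi> X / hausdorff_dim X) * \<theta> (length I)"

text \<open>Meaningful only for a conformal IFS with \<open>hausdorff_dim X > 0\<close>. ``Decreasing'' is
  non-increasing. Almost everywhere means that the complement in \<open>X\<close> is null for the outer
  measure.\<close>

definition approximation_regular_pair ::
  "'i set \<Rightarrow> ('i \<Rightarrow> 'a \<Rightarrow> 'a) \<Rightarrow> 'a::euclidean_space set \<Rightarrow> 'a \<Rightarrow> bool" where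
  "approximation_regular_pair D \<phi> X z \<longleftrightarrow>
     (\<forall>\<theta> :: nat \<Rightarrow> real.
        (\<forall>n\<ge>1. 0 \<le> \<theta> n) \<and> antimono_on {1..} \<theta> \<and>
        word_series D (psi_theta D \<phi> X \<theta>) (hausdorff_dim X) = \<infinity> \<longrightarrow>
        (if hausdorff_measure (hausdorff_dim X) X > 0
         then hausdorff_measure (hausdorff_dim X) (X - limsup_set D \<phi> X (psi_theta D \<phi> X \<theta>) z) = 0
         else hausdorff_dim (limsup_set D \<phi> X (psi_theta D \<phi> X \<theta>) z) = hausdorff_dim X))"

definition approximation_regular ::
  "'i set \<Rightarrow> ('i \<Rightarrow> 'a \<Rightarrow> 'a) \<Rightarrow> 'a::euclidean_space set \<Rightarrow> bool" where
  "approximation_regular D \<phi> X \<longleftrightarrow> (\<forall>z\<in>X. approximation_regular_pair D \<phi> X z)"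

end

theory Submission
  imports Defs "HOL-Complex_Analysis.Great_Picard" "HOL-Library.Sublist"
begin

text \<open>
  The convergence half is the Hausdorff--Cantelli argument: the balls of any tail cover the limsup set, and their
  diameters raised to the power \<open>dim\<^sub>H X\<close> have a small sum (\<open>limsup_set_null\<close>).

  For the divergence half let \<open>s\<close> be the zero of the pressure. Bounded distortion makes the contraction ratios
  \<open>w I\<close> of the words multiplicative up to a constant, so the sums of \<open>w\<^sup>s\<close> over the words of length
  \<open>n\<close> stay between positive constants (\<open>critical_exponent\<close>), and there is a measure on infinite words that
  gives each cylinder a mass comparable with \<open>w\<^sup>s\<close> and under which disjoint blocks of letters are
  almost independent (\<open>gibbs_measure\<close>). Under the open set condition a ball of radius \<open>\<rho>\<close> meets boundedly many
  cylinders of size about \<open>\<rho>\<close>, by comparison of volumes, so the mass of the ball is at most a multiple of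
  \<open>\<rho>\<^sup>s\<close>. The mass distribution principle gives \<open>H\<^sup>s(X) > 0\<close> (\<open>hausdorff_measure_pos\<close>), while covers
  by cylinders show that the measure vanishes for larger exponents. Hence
  both dimensions equal \<open>s\<close>, and what has to be shown is that almost every point of \<open>X\<close> is approximated infinitely often.

  Fix an address of \<open>z\<close>. A point with address \<open>\<omega>\<close> lies within \<open>Diam(X\<^sub>I) \<theta>(n)\<close> of \<open>\<phi>\<^sub>I(z)\<close>, where \<open>I\<close>
  consists of the first \<open>n\<close> letters of \<open>\<omega>\<close>, as soon as the following letters of \<open>\<omega>\<close> agree with those of the address of \<open>z\<close>
  up to a length \<open>\<kappa>(n)\<close> at which the ratio drops below a multiple of \<open>\<theta>(n)\<close>. This is a shrinking target problem for
  the shift, whose targets are nested cylinders with masses at least comparable with \<open>\<theta>(n)\<^sup>s\<close>, and the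
  divergence condition says that these masses have infinite sum. Hits at different positions are independent
  up to a constant, except for an overlap term that is summable
  because the targets are nested (\<open>mass_read_both\<close>). The second moment method then shows that a fixed proportion of
  every cylinder is hit (\<open>mass_hit_ge\<close>), and iteration makes the mass of the words that are never hit
  tend to 0 (\<open>avoiding_mass_tendsto_0\<close>). The cylinders of those words cover the exceptional points, and their masses
  control the sum of the \<open>s\<close>-th powers of their diameters (\<open>complement_of_limsup_set_null\<close>).
\<close>

section \<open>Words\<close>

lemma words_0 [simp]: "words D 0 = {[]}"
  by (auto simp: words_def)

lemma finite_words [simp]: "finite D \<Longrightarrow> finite (words D n)"
  unfolding words_def by (rule finite_lists_length_eq)

lemma sum_words_append:
  "(\<Sum>K\<in>words D (m + n). f K) = (\<Sum>I\<in>words D m. \<Sum>J\<in>words D n. f (I @ J))"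
proof -
  have "bij_betw (\<lambda>(I, J). I @ J) (words D m \<times> words D n) (words D (m + n))"
    by (rule bij_betw_byWitness[where f' = "\<lambda>K. (take m K, drop m K)"])
      (auto simp: words_def dest: in_set_takeD in_set_dropD)
  from sum.reindex_bij_betw[OF this, of f] show ?thesis
    by (simp add: sum.cartesian_product case_prod_beta)
qed

lemma words_in_words_star: "I \<in> words D (Suc n) \<Longrightarrow> I \<in> words_star D"
  by (auto simp: words_star_def words_def)

lemma sum_words_1: "(\<Sum>K\<in>words D (Suc 0). f K) = (\<Sum>i\<in>D. f [i])"
proof -
  have "words D (Suc 0) = (\<lambda>i. [i]) ` D"
    by (auto simp: words_def length_Suc_conv)
  then show ?thesis by (simp add: sum.reindex inj_on_def)
qed

lemma card_words: "finite D \<Longrightarrow> card (words D n) = card D ^ n"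
  unfolding words_def by (rule card_lists_length_eq)

section \<open>Shrinking targets for quasi-Bernoulli measures\<close>

text \<open>The second moment method: a function that is large on average while its square is not much larger
must be nonzero on a set of definite mass.\<close>

lemma second_moment:
  fixes p :: "'b \<Rightarrow> real" and f :: "'b \<Rightarrow> real"
  assumes "finite S" "\<And>x. x \<in> S \<Longrightarrow> 0 \<le> p x"
  shows "(\<Sum>x\<in>S. p x * f x)\<^sup>2 \<le> (\<Sum>x\<in>S. if f x \<noteq> 0 then p x else 0) * (\<Sum>x\<in>S. p x * (f x)\<^sup>2)"
proof -
  have "(\<Sum>x\<in>S. p x * f x) = (\<Sum>x\<in>S. (if f x \<noteq> 0 then sqrt (p x) else 0) * (sqrt (p x) * f x))"
    by (intro sum.cong) (use assms in auto)
  then have "(\<Sum>x\<in>S. p x * f x)\<^sup>2 \<le>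
    (\<Sum>x\<in>S. (if f x \<noteq> 0 then sqrt (p x) else 0)\<^sup>2) * (\<Sum>x\<in>S. (sqrt (p x) * f x)\<^sup>2)"
    using Cauchy_Schwarz_ineq_sum by metis
  also have "(\<Sum>x\<in>S. (if f x \<noteq> 0 then sqrt (p x) else 0)\<^sup>2) = (\<Sum>x\<in>S. if f x \<noteq> 0 then p x else 0)"
    by (intro sum.cong) (use assms in auto)
  also have "(\<Sum>x\<in>S. (sqrt (p x) * f x)\<^sup>2) = (\<Sum>x\<in>S. p x * (f x)\<^sup>2)"
    by (intro sum.cong) (use assms in \<open>auto simp: power_mult_distrib\<close>)
  finally show ?thesis .
qed

text \<open>A probability measure on infinite words is encoded by the masses \<open>m I\<close> of its cylinders. Every
event below depends on finitely many letters only, so that all measures and integrals are sums over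
the words of one sufficiently large length. Up to the constant \<open>C\<close>, disjoint blocks
of letters are independent.\<close>

locale quasi_bernoulli =
  fixes D :: "'i set" and m :: "'i list \<Rightarrow> real" and C :: real
  assumes finite_alphabet: "finite D"
    and pos: "set I \<subseteq> D \<Longrightarrow> 0 < m I"
    and nil: "m [] = 1"
    and consistent: "set I \<subseteq> D \<Longrightarrow> (\<Sum>i\<in>D. m (I @ [i])) = m I"
    and upper: "set I \<subseteq> D \<Longrightarrow> set J \<subseteq> D \<Longrightarrow> m (I @ J) \<le> C * (m I * m J)"
    and lower: "set I \<subseteq> D \<Longrightarrow> set J \<subseteq> D \<Longrightarrow> m I * m J \<le> C * m (I @ J)"
begin

lemma C_ge_1: "1 \<le> C"
  using upper[of "[]" "[]"] by (simp add: nil)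

lemma sum_extensions: "set I \<subseteq> D \<Longrightarrow> (\<Sum>J\<in>words D n. m (I @ J)) = m I"
proof (induction n)
  case (Suc n)
  have "(\<Sum>J\<in>words D (n + Suc 0). m (I @ J)) = (\<Sum>J\<in>words D n. \<Sum>i\<in>D. m ((I @ J) @ [i]))"
    by (subst sum_words_append) (simp add: sum_words_1)
  also have "\<dots> = (\<Sum>J\<in>words D n. m (I @ J))"
    by (intro sum.cong refl consistent) (use Suc.prems in \<open>auto simp: words_def\<close>)
  finally show ?case using Suc by simp
qed simp

lemma sum_words_eq_1: "(\<Sum>J\<in>words D n. m J) = 1"
  using sum_extensions[of "[]" n] by (simp add: nil)

text \<open>\<open>I @ J\<close> runs through the extensions of a fixed prefix \<open>I\<close>. The event \<open>P\<close> is decided by the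
  first \<open>j\<close> letters of \<open>J\<close>, and \<open>v\<close> is read directly behind them, so the letters that follow \<open>v\<close>
  can be summed out by consistency.\<close>

lemma mass_read_at:
  assumes I: "set I \<subseteq> D" and v: "set v \<subseteq> D" and L: "j + length v \<le> L"
  shows "(\<Sum>J\<in>words D L. if P (take j J) \<and> take (length v) (drop j J) = v then m (I @ J) else 0) =
    (\<Sum>A\<in>words D j. if P A then m (I @ A @ v) else 0)"
proof -
  obtain r where r: "L = j + (length v + r)"
    using L by (metis add.assoc le_Suc_ex)
  have vw: "v \<in> words D (length v)" using v by (auto simp: words_def)
  have "(\<Sum>J\<in>words D L. if P (take j J) \<and> take (length v) (drop j J) = v then m (I @ J) else 0)
     = (\<Sum>A\<in>words D j. \<Sum>B\<in>words D (length v). \<Sum>R\<in>words D r.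
          if P A \<and> B = v then m (I @ A @ B @ R) else 0)"
    unfolding r sum_words_append
    by (intro sum.cong refl) (auto simp: words_def)
  also have "\<dots> = (\<Sum>A\<in>words D j. \<Sum>B\<in>words D (length v). if B = v then
       (\<Sum>R\<in>words D r. if P A then m (I @ A @ v @ R) else 0) else 0)"
    by (intro sum.cong refl) (auto intro!: sum.cong sum.neutral)
  also have "\<dots> = (\<Sum>A\<in>words D j. \<Sum>R\<in>words D r. if P A then m (I @ A @ v @ R) else 0)"
    using vw finite_alphabet by (simp add: sum.delta)
  also have "\<dots> = (\<Sum>A\<in>words D j. if P A then m (I @ A @ v) else 0)"
  proof (intro sum.cong refl)
    fix A assume "A \<in> words D j"
    then have "set (I @ A @ v) \<subseteq> D" using I v by (auto simp: words_def)
    from sum_extensions[OF this, of r]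
    show "(\<Sum>R\<in>words D r. if P A then m (I @ A @ v @ R) else 0) = (if P A then m (I @ A @ v) else 0)"
      by simp
  qed
  finally show ?thesis .
qed

definition reads :: "nat \<Rightarrow> 'i list \<Rightarrow> 'i list \<Rightarrow> bool" where
  "reads j v J \<longleftrightarrow> take (length v) (drop j J) = v"

lemma mass_read_upper:
  assumes I: "set I \<subseteq> D" and v: "set v \<subseteq> D" and L: "j + length v \<le> L"
  shows "(\<Sum>J\<in>words D L. if P (take j J) \<and> reads j v J then m (I @ J) else 0) \<le>
    C * m v * (\<Sum>A\<in>words D j. if P A then m (I @ A) else 0)"
  unfolding reads_def mass_read_at[OF assms] sum_distrib_left
proof (intro sum_mono)
  fix A assume "A \<in> words D j"
  then show "(if P A then m (I @ A @ v) else 0) \<le> C * m v * (if P A then m (I @ A) else 0)"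
    using upper[of "I @ A" v] I v by (auto simp: words_def algebra_simps)
qed

lemma mass_read_le:
  assumes I: "set I \<subseteq> D" and v: "set v \<subseteq> D" and L: "j + length v \<le> L"
  shows "(\<Sum>J\<in>words D L. if reads j v J then m (I @ J) else 0) \<le> C * m v * m I"
  using mass_read_upper[OF assms, of "\<lambda>_. True"] sum_extensions[OF I] by simp

lemma mass_read_ge:
  assumes I: "set I \<subseteq> D" and v: "set v \<subseteq> D" and L: "j + length v \<le> L"
  shows "m v * m I \<le> C * (\<Sum>J\<in>words D L. if reads j v J then m (I @ J) else 0)"
proof -
  have "m v * m I = (\<Sum>A\<in>words D j. m v * m (I @ A))"
    using sum_extensions[OF I] by (simp flip: sum_distrib_left)
  also have "\<dots> \<le> (\<Sum>A\<in>words D j. C * m (I @ A @ v))"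
  proof (intro sum_mono)
    fix A assume "A \<in> words D j"
    then show "m v * m (I @ A) \<le> C * m (I @ A @ v)"
      using lower[of "I @ A" v] I v by (auto simp: words_def algebra_simps)
  qed
  also have "\<dots> = C * (\<Sum>J\<in>words D L. if reads j v J then m (I @ J) else 0)"
    using mass_read_at[OF assms, of "\<lambda>_. True"] by (simp add: sum_distrib_left reads_def)
  finally show ?thesis .
qed

text \<open>Quasi-independence of two hits. If the occurrence of \<open>z a\<close> ends before position \<open>j\<close>, then the two
  blocks are disjoint. If it overlaps the occurrence of \<open>z b\<close>, then its part in front of position \<open>j\<close>
  is \<open>z (j - i)\<close>, because all targets are prefixes of one infinite word. This nesting of the
  targets around a common centre is what makes the sum of all overlap terms
  bounded by the convergent series \<open>\<Sum>k. m (z k)\<close>.\<close>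

lemma mass_read_both:
  assumes I: "set I \<subseteq> D" and z: "\<And>n. set (z n) \<subseteq> D" "\<And>n. length (z n) = n"
    "\<And>k n. k \<le> n \<Longrightarrow> take k (z n) = z k"
    and ij: "i < j" and Lj: "j + b \<le> L"
  shows "(\<Sum>J\<in>words D L. if reads i (z a) J \<and> reads j (z b) J then m (I @ J) else 0) \<le>
    C\<^sup>2 * m I * m (z b) * (m (z a) + m (z (j - i)))"
proof -
  \<comment> \<open>the number of letters of \<open>z a\<close> that are used: all of them, or those in front of position \<open>j\<close>\<close>
  define c where "c = (if i + a \<le> j then a else j - i)"
  have c: "c \<le> a" "i + c \<le> j" using ij by (auto simp: c_def)
  have C0: "0 \<le> C" using C_ge_1 by simp
  have imp: "reads i (z c) (take j J)" if "reads i (z a) J" for J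
  proof -
    have "take c (drop i (take j J)) = take c (take a (drop i J))"
      using c by (simp add: drop_take min_def)
    also have "\<dots> = z c" using that c z by (simp add: reads_def)
    finally show ?thesis by (simp add: reads_def z)
  qed
  have "(\<Sum>J\<in>words D L. if reads i (z a) J \<and> reads j (z b) J then m (I @ J) else 0)
      \<le> (\<Sum>J\<in>words D L. if reads i (z c) (take j J) \<and> reads j (z b) J then m (I @ J) else 0)"
    by (intro sum_mono) (use imp I in \<open>auto simp: words_def less_imp_le[OF pos]\<close>)
  also have "\<dots> \<le> C * m (z b) * (\<Sum>A\<in>words D j. if reads i (z c) A then m (I @ A) else 0)"
    using I z Lj by (intro mass_read_upper) auto
  also have "\<dots> \<le> C * m (z b) * (C * m (z c) * m I)"
    using I z c C0 by (intro mult_left_mono mass_read_le) (auto simp: less_imp_le[OF pos])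
  also have "\<dots> = C\<^sup>2 * m I * m (z b) * m (z c)" by (simp add: power2_eq_square)
  also have "\<dots> \<le> C\<^sup>2 * m I * m (z b) * (m (z a) + m (z (j - i)))"
    using I z C0 by (intro mult_left_mono) (auto simp: c_def less_imp_le[OF pos])
  finally show ?thesis .
qed

text \<open>The Kochen--Stone argument inside the cylinder of \<open>I\<close>: \<open>f\<close> counts the hits, its mean is comparable with
the sum \<open>S\<close> of the target masses, and its second moment is at most a multiple of \<open>S\<^sup>2\<close> as soon as
\<open>S \<ge> 1\<close>. A fixed proportion of the cylinder, independent of \<open>I\<close>, is therefore hit.\<close>

lemma mass_hit_ge:
  assumes I: "set I \<subseteq> D" and z: "\<And>n. set (z n) \<subseteq> D" "\<And>n. length (z n) = n"
    "\<And>k n. k \<le> n \<Longrightarrow> take k (z n) = z k"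
    and \<Lambda>: "\<And>n. (\<Sum>k<n. m (z k)) \<le> \<Lambda>"
    and S: "1 \<le> (\<Sum>j<T. m (z (\<kappa> j)))" and L: "\<And>j. j < T \<Longrightarrow> j + \<kappa> j \<le> L"
  shows "m I \<le> C ^ 2 * (C + 2 * C\<^sup>2 * (1 + \<Lambda>)) *
    (\<Sum>J\<in>words D L. if \<exists>j<T. reads j (z (\<kappa> j)) J then m (I @ J) else 0)"
proof -
  define S where "S = (\<Sum>j<T. m (z (\<kappa> j)))"
  define f where "f J = (\<Sum>j<T. of_bool (reads j (z (\<kappa> j)) J) :: real)" for J
  define Q where "Q = (\<Sum>J\<in>words D L. if \<exists>j<T. reads j (z (\<kappa> j)) J then m (I @ J) else 0)"
  have C0: "0 \<le> C" using C_ge_1 by simp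
  have mI: "0 < m I" using I by (rule pos)
  have mz: "0 < m (z n)" for n using z by (intro pos)
  have \<Lambda>0: "0 \<le> \<Lambda>" using \<Lambda>[of 0] by simp
  have S1: "1 \<le> S" using S by (simp add: S_def)
  have ww: "\<And>J. J \<in> words D L \<Longrightarrow> 0 < m (I @ J)"
    using I by (intro pos) (auto simp: words_def)
  have first: "S * m I \<le> C * (\<Sum>J\<in>words D L. m (I @ J) * f J)"
  proof -
    have "S * m I = (\<Sum>j<T. m (z (\<kappa> j)) * m I)" by (simp add: S_def sum_distrib_right)
    also have "\<dots> \<le> (\<Sum>j<T. C * (\<Sum>J\<in>words D L. if reads j (z (\<kappa> j)) J then m (I @ J) else 0))"
      using I z L by (intro sum_mono mass_read_ge) auto
    also have "\<dots> = C * (\<Sum>j<T. \<Sum>J\<in>words D L. m (I @ J) * of_bool (reads j (z (\<kappa> j)) J))"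
      by (simp add: sum_distrib_left of_bool_def if_distrib cong: if_cong)
    also have "\<dots> = C * (\<Sum>J\<in>words D L. m (I @ J) * f J)"
      unfolding f_def sum_distrib_left by (subst sum.swap) simp
    finally show ?thesis .
  qed
  define G where "G i j = (\<Sum>J\<in>words D L. if reads i (z (\<kappa> i)) J \<and> reads j (z (\<kappa> j)) J then m (I @ J) else 0)"
    for i j
  have Gsym: "G i j = G j i" for i j by (simp add: G_def conj_commute)
  have Gdiag: "G j j \<le> C * m I * m (z (\<kappa> j))" if "j < T" for j
    using mass_read_le[OF I z(1), of j "\<kappa> j" L] that L[of j] z by (simp add: G_def algebra_simps)
  have Goff: "G i j \<le> C\<^sup>2 * m I * m (z (\<kappa> j)) * (m (z (\<kappa> i)) + m (z (j - i)))" if "i < j" "j < T" for i j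
    unfolding G_def using that L I by (intro mass_read_both z) auto
  have lowtri: "(\<Sum>j<T. \<Sum>i<j. G i j) \<le> C\<^sup>2 * m I * (S * (S + \<Lambda>))"
  proof -
    have "(\<Sum>j<T. \<Sum>i<j. G i j) \<le>
      (\<Sum>j<T. \<Sum>i<j. C\<^sup>2 * m I * m (z (\<kappa> j)) * (m (z (\<kappa> i)) + m (z (j - i))))"
      by (intro sum_mono Goff) auto
    also have "\<dots> = (\<Sum>j<T. C\<^sup>2 * m I * m (z (\<kappa> j)) * ((\<Sum>i<j. m (z (\<kappa> i))) + (\<Sum>i<j. m (z (j - i)))))"
      by (simp only: sum.distrib[symmetric] sum_distrib_left)
    also have "\<dots> \<le> (\<Sum>j<T. C\<^sup>2 * m I * m (z (\<kappa> j)) * (S + \<Lambda>))"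
    proof (intro sum_mono mult_left_mono add_mono)
      fix j assume j: "j \<in> {..<T}"
      show "(\<Sum>i<j. m (z (\<kappa> i))) \<le> S"
        unfolding S_def using j mz by (intro sum_mono2) (auto simp: less_imp_le)
      have "(\<Sum>i<j. m (z (j - i))) = (\<Sum>k\<in>{1..j}. m (z k))"
        by (rule sum.reindex_bij_witness[where i = "\<lambda>k. j - k" and j = "\<lambda>i. j - i"]) auto
      also have "\<dots> \<le> (\<Sum>k<Suc j. m (z k))"
        using mz by (intro sum_mono2) (auto simp: less_imp_le)
      also have "\<dots> \<le> \<Lambda>" by (rule \<Lambda>)
      finally show "(\<Sum>i<j. m (z (j - i))) \<le> \<Lambda>" .
      show "0 \<le> C\<^sup>2 * m I * m (z (\<kappa> j))" using mI mz[of "\<kappa> j"] by simp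
    qed
    also have "\<dots> = C\<^sup>2 * m I * S * (S + \<Lambda>)"
      by (simp only: S_def[symmetric] sum_distrib_left[symmetric] sum_distrib_right[symmetric])
    also have "\<dots> = C\<^sup>2 * m I * (S * (S + \<Lambda>))" by simp
    finally show ?thesis .
  qed
  have split: "(\<Sum>i<n. \<Sum>j<n. G i j) = (\<Sum>j<n. G j j) + 2 * (\<Sum>j<n. \<Sum>i<j. G i j)" for n
  proof (induction n)
    case (Suc n)
    have "(\<Sum>i<Suc n. \<Sum>j<Suc n. G i j) = (\<Sum>i<n. \<Sum>j<n. G i j) + (\<Sum>i<n. G i n) + (\<Sum>j<n. G n j) + G n n"
      by (simp add: sum.distrib)
    also have "(\<Sum>j<n. G n j) = (\<Sum>i<n. G i n)" by (intro sum.cong refl Gsym)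
    finally show ?case using Suc by simp
  qed simp
  have "(\<Sum>J\<in>words D L. m (I @ J) * (f J)\<^sup>2) = (\<Sum>i<T. \<Sum>j<T. G i j)"
  proof -
    have "(\<Sum>J\<in>words D L. m (I @ J) * (f J)\<^sup>2) =
      (\<Sum>J\<in>words D L. \<Sum>i<T. \<Sum>j<T. if reads i (z (\<kappa> i)) J \<and> reads j (z (\<kappa> j)) J then m (I @ J) else 0)"
      unfolding power2_eq_square f_def sum_product
      unfolding sum_distrib_left
      by (intro sum.cong refl) auto
    also have "\<dots> = (\<Sum>i<T. \<Sum>J\<in>words D L. \<Sum>j<T. if reads i (z (\<kappa> i)) J \<and> reads j (z (\<kappa> j)) J then m (I @ J) else 0)"
      by (rule sum.swap)
    also have "\<dots> = (\<Sum>i<T. \<Sum>j<T. G i j)"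
      unfolding G_def by (intro sum.cong refl sum.swap)
    finally show ?thesis .
  qed
  also have "\<dots> \<le> C * m I * S + 2 * (C\<^sup>2 * m I * (S * (S + \<Lambda>)))"
  proof -
    have "(\<Sum>j<T. G j j) \<le> (\<Sum>j<T. C * m I * m (z (\<kappa> j)))" by (intro sum_mono Gdiag) auto
    also have "\<dots> = C * m I * S" by (simp add: S_def sum_distrib_left)
    finally show ?thesis using lowtri unfolding split by linarith
  qed
  also have "\<dots> \<le> C * m I * S\<^sup>2 + 2 * (C\<^sup>2 * m I * (S\<^sup>2 * (1 + \<Lambda>)))"
  proof -
    have "S \<le> S\<^sup>2" using S1 by (simp add: power2_eq_square)
    moreover have "S * (S + \<Lambda>) \<le> S\<^sup>2 * (1 + \<Lambda>)"
      using mult_right_mono[OF \<open>S \<le> S\<^sup>2\<close> \<Lambda>0] by (simp add: power2_eq_square algebra_simps)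
    ultimately show ?thesis using C0 mI by (intro add_mono mult_left_mono) auto
  qed
  also have "\<dots> = m I * S\<^sup>2 * (C + 2 * C\<^sup>2 * (1 + \<Lambda>))" by (simp add: algebra_simps)
  finally have sec: "(\<Sum>J\<in>words D L. m (I @ J) * (f J)\<^sup>2) \<le> m I * S\<^sup>2 * (C + 2 * C\<^sup>2 * (1 + \<Lambda>))" .
  have f0: "f J \<noteq> 0 \<longleftrightarrow> (\<exists>j<T. reads j (z (\<kappa> j)) J)" for J
    unfolding f_def by (subst sum_nonneg_eq_0_iff) auto
  have Q0: "0 \<le> Q" unfolding Q_def by (intro sum_nonneg) (auto simp: less_imp_le[OF ww])
  have "(S * m I)\<^sup>2 \<le> (C * (\<Sum>J\<in>words D L. m (I @ J) * f J))\<^sup>2"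
    using first S1 mI by (intro power_mono) auto
  also have "\<dots> \<le> C\<^sup>2 * (Q * (\<Sum>J\<in>words D L. m (I @ J) * (f J)\<^sup>2))"
    unfolding power_mult_distrib Q_def f0[symmetric] using finite_alphabet
    by (intro mult_left_mono second_moment) (auto simp: less_imp_le[OF ww])
  also have "\<dots> \<le> C\<^sup>2 * (Q * (m I * S\<^sup>2 * (C + 2 * C\<^sup>2 * (1 + \<Lambda>))))"
    using Q0 by (intro mult_left_mono sec) auto
  finally have "(m I * S\<^sup>2) * m I \<le> (m I * S\<^sup>2) * (C ^ 2 * (C + 2 * C\<^sup>2 * (1 + \<Lambda>)) * Q)"
    by (simp add: power2_eq_square algebra_simps)
  then show ?thesis unfolding Q_def[symmetric] using mI S1 by simp
qed

definition avoids :: "nat \<Rightarrow> (nat \<Rightarrow> 'i list) \<Rightarrow> 'i list \<Rightarrow> bool" where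
  "avoids n0 v K \<longleftrightarrow> (\<forall>n\<ge>n0. n + length (v n) \<le> length K \<longrightarrow> \<not> reads n (v n) K)"

text \<open>Every cylinder loses a fixed proportion \<open>1 / q\<close> of its mass over a long enough block of
further letters, since the divergent series makes the target masses of a late block sum to at least 1.
Iterating over successive blocks, the mass of the words without a hit decays geometrically. This
replaces a zero-one law.\<close>

theorem avoiding_mass_tendsto_0:
  assumes z: "\<And>n. set (z n) \<subseteq> D" "\<And>n. length (z n) = n"
    "\<And>k n. k \<le> n \<Longrightarrow> take k (z n) = z k"
    and \<Lambda>: "\<And>n. (\<Sum>k<n. m (z k)) \<le> \<Lambda>"
    and div: "\<not> summable (\<lambda>n. m (z (\<kappa> n)))" and \<epsilon>: "0 < \<epsilon>"
  shows "\<exists>M. (\<Sum>K\<in>words D M. if avoids n0 (\<lambda>n. z (\<kappa> n)) K then m K else 0) < \<epsilon>"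
proof -
  define a where "a M = (\<Sum>K\<in>words D M. if avoids n0 (\<lambda>n. z (\<kappa> n)) K then m K else 0)" for M
  define q where "q = C ^ 2 * (C + 2 * C\<^sup>2 * (1 + \<Lambda>))"
  have \<Lambda>0: "0 \<le> \<Lambda>" using \<Lambda>[of 0] by simp
  have "1 * 1 \<le> C\<^sup>2 * (C + 2 * C\<^sup>2 * (1 + \<Lambda>))"
    using C_ge_1 \<Lambda>0 by (intro mult_mono) (auto simp: add_increasing2)
  then have q: "1 \<le> q" by (simp add: q_def)
  have step: "\<exists>M'\<ge>M. a M' \<le> (1 - 1 / q) * a M" if M: "n0 \<le> M" for M
  proof -
    have "\<exists>T. 1 \<le> (\<Sum>j<T. m (z (\<kappa> (M + j))))"
    proof (rule ccontr)
      assume "\<not> ?thesis"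
      then have "summable (\<lambda>j. m (z (\<kappa> (M + j))))"
        by (intro summableI_nonneg_bounded[where x = 1]) (auto simp: less_imp_le pos z not_le)
      then show False using div summable_iff_shift[of "\<lambda>n. m (z (\<kappa> n))" M] by (simp add: add.commute)
    qed
    then obtain T where T: "1 \<le> (\<Sum>j<T. m (z (\<kappa> (M + j))))" by blast
    define L where "L = (\<Sum>j<T. j + \<kappa> (M + j))"
    have L: "j + \<kappa> (M + j) \<le> L" if "j < T" for j
      unfolding L_def using that member_le_sum[of j "{..<T}" "\<lambda>j. j + \<kappa> (M + j)"] by auto
    have "a (M + L) \<le> (\<Sum>I\<in>words D M. \<Sum>J\<in>words D L. if avoids n0 (\<lambda>n. z (\<kappa> n)) I \<and>
       \<not> (\<exists>j<T. reads j (z (\<kappa> (M + j))) J) then m (I @ J) else 0)"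
      unfolding a_def sum_words_append
    proof (intro sum_mono)
      fix I J assume IJ: "I \<in> words D M" "J \<in> words D L"
      then have *: "length I = M" "length J = L" "0 < m (I @ J)"
        by (auto simp: words_def intro!: pos)
      have "avoids n0 (\<lambda>n. z (\<kappa> n)) I \<and> \<not> (\<exists>j<T. reads j (z (\<kappa> (M + j))) J)"
        if av: "avoids n0 (\<lambda>n. z (\<kappa> n)) (I @ J)"
      proof (intro conjI notI)
        show "avoids n0 (\<lambda>n. z (\<kappa> n)) I"
          using av * by (auto simp: avoids_def reads_def z)
        assume "\<exists>j<T. reads j (z (\<kappa> (M + j))) J"
        then obtain j where j: "j < T" "reads j (z (\<kappa> (M + j))) J" by blast
        then have "reads (M + j) (z (\<kappa> (M + j))) (I @ J)" using * by (simp add: reads_def z)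
        moreover have "\<not> reads (M + j) (z (\<kappa> (M + j))) (I @ J)"
          using av L[OF j(1)] * M unfolding avoids_def z by auto
        ultimately show False by simp
      qed
      then show "(if avoids n0 (\<lambda>n. z (\<kappa> n)) (I @ J) then m (I @ J) else 0) \<le>
        (if avoids n0 (\<lambda>n. z (\<kappa> n)) I \<and> \<not> (\<exists>j<T. reads j (z (\<kappa> (M + j))) J) then m (I @ J) else 0)"
        using *(3) by auto
    qed
    also have "\<dots> \<le> (\<Sum>I\<in>words D M. (1 - 1 / q) * (if avoids n0 (\<lambda>n. z (\<kappa> n)) I then m I else 0))"
    proof (intro sum_mono)
      fix I assume "I \<in> words D M"
      then have I: "set I \<subseteq> D" by (auto simp: words_def)
      let ?h = "\<lambda>J. \<exists>j<T. reads j (z (\<kappa> (M + j))) J"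
      let ?b = "\<Sum>J\<in>words D L. if ?h J then m (I @ J) else 0"
      let ?c = "\<Sum>J\<in>words D L. if \<not> ?h J then m (I @ J) else 0"
      have hit: "m I \<le> q * ?b"
        unfolding q_def using L by (intro mass_hit_ge I z \<Lambda> T) auto
      have total: "?b + ?c = m I"
        unfolding sum.distrib[symmetric] sum_extensions[OF I, of L, symmetric]
        by (intro sum.cong) auto
      have "m I / q \<le> ?b" using hit q by (simp add: pos_divide_le_eq mult.commute)
      then have "?c \<le> m I - m I / q" using total by linarith
      then have "?c \<le> (1 - 1 / q) * m I" by (simp add: algebra_simps)
      then show "(\<Sum>J\<in>words D L. if avoids n0 (\<lambda>n. z (\<kappa> n)) I \<and> \<not> ?h J then m (I @ J) else 0)
         \<le> (1 - 1 / q) * (if avoids n0 (\<lambda>n. z (\<kappa> n)) I then m I else 0)"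
        by auto
    qed
    also have "\<dots> = (1 - 1 / q) * a M" by (simp add: a_def sum_distrib_left)
    finally show ?thesis by (intro exI[of _ "M + L"]) auto
  qed
  have q1: "0 \<le> 1 - 1 / q" using q by simp
  have iter: "\<exists>M\<ge>n0. a M \<le> (1 - 1 / q) ^ j" for j
  proof (induction j)
    case 0
    have "a n0 \<le> (\<Sum>K\<in>words D n0. m K)"
      unfolding a_def by (intro sum_mono) (auto simp: words_def less_imp_le pos)
    then show ?case by (auto simp: sum_words_eq_1)
  next
    case (Suc j)
    then obtain M where M: "M \<ge> n0" "a M \<le> (1 - 1 / q) ^ j" by blast
    obtain M' where M': "M' \<ge> M" "a M' \<le> (1 - 1 / q) * a M" using step[OF M(1)] by blast
    note M'(2)
    also have "(1 - 1 / q) * a M \<le> (1 - 1 / q) ^ Suc j" using M(2) q1 by (simp add: mult_left_mono)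
    finally show ?case using M M' by (intro exI[of _ M']) auto
  qed
  obtain j where "(1 - 1 / q) ^ j < \<epsilon>"
    using real_arch_pow_inv[OF \<epsilon>, of "1 - 1 / q"] q by auto
  with iter[of j] show ?thesis unfolding a_def by (meson le_less_trans)
qed

end

section \<open>The critical exponent and the Gibbs measure of a quasi-multiplicative weight\<close>

text \<open>The weight \<open>w I\<close> stands for the contraction ratio of the map of the word \<open>I\<close>, which bounded
distortion makes multiplicative up to a constant.\<close>

locale quasi_multiplicative =
  fixes D :: "'i set" and w :: "'i list \<Rightarrow> real" and B \<rho> :: real
  assumes finite_alphabet: "finite D" and nonempty_alphabet: "D \<noteq> {}"
    and pos: "set I \<subseteq> D \<Longrightarrow> 0 < w I"
    and nil: "w [] = 1"
    and upper: "set I \<subseteq> D \<Longrightarrow> set J \<subseteq> D \<Longrightarrow> w (I @ J) \<le> B * (w I * w J)"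
    and lower: "set I \<subseteq> D \<Longrightarrow> set J \<subseteq> D \<Longrightarrow> w I * w J \<le> B * w (I @ J)"
    and decay: "set I \<subseteq> D \<Longrightarrow> w I \<le> \<rho> ^ length I" and \<rho>: "0 < \<rho>" "\<rho> < 1"
begin

lemma B_ge_1: "1 \<le> B"
  using upper[of "[]" "[]"] by (simp add: nil)

definition Z :: "real \<Rightarrow> nat \<Rightarrow> real" where
  "Z s n = (\<Sum>I\<in>words D n. w I powr s)"

lemma powr_upper:
  assumes "0 \<le> s" "set I \<subseteq> D" "set J \<subseteq> D"
  shows "w (I @ J) powr s \<le> B powr s * (w I powr s * w J powr s)"
proof -
  have "w (I @ J) powr s \<le> (B * (w I * w J)) powr s"
    using assms upper pos[of "I @ J"] by (intro powr_mono2) auto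
  also have "\<dots> = B powr s * (w I powr s * w J powr s)"
    using pos[OF assms(2)] pos[OF assms(3)] B_ge_1 by (simp add: powr_mult)
  finally show ?thesis .
qed

lemma powr_lower:
  assumes "0 \<le> s" "set I \<subseteq> D" "set J \<subseteq> D"
  shows "w I powr s * w J powr s \<le> B powr s * w (I @ J) powr s"
proof -
  have p: "0 < w I" "0 < w J" "0 < w (I @ J)" using assms by (auto intro!: pos)
  have "(w I * w J) powr s \<le> (B * w (I @ J)) powr s"
    using assms lower p by (intro powr_mono2) auto
  then show ?thesis using p B_ge_1 by (simp add: powr_mult)
qed

lemma Z_upper: "0 \<le> s \<Longrightarrow> Z s (m + n) \<le> B powr s * (Z s m * Z s n)"
  unfolding Z_def sum_words_append sum_product unfolding sum_distrib_left
  by (intro sum_mono powr_upper) (auto simp: words_def)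

lemma Z_lower: "0 \<le> s \<Longrightarrow> Z s m * Z s n \<le> B powr s * Z s (m + n)"
  unfolding Z_def sum_words_append sum_product unfolding sum_distrib_left
  by (intro sum_mono powr_lower) (auto simp: words_def)

lemma words_nonempty: "words D n \<noteq> {}"
  using card_words[OF finite_alphabet, of n] nonempty_alphabet finite_alphabet
  by (metis card.empty card_0_eq power_not_zero)

lemma Z_pos: "0 < Z s n"
  unfolding Z_def
proof (rule sum_pos)
  show "0 < w I powr s" if "I \<in> words D n" for I
    using that pos[of I] by (simp add: words_def)
qed (simp_all add: finite_alphabet words_nonempty)

lemma Z_0: "0 \<le> s \<Longrightarrow> Z s 0 = 1"
  by (simp add: Z_def nil)

lemma continuous_Z: "continuous_on A (\<lambda>s. Z s n)"
  unfolding Z_def by (intro continuous_intros) (auto simp: words_def dest: pos)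

text \<open>The function \<open>n \<mapsto> B\<^sup>s Z s n\<close> is submultiplicative. Hence these are the exponents \<open>s \<ge> 0\<close> of
non-negative pressure, described without passing to the limit that defines the pressure.\<close>

definition admissible :: "real set" where
  "admissible = {s. 0 \<le> s \<and> (\<forall>n. 1 \<le> B powr s * Z s n)}"

lemma bounded_admissible: "\<exists>b. \<forall>s\<in>admissible. s \<le> b"
proof -
  obtain n where n: "\<rho> ^ n < 1 / B"
    using real_arch_pow_inv[of "1 / B" \<rho>] B_ge_1 \<rho> by auto
  define \<beta> where "\<beta> = B * \<rho> ^ n"
  have \<beta>: "0 < \<beta>" "\<beta> < 1" using n B_ge_1 \<rho> by (auto simp: \<beta>_def field_simps)
  have "s \<le> ln (card (words D n)) / - ln \<beta>" if s: "s \<in> admissible" for s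
  proof -
    have "Z s n \<le> (\<Sum>I\<in>words D n. (\<rho> ^ n) powr s)"
      unfolding Z_def
    proof (rule sum_mono)
      fix I assume "I \<in> words D n"
      then show "w I powr s \<le> (\<rho> ^ n) powr s"
        using decay[of I] s pos[of I] by (intro powr_mono2) (auto simp: words_def admissible_def)
    qed
    then have "B powr s * Z s n \<le> B powr s * (card (words D n) * (\<rho> ^ n) powr s)"
      by (intro mult_left_mono) auto
    moreover have "1 \<le> B powr s * Z s n" using s by (simp add: admissible_def)
    ultimately have "1 \<le> B powr s * (card (words D n) * (\<rho> ^ n) powr s)" by linarith
    then have "1 \<le> card (words D n) * \<beta> powr s"
      using B_ge_1 \<rho> by (simp add: \<beta>_def powr_mult algebra_simps)
    then have "0 \<le> ln (card (words D n) * \<beta> powr s)" by simp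
    also have "\<dots> = ln (card (words D n)) + s * ln \<beta>"
      using \<beta> words_nonempty[of n] finite_alphabet by (subst ln_mult) (auto simp: card_gt_0_iff ln_powr)
    finally have "s * (- ln \<beta>) \<le> ln (card (words D n))" by simp
    then show ?thesis using \<beta> by (subst pos_le_divide_eq) auto
  qed
  then show ?thesis by blast
qed

text \<open>The largest admissible \<open>s\<close> is the zero of the pressure, and quasi-multiplicativity upgrades zero
pressure to two-sided bounds on \<open>Z s n\<close> that are uniform in \<open>n\<close>.\<close>

lemma critical_exponent:
  "\<exists>s\<ge>0. \<forall>n. B powr - s \<le> Z s n \<and> Z s n \<le> B powr s"
proof -
  obtain b where b: "\<And>s. s \<in> admissible \<Longrightarrow> s \<le> b" using bounded_admissible by blast
  have Z0: "1 \<le> Z 0 n" for n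
  proof -
    have "Z 0 n = (\<Sum>I\<in>words D n. 1)"
      unfolding Z_def by (intro sum.cong refl) (auto simp: words_def dest: pos)
    also have "\<dots> \<ge> 1" using words_nonempty[of n] finite_alphabet by (simp add: Suc_le_eq card_gt_0_iff)
    finally show ?thesis by simp
  qed
  have "closed admissible"
  proof -
    have "admissible = {0..} \<inter> (\<Inter>n. {s. 1 \<le> B powr s * Z s n})" by (auto simp: admissible_def)
    moreover have "closed {s. 1 \<le> B powr s * Z s n}" for n
      using B_ge_1 by (intro closed_Collect_le continuous_intros continuous_Z) auto
    ultimately show ?thesis by (auto intro!: closed_Int closed_INT)
  qed
  moreover have "bounded admissible"
    using b by (auto simp: bounded_iff admissible_def intro!: exI[of _ b])
  moreover have "0 \<in> admissible" using Z0 B_ge_1 by (auto simp: admissible_def)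
  ultimately obtain s where s: "s \<in> admissible" and max: "\<And>t. t \<in> admissible \<Longrightarrow> t \<le> s"
    using compact_attains_sup[of admissible] by (auto simp: compact_eq_bounded_closed)
  have s0: "0 \<le> s" using s by (simp add: admissible_def)
  have "Z s k \<le> B powr s" for k
  proof (rule ccontr)
    assume "\<not> Z s k \<le> B powr s"
    \<comment> \<open>beyond \<open>s\<close> some \<open>B\<^sup>t Z\<^sub>l\<close> drops below 1, while \<open>B\<^sup>-\<^sup>t Z\<^sub>k\<close> still exceeds 1; this
      contradicts the two multiplicativity estimates at length \<open>k l\<close>\<close>
    then have "1 < B powr - s * Z s k" using B_ge_1 by (simp add: powr_minus field_simps)
    moreover have "isCont (\<lambda>t. B powr - t * Z t k) s"
      using B_ge_1 continuous_Z[of UNIV k]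
      by (intro continuous_intros) (auto simp: continuous_on_eq_continuous_at)
    ultimately have "eventually (\<lambda>t. 1 < B powr - t * Z t k) (at s)"
      by (metis isCont_def order_tendstoD(1))
    then have "eventually (\<lambda>t. 1 < B powr - t * Z t k) (at_right s)"
      by (simp add: eventually_at_split)
    then have "eventually (\<lambda>t. 1 < B powr - t * Z t k \<and> s < t) (at_right s)"
      by (intro eventually_conj) (simp_all add: eventually_at_right_less)
    then obtain t where t: "1 < B powr - t * Z t k" "s < t"
      using eventually_happens[of _ "at_right s"] by (auto simp: trivial_limit_at_right_real)
    have t0: "0 \<le> t" using t s0 by simp
    from t max have "t \<notin> admissible" by force
    then obtain l where l: "B powr t * Z t l < 1" using t0 by (auto simp: admissible_def not_le)
    have up: "B powr t * Z t (l * j) \<le> (B powr t * Z t l) ^ j" if "0 < j" for j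
      using that
    proof (induction j rule: nat_induct_non_zero)
      case (Suc j)
      have "B powr t * Z t (l * Suc j) \<le> B powr t * (B powr t * (Z t l * Z t (l * j)))"
        using Z_upper[OF t0, of l "l * j"] by (intro mult_left_mono) auto
      also have "\<dots> = (B powr t * Z t l) * (B powr t * Z t (l * j))" by simp
      also have "\<dots> \<le> (B powr t * Z t l) * (B powr t * Z t l) ^ j"
        using Suc Z_pos[of t l] by (intro mult_left_mono) auto
      finally show ?case by simp
    qed simp
    have low: "(B powr - t * Z t k) ^ j \<le> B powr - t * Z t (k * j)" if "0 < j" for j
      using that
    proof (induction j rule: nat_induct_non_zero)
      case (Suc j)
      have "(B powr - t * Z t k) ^ Suc j \<le> (B powr - t * Z t k) * (B powr - t * Z t (k * j))"
        using Suc Z_pos[of t k] by (simp add: mult_left_mono)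
      also have "\<dots> = (B powr - t) * ((B powr - t) * (Z t k * Z t (k * j)))" by simp
      also have "\<dots> \<le> (B powr - t) * ((B powr - t) * (B powr t * Z t (k + k * j)))"
        by (intro mult_left_mono Z_lower t0) auto
      also have "\<dots> = B powr - t * Z t (k * Suc j)"
        using B_ge_1 by (simp add: powr_minus)
      finally show ?case .
    qed simp
    have l0: "0 < l"
    proof (rule ccontr)
      assume "\<not> 0 < l"
      then have "B powr t < 1" using l Z_0[OF t0] by simp
      then show False using ge_one_powr_ge_zero[OF B_ge_1 t0] by simp
    qed
    have k0: "0 < k"
    proof (rule ccontr)
      assume "\<not> 0 < k"
      then have "1 < B powr - t" using t Z_0[OF t0] by simp
      then show False using powr_mono[of "- t" 0 B] B_ge_1 t0 by simp
    qed
    have "1 < (B powr - t * Z t k) ^ l" using t l0 by (simp add: one_less_power)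
    also have "\<dots> \<le> B powr - t * Z t (k * l)" by (rule low[OF l0])
    also have "\<dots> \<le> B powr t * Z t (k * l)"
      using B_ge_1 t0 Z_pos[of t "k * l"] by (intro mult_right_mono powr_mono) auto
    also have "\<dots> \<le> (B powr t * Z t l) ^ k" using up[OF k0] by (simp add: mult.commute)
    also have "\<dots> \<le> 1" using l Z_pos[of t l] by (intro power_le_one) auto
    finally show False by simp
  qed
  moreover have "B powr - s \<le> Z s n" for n
    using s B_ge_1 by (auto simp: admissible_def powr_minus field_simps)
  ultimately show ?thesis using s0 by blast
qed

text \<open>Distributing unit mass over the words of length \<open>N\<close> in proportion to \<open>w\<^sup>s\<close> defines masses
  \<open>M N I\<close> for all shorter words, additive and comparable with \<open>w\<^sup>s\<close>. Both properties pass to a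
  subsequential limit as \<open>N\<close> grows, where additivity holds at every length.\<close>

theorem gibbs_measure:
  assumes s: "0 \<le> s" and Zs: "\<And>n. B powr - s \<le> Z s n" "\<And>n. Z s n \<le> B powr s"
  obtains m where "quasi_bernoulli D m (B powr (10 * s))"
    "\<And>I. set I \<subseteq> D \<Longrightarrow> w I powr s \<le> B powr (3 * s) * m I"
    "\<And>I. set I \<subseteq> D \<Longrightarrow> m I \<le> B powr (3 * s) * w I powr s"
proof -
  define M where "M N I = (if length I \<le> N then (\<Sum>J\<in>words D (N - length I). w (I @ J) powr s) / Z s N else 0)"
    for N I
  have B0: "0 < B" using B_ge_1 by simp
  have "s + s + s = 3 * s" by simp
  then have thrice: "B powr (3 * s) = B powr s * (B powr s * B powr s)"
    by (metis powr_add mult.assoc)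
  have up: "M N I \<le> B powr (3 * s) * w I powr s" if I: "set I \<subseteq> D" "length I \<le> N" for N I
  proof -
    have "(\<Sum>J\<in>words D (N - length I). w (I @ J) powr s) \<le>
      (\<Sum>J\<in>words D (N - length I). B powr s * (w I powr s * w J powr s))"
      using I s by (intro sum_mono powr_upper) (auto simp: words_def)
    also have "\<dots> = B powr s * w I powr s * Z s (N - length I)"
      by (simp add: Z_def sum_distrib_left mult.assoc)
    also have "\<dots> \<le> B powr s * w I powr s * B powr s"
      by (intro mult_left_mono Zs) auto
    finally have "M N I \<le> (B powr s * w I powr s * B powr s) / Z s N"
      using that Z_pos[of s N] by (simp add: M_def divide_right_mono)
    also have "\<dots> \<le> (B powr s * w I powr s * B powr s) / B powr - s"
      using Zs(1) B0 by (intro divide_left_mono) (auto intro!: mult_pos_pos Z_pos)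
    also have "\<dots> = B powr (3 * s) * w I powr s"
      unfolding thrice by (simp add: powr_minus field_simps)
    finally show ?thesis .
  qed
  have low: "w I powr s \<le> B powr (3 * s) * M N I" if I: "set I \<subseteq> D" "length I \<le> N" for N I
  proof -
    have "w I powr s * B powr - s \<le> w I powr s * Z s (N - length I)"
      by (intro mult_left_mono Zs) auto
    also have "\<dots> = (\<Sum>J\<in>words D (N - length I). w I powr s * w J powr s)"
      by (simp add: Z_def sum_distrib_left)
    also have "\<dots> \<le> (\<Sum>J\<in>words D (N - length I). B powr s * w (I @ J) powr s)"
      using I s by (intro sum_mono powr_lower) (auto simp: words_def)
    also have "\<dots> = B powr s * (M N I * Z s N)"
      using Z_pos[of s N] that by (simp add: M_def sum_distrib_left)
    also have "\<dots> \<le> B powr s * (M N I * B powr s)"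
    proof -
      have "0 \<le> M N I" using Z_pos[of s N] by (auto simp: M_def intro!: divide_nonneg_pos sum_nonneg)
      then show ?thesis by (intro mult_left_mono Zs) auto
    qed
    finally have "B powr s * (w I powr s * B powr - s) \<le> B powr s * (B powr s * (M N I * B powr s))"
      by (intro mult_left_mono) auto
    then have "w I powr s \<le> B powr (3 * s) * M N I"
      using B0 unfolding thrice by (simp add: powr_minus field_simps)
    then show ?thesis .
  qed
  have cons: "(\<Sum>i\<in>D. M N (I @ [i])) = M N I" if len: "set I \<subseteq> D" "Suc (length I) \<le> N" for N I
  proof -
    obtain r where r: "N = length I + Suc 0 + r" using len(2) by (metis add_Suc_right add_0_right le_Suc_ex)
    have "(\<Sum>J\<in>words D (Suc 0 + r). w (I @ J) powr s) = (\<Sum>i\<in>D. \<Sum>J\<in>words D r. w ((I @ [i]) @ J) powr s)"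
      by (subst sum_words_append) (simp add: sum_words_1)
    then show ?thesis by (simp add: M_def r sum_divide_distrib[symmetric])
  qed
  have bdd: "norm (M N I) \<le> B powr (3 * s)" if I: "I \<in> lists D" for N I
  proof -
    have ID: "set I \<subseteq> D" using I by auto
    have "w I \<le> 1"
      using decay[OF ID] power_le_one[of \<rho> "length I"] \<rho> by linarith
    then have "w I powr s \<le> 1 powr s"
      using s pos[OF ID] by (intro powr_mono2) auto
    then have "w I powr s \<le> 1" by simp
    then have "M N I \<le> B powr (3 * s) * 1" if "length I \<le> N"
    proof -
      have "M N I \<le> B powr (3 * s) * w I powr s" by (rule up[OF ID that])
      also have "\<dots> \<le> B powr (3 * s) * 1" using \<open>w I powr s \<le> 1\<close> by (intro mult_left_mono) auto
      finally show ?thesis .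
    qed
    moreover have "0 \<le> M N I" using Z_pos[of s N] by (auto simp: M_def intro!: divide_nonneg_pos sum_nonneg)
    ultimately show ?thesis by (cases "length I \<le> N") (auto simp: M_def)
  qed
  have "countable (lists D)" using finite_alphabet by (simp add: countable_finite)
  then obtain k :: "nat \<Rightarrow> nat" where k: "strict_mono k"
    and lim: "\<forall>I\<in>lists D. \<exists>l. (\<lambda>n. M (k n) I) \<longlonglongrightarrow> l"
    by (rule function_convergent_subsequence[of "lists D" M "B powr (3 * s)"]) (use bdd in auto)
  obtain m where m: "\<And>I. I \<in> lists D \<Longrightarrow> (\<lambda>n. M (k n) I) \<longlonglongrightarrow> m I"
    using lim by metis
  have ev: "eventually (\<lambda>n. r \<le> k n) sequentially" for r
    using filterlim_subseq[OF k] by (auto simp: filterlim_at_top)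
  have mup: "m I \<le> B powr (3 * s) * w I powr s" if "set I \<subseteq> D" for I
    by (rule tendsto_upperbound[OF m])
      (use that in \<open>auto intro!: eventually_mono[OF ev[of "length I"]] up\<close>)
  have mlow: "w I powr s \<le> B powr (3 * s) * m I" if "set I \<subseteq> D" for I
    by (rule tendsto_lowerbound[OF tendsto_mult_left[OF m]])
      (use that in \<open>auto intro!: eventually_mono[OF ev[of "length I"]] low\<close>)
  have wp: "0 < w I powr s" if "set I \<subseteq> D" for I using pos[OF that] by simp
  have mpos: "0 < m I" if "set I \<subseteq> D" for I
    using less_le_trans[OF wp[OF that] mlow[OF that]] B0 by (simp add: zero_less_mult_iff)
  have mcons: "(\<Sum>i\<in>D. m (I @ [i])) = m I" if I: "set I \<subseteq> D" for I
  proof (rule LIMSEQ_unique)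
    show "(\<lambda>n. M (k n) I) \<longlonglongrightarrow> m I" using I by (intro m) auto
    have "(\<lambda>n. \<Sum>i\<in>D. M (k n) (I @ [i])) \<longlonglongrightarrow> (\<Sum>i\<in>D. m (I @ [i]))"
      using I by (intro tendsto_sum m) auto
    then show "(\<lambda>n. M (k n) I) \<longlonglongrightarrow> (\<Sum>i\<in>D. m (I @ [i]))"
      by (rule Lim_transform_eventually)
        (use I in \<open>auto intro!: eventually_mono[OF ev[of "Suc (length I)"]] cons\<close>)
  qed
  have mnil: "m [] = 1"
  proof (rule LIMSEQ_unique)
    show "(\<lambda>n. M (k n) []) \<longlonglongrightarrow> m []" by (intro m) auto
    have "M N [] = 1" for N using Z_pos[of s N] by (simp add: M_def Z_def[symmetric])
    then show "(\<lambda>n. M (k n) []) \<longlonglongrightarrow> 1" by simp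
  qed
  have split10: "B powr (10 * s) = B powr (3 * s) * (B powr s * (B powr (3 * s) * B powr (3 * s)))"
    by (simp flip: powr_add)
  have "quasi_bernoulli D m (B powr (10 * s))"
  proof
    fix I J assume IJ: "set I \<subseteq> D" "set J \<subseteq> D"
    have "m (I @ J) \<le> B powr (3 * s) * w (I @ J) powr s" using IJ by (intro mup) auto
    also have "\<dots> \<le> B powr (3 * s) * (B powr s * (w I powr s * w J powr s))"
      by (intro mult_left_mono powr_upper s IJ) auto
    also have "\<dots> \<le> B powr (3 * s) * (B powr s * ((B powr (3 * s) * m I) * (B powr (3 * s) * m J)))"
      using IJ mpos[of I] by (intro mult_left_mono mult_mono mlow) auto
    finally show "m (I @ J) \<le> B powr (10 * s) * (m I * m J)" unfolding split10 by (simp only: mult_ac)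
    have "m I * m J \<le> (B powr (3 * s) * w I powr s) * (B powr (3 * s) * w J powr s)"
      using IJ mpos[of J] by (intro mult_mono mup) auto
    also have "\<dots> = B powr (3 * s) * (B powr (3 * s) * (w I powr s * w J powr s))" by simp
    also have "\<dots> \<le> B powr (3 * s) * (B powr (3 * s) * (B powr s * w (I @ J) powr s))"
      by (intro mult_left_mono powr_lower s IJ) auto
    also have "\<dots> \<le> B powr (3 * s) * (B powr (3 * s) * (B powr s * (B powr (3 * s) * m (I @ J))))"
      using IJ by (intro mult_left_mono mlow) auto
    finally show "m I * m J \<le> B powr (10 * s) * m (I @ J)" unfolding split10 by (simp only: mult_ac)
  qed (use finite_alphabet mpos mnil mcons in auto)
  then show thesis using mlow mup that by blast
qed

end

section \<open>Hausdorff measure\<close>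

lemma rpow_nonneg: "0 \<le> rpow x s"
  by (simp add: rpow_def)

lemma rpow_pos: "0 < s \<Longrightarrow> rpow x s = x powr s"
  by (simp add: rpow_def)

lemma hausdorff_content_le_cover:
  assumes "E \<subseteq> (\<Union>k. U k)" "\<And>k. bounded (U k)" "\<And>k. diameter (U k) \<le> \<delta>"
  shows "hausdorff_content s \<delta> E \<le> (\<Sum>k. if U k = {} then 0 else ennreal (rpow (diameter (U k)) s))"
  unfolding hausdorff_content_def by (rule INF_lower) (use assms in auto)

lemma hausdorff_content_mono: "E \<subseteq> F \<Longrightarrow> hausdorff_content s \<delta> E \<le> hausdorff_content s \<delta> F"
  unfolding hausdorff_content_def by (rule INF_superset_mono) auto

lemma hausdorff_measure_mono: "E \<subseteq> F \<Longrightarrow> hausdorff_measure s E \<le> hausdorff_measure s F"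
  unfolding hausdorff_measure_def by (rule SUP_mono') (rule hausdorff_content_mono)

lemma hausdorff_content_le_measure: "0 < \<delta> \<Longrightarrow> hausdorff_content s \<delta> E \<le> hausdorff_measure s E"
  unfolding hausdorff_measure_def by (rule SUP_upper) simp

lemma hausdorff_content_empty:
  assumes "0 < \<delta>" shows "hausdorff_content s \<delta> {} = 0"
  using hausdorff_content_le_cover[of "{}" "\<lambda>_. {}" \<delta> s] assms by simp

lemma hausdorff_content_single:
  assumes "bounded A" "diameter A \<le> \<delta>" "0 < \<delta>"
  shows "hausdorff_content s \<delta> A \<le> ennreal (rpow (diameter A) s)"
proof -
  let ?U = "\<lambda>k::nat. if k = 0 then A else {}"
  have "hausdorff_content s \<delta> A \<le> (\<Sum>k. if ?U k = {} then 0 else ennreal (rpow (diameter (?U k)) s))"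
    by (rule hausdorff_content_le_cover) (use assms in \<open>auto split: if_splits\<close>)
  also have "\<dots> = (\<Sum>k\<in>{0}. if ?U k = {} then 0 else ennreal (rpow (diameter (?U k)) s))"
    by (rule suminf_finite) auto
  also have "\<dots> \<le> ennreal (rpow (diameter A) s)" by simp
  finally show ?thesis .
qed

text \<open>Covers of the \<open>E n\<close> that are optimal up to \<open>e / 2\<^sup>n\<^sup>+\<^sup>1\<close> combine to one cover of the union, indexed
through a bijection between pairs and natural numbers.\<close>

lemma hausdorff_content_UN_le:
  assumes \<delta>: "0 < \<delta>"
  shows "hausdorff_content s \<delta> (\<Union>n::nat. E n) \<le> (\<Sum>n. hausdorff_content s \<delta> (E n))"
proof (cases "\<exists>n. hausdorff_content s \<delta> (E n) = \<infinity>")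
  case True
  then obtain n where "hausdorff_content s \<delta> (E n) = \<infinity>" by blast
  moreover have "hausdorff_content s \<delta> (E n) \<le> (\<Sum>n. hausdorff_content s \<delta> (E n))"
    using sum_le_suminf[of "\<lambda>n. hausdorff_content s \<delta> (E n)" "{n}"] by simp
  ultimately show ?thesis by (simp add: top.extremum_unique)
next
  case False
  let ?f = "\<lambda>A::'a set. if A = {} then 0 else ennreal (rpow (diameter A) s)"
  show ?thesis
  proof (rule ennreal_le_epsilon)
    fix e :: real assume e: "0 < e"
    define \<eta> where "\<eta> n = ennreal (e * (1 / 2) ^ Suc n)" for n
    have "\<exists>U. E n \<subseteq> (\<Union>k::nat. U k) \<and> (\<forall>k. bounded (U k) \<and> diameter (U k) \<le> \<delta>) \<and>
      (\<Sum>k. ?f (U k)) \<le> hausdorff_content s \<delta> (E n) + \<eta> n" for n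
    proof -
      have "hausdorff_content s \<delta> (E n) < hausdorff_content s \<delta> (E n) + \<eta> n"
        using False e ennreal_add_left_cancel_less[of "hausdorff_content s \<delta> (E n)" 0 "\<eta> n"]
        by (simp add: \<eta>_def)
      then obtain U where "E n \<subseteq> (\<Union>k::nat. U k)" "\<forall>k. bounded (U k) \<and> diameter (U k) \<le> \<delta>"
        "(\<Sum>k. ?f (U k)) < hausdorff_content s \<delta> (E n) + \<eta> n"
        unfolding hausdorff_content_def INF_less_iff by auto
      then show ?thesis by (meson less_imp_le)
    qed
    then have "\<forall>n. \<exists>U. E n \<subseteq> (\<Union>k::nat. U k) \<and> (\<forall>k. bounded (U k) \<and> diameter (U k) \<le> \<delta>) \<and>
      (\<Sum>k. ?f (U k)) \<le> hausdorff_content s \<delta> (E n) + \<eta> n" by blast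
    from choice[OF this] obtain U where U: "\<And>n. E n \<subseteq> (\<Union>k::nat. U n k)"
      "\<And>n k. bounded (U n k)" "\<And>n k. diameter (U n k) \<le> \<delta>"
      "\<And>n. (\<Sum>k. ?f (U n k)) \<le> hausdorff_content s \<delta> (E n) + \<eta> n"
      by blast
    define W where "W k = (case prod_decode k of (n, j) \<Rightarrow> U n j)" for k
    have "hausdorff_content s \<delta> (\<Union>n. E n) \<le> (\<Sum>k. ?f (W k))"
    proof (rule hausdorff_content_le_cover)
      show "(\<Union>n. E n) \<subseteq> (\<Union>k. W k)"
      proof
        fix x assume "x \<in> (\<Union>n. E n)"
        then obtain n j where "x \<in> U n j" using U(1) by blast
        then have "x \<in> W (prod_encode (n, j))" by (simp add: W_def)
        then show "x \<in> (\<Union>k. W k)" by blast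
      qed
    qed (auto simp: W_def U split: prod.split)
    also have "\<dots> = (\<Sum>k. (\<lambda>(n, j). ?f (U n j)) (prod_decode k))"
      by (intro arg_cong[where f = suminf] ext) (simp add: W_def split: prod.split)
    also have "\<dots> = (\<Sum>n. \<Sum>j. ?f (U n j))"
      using suminf_ennreal_2dimen[of "\<lambda>n. \<Sum>j. ?f (U n j)" "\<lambda>(n, j). ?f (U n j)"]
      by (simp add: comp_def)
    also have "\<dots> \<le> (\<Sum>n. hausdorff_content s \<delta> (E n) + \<eta> n)"
      by (intro suminf_le U(4)) auto
    also have "\<dots> = (\<Sum>n. hausdorff_content s \<delta> (E n)) + (\<Sum>n. \<eta> n)"
      by (rule suminf_add[symmetric]) auto
    also have "(\<Sum>n. \<eta> n) = ennreal e"
      unfolding \<eta>_def using sums_mult[OF power_half_series, of e] e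
      by (intro suminf_ennreal_eq) auto
    finally show "hausdorff_content s \<delta> (\<Union>n. E n) \<le> (\<Sum>n. hausdorff_content s \<delta> (E n)) + ennreal e" .
  qed
qed

lemma hausdorff_content_UN_finite_le:
  assumes "0 < \<delta>" "finite F"
  shows "hausdorff_content s \<delta> (\<Union>i\<in>F. E i) \<le> (\<Sum>i\<in>F. hausdorff_content s \<delta> (E i))"
  using assms(2)
proof (induction F)
  case empty
  then show ?case using assms(1) by (simp add: hausdorff_content_empty)
next
  case (insert i F)
  let ?G = "\<lambda>n::nat. if n = 0 then E i else if n = 1 then (\<Union>i\<in>F. E i) else {}"
  have "?G 0 \<union> ?G 1 \<subseteq> (\<Union>n. ?G n)" by blast
  then have "(\<Union>i\<in>insert i F. E i) \<subseteq> (\<Union>n. ?G n)" by simp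
  then have "hausdorff_content s \<delta> (\<Union>i\<in>insert i F. E i) \<le> (\<Sum>n. hausdorff_content s \<delta> (?G n))"
    by (rule order_trans[OF hausdorff_content_mono hausdorff_content_UN_le[OF assms(1)]])
  also have "\<dots> = (\<Sum>n<2. hausdorff_content s \<delta> (?G n))"
    by (rule suminf_finite) (auto simp: hausdorff_content_empty assms)
  also have "\<dots> = hausdorff_content s \<delta> (E i) + hausdorff_content s \<delta> (\<Union>i\<in>F. E i)"
    by (simp add: numeral_2_eq_2)
  also have "\<dots> \<le> (\<Sum>i\<in>insert i F. hausdorff_content s \<delta> (E i))"
    using insert by (simp add: add_left_mono)
  finally show ?case .
qed

lemma hausdorff_content_finite_cover:
  assumes "0 < \<delta>" "finite F" "E \<subseteq> (\<Union>i\<in>F. A i)"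
    "\<And>i. i \<in> F \<Longrightarrow> bounded (A i)" "\<And>i. i \<in> F \<Longrightarrow> diameter (A i) \<le> \<delta>"
  shows "hausdorff_content s \<delta> E \<le> ennreal (\<Sum>i\<in>F. rpow (diameter (A i)) s)"
proof -
  have "hausdorff_content s \<delta> E \<le> (\<Sum>i\<in>F. hausdorff_content s \<delta> (A i))"
    using hausdorff_content_mono[OF assms(3)] hausdorff_content_UN_finite_le[OF assms(1,2)]
    by (rule order_trans)
  also have "\<dots> \<le> (\<Sum>i\<in>F. ennreal (rpow (diameter (A i)) s))"
    using assms by (intro sum_mono hausdorff_content_single) auto
  also have "\<dots> = ennreal (\<Sum>i\<in>F. rpow (diameter (A i)) s)"
    by (rule sum_ennreal) (simp add: rpow_nonneg)
  finally show ?thesis .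
qed

lemma hausdorff_measure_UN_null:
  assumes "\<And>n::nat. hausdorff_measure s (E n) = 0"
  shows "hausdorff_measure s (\<Union>n. E n) = 0"
proof -
  have "hausdorff_content s \<delta> (\<Union>n. E n) = 0" if "0 < \<delta>" for \<delta>
  proof -
    have "hausdorff_content s \<delta> (E n) = 0" for n
      using hausdorff_content_le_measure[OF that, of s "E n"] assms by simp
    then show ?thesis using hausdorff_content_UN_le[OF that, of s E] by simp
  qed
  then show ?thesis by (simp add: hausdorff_measure_def)
qed

lemma hausdorff_measure_eq_0I:
  assumes "\<And>\<delta> \<epsilon>. 0 < \<delta> \<Longrightarrow> 0 < \<epsilon> \<Longrightarrow> hausdorff_content s \<delta> E \<le> ennreal \<epsilon>"
  shows "hausdorff_measure s E = 0"
proof -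
  have "hausdorff_content s \<delta> E \<le> 0" if "0 < \<delta>" for \<delta>
    by (rule ennreal_le_epsilon) (use assms[OF that] in \<open>simp only: add_0_left\<close>)
  then show ?thesis by (simp add: hausdorff_measure_def)
qed

text \<open>Sets of diameter at most 1 contribute less for a larger exponent; hence the passage from the scale
\<open>\<delta>\<close> to \<open>min \<delta> 1\<close>.\<close>

lemma hausdorff_measure_exponent_antimono:
  assumes "0 \<le> t" "t \<le> s"  "hausdorff_measure t E = 0"
  shows "hausdorff_measure s E = 0"
proof (rule hausdorff_measure_eq_0I)
  fix \<delta> \<epsilon> :: real assume \<delta>: "0 < \<delta>" and \<epsilon>: "0 < \<epsilon>"
  define \<gamma> where "\<gamma> = min \<delta> 1"
  have \<gamma>: "0 < \<gamma>" "\<gamma> \<le> \<delta>" "\<gamma> \<le> 1" using \<delta> by (auto simp: \<gamma>_def)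
  have le: "rpow d s \<le> rpow d t" if "0 \<le> d" "d \<le> 1" for d
    using that assms powr_mono'[of t s d] powr_le1[of s d] by (auto simp: rpow_def)
  have "hausdorff_content t \<gamma> E \<le> hausdorff_measure t E" by (rule hausdorff_content_le_measure[OF \<gamma>(1)])
  with assms(3) have "hausdorff_content t \<gamma> E < ennreal \<epsilon>" using \<epsilon> by simp
  then obtain U where U: "E \<subseteq> (\<Union>k::nat. U k)" "\<And>k. bounded (U k)" "\<And>k. diameter (U k) \<le> \<gamma>"
    "(\<Sum>k. if U k = {} then 0 else ennreal (rpow (diameter (U k)) t)) < ennreal \<epsilon>"
    unfolding hausdorff_content_def INF_less_iff by auto
  have "hausdorff_content s \<delta> E \<le> (\<Sum>k. if U k = {} then 0 else ennreal (rpow (diameter (U k)) s))"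
    using U \<gamma> by (intro hausdorff_content_le_cover) (auto intro: order_trans)
  also have "\<dots> \<le> (\<Sum>k. if U k = {} then 0 else ennreal (rpow (diameter (U k)) t))"
    using U \<gamma> by (intro suminf_le) (auto intro!: ennreal_leI le diameter_ge_0 intro: order_trans)
  finally show "hausdorff_content s \<delta> E \<le> ennreal \<epsilon>" using U(4) by simp
qed

lemma hausdorff_dim_eqI:
  assumes "0 \<le> s" "hausdorff_measure s E > 0" "\<And>t. s < t \<Longrightarrow> hausdorff_measure t E = 0"
  shows "hausdorff_dim E = s"
  unfolding hausdorff_dim_def
proof (rule antisym)
  let ?S = "{t. 0 \<le> t \<and> hausdorff_measure t E = 0}"
  have low: "s \<le> t" if "t \<in> ?S" for t
  proof (rule ccontr)
    assume "\<not> s \<le> t"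
    then show False using hausdorff_measure_exponent_antimono[of t s E] that assms(2) by auto
  qed
  have bdd: "bdd_below ?S" by (rule bdd_belowI[of _ 0]) auto
  have "s + 1 \<in> ?S" using assms by auto
  then show "s \<le> Inf ?S" using low by (intro cInf_greatest) auto
  show "Inf ?S \<le> s"
  proof (rule field_le_epsilon)
    fix e :: real assume "0 < e"
    then show "Inf ?S \<le> s + e" using assms bdd by (intro cInf_lower) auto
  qed
qed

lemma hausdorff_dim_le:
  assumes "0 \<le> s" "\<And>t. s < t \<Longrightarrow> hausdorff_measure t E = 0"
  shows "hausdorff_dim E \<le> s"
proof (rule field_le_epsilon)
  fix e :: real assume "0 < e"
  then show "hausdorff_dim E \<le> s + e"
    unfolding hausdorff_dim_def using assms by (intro cInf_lower bdd_belowI[of _ 0]) auto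
qed

section \<open>Iterated function systems and the convergence part\<close>

lemma word_map_Nil [simp]: "word_map \<phi> [] x = x"
  by (simp add: word_map_def)

lemma word_map_Cons [simp]: "word_map \<phi> (i # I) x = \<phi> i (word_map \<phi> I x)"
  by (simp add: word_map_def)

lemma word_map_Cons_comp: "word_map \<phi> (i # I) = \<phi> i \<circ> word_map \<phi> I"
  by (simp add: word_map_def)

lemma word_map_append: "word_map \<phi> (I @ J) x = word_map \<phi> I (word_map \<phi> J x)"
  by (induction I) auto

lemma word_map_in:
  assumes "\<And>i. i \<in> D \<Longrightarrow> \<phi> i ` A \<subseteq> A" "set I \<subseteq> D" "x \<in> A"
  shows "word_map \<phi> I x \<in> A"
  using assms(2) by (induction I) (use assms(1,3) in auto)

lemma word_map_contracts:
  assumes "\<And>i. i \<in> D \<Longrightarrow> \<phi> i ` A \<subseteq> A"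
    and "\<And>i x y. i \<in> D \<Longrightarrow> x \<in> A \<Longrightarrow> y \<in> A \<Longrightarrow> dist (\<phi> i x) (\<phi> i y) \<le> r * dist x y"
    and "0 \<le> r" "set I \<subseteq> D" "x \<in> A" "y \<in> A"
  shows "dist (word_map \<phi> I x) (word_map \<phi> I y) \<le> r ^ length I * dist x y"
  using assms(4)
proof (induction I)
  case (Cons i I)
  then have "dist (word_map \<phi> (i # I) x) (word_map \<phi> (i # I) y) \<le>
      r * dist (word_map \<phi> I x) (word_map \<phi> I y)"
    unfolding word_map_Cons using Cons.prems assms(5,6)
    by (intro assms(2) word_map_in[where D = D]) (auto simp: assms(1))
  also have "\<dots> \<le> r * (r ^ length I * dist x y)"
    using Cons assms(3) by (intro mult_left_mono) auto
  finally show ?case by simp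
qed simp

lemma self_similar_words:
  assumes "X = (\<Union>i\<in>D. \<phi> i ` X)"
  shows "X = (\<Union>I\<in>words D n. word_map \<phi> I ` X)"
proof (induction n)
  case (Suc n)
  have "(\<Union>I\<in>words D (Suc n). word_map \<phi> I ` X) = (\<Union>i\<in>D. \<Union>I\<in>words D n. \<phi> i ` word_map \<phi> I ` X)"
  proof -
    have "words D (Suc n) = (\<Union>i\<in>D. (#) i ` words D n)"
      by (auto simp: words_def length_Suc_conv image_iff)
    then show ?thesis by (auto simp: image_iff)
  qed
  also have "\<dots> = (\<Union>i\<in>D. \<phi> i ` X)"
    by (subst (2) Suc.IH) (simp only: image_UN)
  finally have "(\<Union>I\<in>words D (Suc n). word_map \<phi> I ` X) = (\<Union>i\<in>D. \<phi> i ` X)" .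
  from trans[OF assms this[symmetric]] show ?case .
qed simp

lemma uniform_contraction_ratio:
  assumes "finite D" "D \<noteq> {}" "\<And>i. i \<in> D \<Longrightarrow> contraction_on A (\<phi> i)"
  obtains r where "0 < r" "r < 1"
    "\<And>i x y. i \<in> D \<Longrightarrow> x \<in> A \<Longrightarrow> y \<in> A \<Longrightarrow> dist (\<phi> i x) (\<phi> i y) \<le> r * dist x y"
proof -
  obtain \<rho> where \<rho>: "\<And>i. i \<in> D \<Longrightarrow> 0 < \<rho> i \<and> \<rho> i < 1 \<and> (\<rho> i)-lipschitz_on A (\<phi> i)"
    using assms(3) unfolding contraction_on_def by metis
  define r where "r = Max (\<rho> ` D)"
  have le: "\<rho> i \<le> r" if "i \<in> D" for i using that assms(1) by (simp add: r_def)
  have "r \<in> \<rho> ` D" using assms(1,2) by (simp add: r_def)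
  then have "0 < r" "r < 1" using \<rho> by auto
  moreover have "dist (\<phi> i x) (\<phi> i y) \<le> r * dist x y" if "i \<in> D" "x \<in> A" "y \<in> A" for i x y
  proof -
    have "dist (\<phi> i x) (\<phi> i y) \<le> \<rho> i * dist x y"
      using \<rho>[OF \<open>i \<in> D\<close>] that by (auto intro: lipschitz_onD)
    also have "\<dots> \<le> r * dist x y" using le[OF \<open>i \<in> D\<close>] by (intro mult_right_mono) auto
    finally show ?thesis .
  qed
  ultimately show thesis using that by blast
qed

text \<open>The Hausdorff--Cantelli lemma: each tail of the family of balls covers the limsup set. For
  \<open>s = 0\<close> every word contributes 1 to the series, which then diverges.\<close>

theorem limsup_set_null:
  assumes ifs: "ifs D \<phi> K" and X: "attractor D \<phi> K X" and s: "0 \<le> s"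
    and \<Psi>: "\<And>I. I \<in> words_star D \<Longrightarrow> 0 \<le> \<Psi> I" and conv: "word_series D \<Psi> s < \<infinity>"
  shows "hausdorff_measure s (limsup_set D \<phi> X \<Psi> z) = 0"
proof -
  have D: "finite D" "D \<noteq> {}" using ifs X by (auto simp: ifs_def attractor_def)
  define b where "b n = (\<Sum>I\<in>words D (Suc n). rpow (\<Psi> I) s)" for n
  have b0: "0 \<le> b n" for n by (simp add: b_def sum_nonneg rpow_nonneg)
  have "word_series D \<Psi> s = (\<Sum>n. ennreal (b n))"
    by (simp add: word_series_def b_def sum_ennreal rpow_nonneg)
  then have sum: "summable b" using conv b0 by (intro summable_suminf_not_top) auto
  have s0: "0 < s"
  proof (rule ccontr)
    assume "\<not> 0 < s"
    then have "s = 0" using s by simp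
    then have "b n = card D ^ Suc n" for n using D by (simp add: b_def rpow_def card_words)
    moreover have "1 \<le> card D ^ Suc n" for n using D by (simp add: Suc_le_eq card_gt_0_iff)
    ultimately have "1 \<le> b n" for n by (metis of_nat_1 of_nat_le_iff)
    moreover have "b \<longlonglongrightarrow> 0" using sum by (rule summable_LIMSEQ_zero)
    ultimately show False using LIMSEQ_le_const[of b 0 1] by force
  qed
  show ?thesis
  proof (rule hausdorff_measure_eq_0I)
    fix \<delta> \<epsilon> :: real assume \<delta>: "0 < \<delta>" and \<epsilon>: "0 < \<epsilon>"
    define c where "c = min (\<epsilon> / 2 powr s) ((\<delta> / 2) powr s)"
    have c: "0 < c" using \<delta> \<epsilon> by (auto simp: c_def)
    obtain N where N: "\<And>n. n \<ge> N \<Longrightarrow> norm (\<Sum>i. b (i + n)) < c" using suminf_exist_split[OF c sum] by blast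
    have tail: "summable (\<lambda>i. b (i + N))" using sum by (simp add: summable_iff_shift)
    have tc: "(\<Sum>i. b (i + N)) < c" using N[of N] by auto
    have rad: "\<Psi> I \<le> \<delta> / 2" if I: "I \<in> words D (Suc (i + N))" for I i
    proof -
      have "\<Psi> I powr s \<le> b (i + N)"
        unfolding b_def using D s0 I by (subst rpow_pos[symmetric]) (auto intro!: member_le_sum rpow_nonneg)
      also have "\<dots> \<le> (\<Sum>i. b (i + N))" using sum_le_suminf[OF tail, of "{i}"] b0 by simp
      also have "\<dots> < (\<delta> / 2) powr s" using tc by (simp add: c_def)
      finally have "\<Psi> I powr s < (\<delta> / 2) powr s" .
      then show ?thesis using powr_mono2[of s "\<delta> / 2" "\<Psi> I"] \<delta> s0 by (cases "\<Psi> I \<le> \<delta> / 2") auto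
    qed
    have "limsup_set D \<phi> X \<Psi> z \<subseteq> (\<Union>i. \<Union>I\<in>words D (Suc (i + N)). cball (word_map \<phi> I z) (\<Psi> I))"
    proof
      fix x assume "x \<in> limsup_set D \<phi> X \<Psi> z"
      then have inf: "infinite {I \<in> words_star D. x \<in> cball (word_map \<phi> I z) (\<Psi> I)}" by (simp add: limsup_set_def)
      have "finite {I. set I \<subseteq> D \<and> length I \<le> N}" using D by (intro finite_lists_length_le)
      then have "\<not> {I \<in> words_star D. x \<in> cball (word_map \<phi> I z) (\<Psi> I)} \<subseteq> {I. set I \<subseteq> D \<and> length I \<le> N}"
        using inf by (meson finite_subset)
      then obtain I where I: "I \<in> words_star D" "x \<in> cball (word_map \<phi> I z) (\<Psi> I)"
        "\<not> (set I \<subseteq> D \<and> length I \<le> N)" by auto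
      then have "I \<in> words D (Suc ((length I - Suc N) + N))" by (auto simp: words_star_def words_def)
      then show "x \<in> (\<Union>i. \<Union>I\<in>words D (Suc (i + N)). cball (word_map \<phi> I z) (\<Psi> I))" using I by blast
    qed
    then have "hausdorff_content s \<delta> (limsup_set D \<phi> X \<Psi> z) \<le>
      (\<Sum>i. hausdorff_content s \<delta> (\<Union>I\<in>words D (Suc (i + N)). cball (word_map \<phi> I z) (\<Psi> I)))"
      by (rule order_trans[OF hausdorff_content_mono hausdorff_content_UN_le[OF \<delta>]])
    also have "\<dots> \<le> (\<Sum>i. ennreal (2 powr s * b (i + N)))"
    proof (intro suminf_le)
      fix i
      have dm: "0 \<le> \<Psi> I" "diameter (cball (word_map \<phi> I z) (\<Psi> I)) = 2 * \<Psi> I" if "I \<in> words D (Suc (i + N))" for I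
        using \<Psi>[OF words_in_words_star[OF that]] by auto
      have "hausdorff_content s \<delta> (\<Union>I\<in>words D (Suc (i + N)). cball (word_map \<phi> I z) (\<Psi> I)) \<le>
        ennreal (\<Sum>I\<in>words D (Suc (i + N)). rpow (diameter (cball (word_map \<phi> I z) (\<Psi> I))) s)"
      proof (intro hausdorff_content_finite_cover)
        show "diameter (cball (word_map \<phi> I z) (\<Psi> I)) \<le> \<delta>" if "I \<in> words D (Suc (i + N))" for I
          using rad[OF that] dm(2)[OF that] by linarith
      qed (use D \<delta> in auto)
      also have "(\<Sum>I\<in>words D (Suc (i + N)). rpow (diameter (cball (word_map \<phi> I z) (\<Psi> I))) s) = 2 powr s * b (i + N)"
        unfolding b_def sum_distrib_left using dm s0
        by (intro sum.cong refl) (auto simp: rpow_pos powr_mult)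
      finally show "hausdorff_content s \<delta> (\<Union>I\<in>words D (Suc (i + N)). cball (word_map \<phi> I z) (\<Psi> I)) \<le>
        ennreal (2 powr s * b (i + N))" .
    qed auto
    also have "\<dots> = ennreal (\<Sum>i. 2 powr s * b (i + N))"
      using b0 tail by (intro suminf_ennreal2) (auto intro: summable_mult)
    also have "(\<Sum>i. 2 powr s * b (i + N)) = 2 powr s * (\<Sum>i. b (i + N))"
      using tail by (rule suminf_mult)
    also have "ennreal \<dots> \<le> ennreal \<epsilon>"
    proof (rule ennreal_leI)
      have "2 powr s * (\<Sum>i. b (i + N)) \<le> 2 powr s * (\<epsilon> / 2 powr s)"
        using tc by (intro mult_left_mono) (auto simp: c_def)
      then show "2 powr s * (\<Sum>i. b (i + N)) \<le> \<epsilon>" by simp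
    qed
    finally show "hausdorff_content s \<delta> (limsup_set D \<phi> X \<Psi> z) \<le> ennreal \<epsilon>" .
  qed
qed

text \<open>The set of exponents in the definition of the dimension has to be non-empty: with ratio
  \<open>r\<close> and \<open>N\<close> maps every exponent \<open>s\<close> with \<open>N r\<^sup>s < 1\<close> belongs to it.\<close>

lemma attractor_dim_nonneg:
  assumes ifs: "ifs D \<phi> K" and X: "attractor D \<phi> K X"
  shows "0 \<le> hausdorff_dim X"
proof -
  have D: "finite D" "D \<noteq> {}" and cpt: "compact X" and XK: "X \<subseteq> K"
    and self: "X = (\<Union>i\<in>D. \<phi> i ` X)"
    using ifs X by (auto simp: ifs_def attractor_def)
  have inv: "\<phi> i ` X \<subseteq> X" if "i \<in> D" for i by (subst (2) self) (use that in blast)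
  have "\<And>i. i \<in> D \<Longrightarrow> contraction_on X (\<phi> i)"
    using ifs XK unfolding ifs_def contraction_on_def by (meson lipschitz_on_subset)
  then obtain r where r: "0 < r" "r < 1"
    "\<And>i x y. i \<in> D \<Longrightarrow> x \<in> X \<Longrightarrow> y \<in> X \<Longrightarrow> dist (\<phi> i x) (\<phi> i y) \<le> r * dist x y"
    using uniform_contraction_ratio[OF D] by blast
  define d where "d = diameter X + 1"
  have d: "0 < d" "\<And>x y. x \<in> X \<Longrightarrow> y \<in> X \<Longrightarrow> dist x y \<le> d"
  proof -
    show "0 < d" using diameter_ge_0[OF compact_imp_bounded[OF cpt]] by (simp add: d_def)
    show "dist x y \<le> d" if "x \<in> X" "y \<in> X" for x y
      using diameter_bounded_bound[OF compact_imp_bounded[OF cpt] that] by (simp add: d_def)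
  qed
  have bd: "bounded (word_map \<phi> I ` X)" "diameter (word_map \<phi> I ` X) \<le> r ^ n * d"
    if "I \<in> words D n" for I n
  proof -
    have I: "set I \<subseteq> D" "length I = n" using that by (auto simp: words_def)
    show "bounded (word_map \<phi> I ` X)"
      using compact_imp_bounded[OF cpt] word_map_in[OF inv I(1)] by (auto intro: bounded_subset)
    have "dist (word_map \<phi> I x) (word_map \<phi> I y) \<le> r ^ n * d" if "x \<in> X" "y \<in> X" for x y
    proof -
      have "dist (word_map \<phi> I x) (word_map \<phi> I y) \<le> r ^ length I * dist x y"
        using r by (intro word_map_contracts[OF inv _ _ I(1)] that) auto
      also have "\<dots> \<le> r ^ n * d"
        using d(2)[OF that] r I by (intro mult_mono) auto
      finally show ?thesis .
    qed
    then show "diameter (word_map \<phi> I ` X) \<le> r ^ n * d"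
      using d r by (intro diameter_le) (auto simp: dist_norm)
  qed
  obtain k where k: "r ^ k < 1 / (card D + 1)" using real_arch_pow_inv[of "1 / (card D + 1)" r] r by auto
  define q where "q = card D * r ^ k"
  have q: "0 \<le> q" "q < 1"
  proof -
    have "card D * r ^ k \<le> (card D + 1) * r ^ k" using r by (simp add: algebra_simps)
    also have "\<dots> < 1" using k by (simp add: field_simps)
    finally show "q < 1" by (simp add: q_def)
  qed (use r in \<open>simp add: q_def\<close>)
  have k0: "0 < k"
    using k by (cases k) (auto simp: field_simps)
  have "hausdorff_measure (real k) X = 0"
  proof (rule hausdorff_measure_eq_0I)
    fix \<delta> \<epsilon> :: real assume \<delta>: "0 < \<delta>" and \<epsilon>: "0 < \<epsilon>"
    have "(\<lambda>n. r ^ n * d) \<longlonglongrightarrow> 0 * d" by (intro tendsto_intros LIMSEQ_realpow_zero) (use r in auto)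
    then have e1: "eventually (\<lambda>n. r ^ n * d < \<delta>) sequentially" using \<delta> by (auto dest: order_tendstoD)
    have "(\<lambda>n. q ^ n * d ^ k) \<longlonglongrightarrow> 0 * d ^ k" by (intro tendsto_intros LIMSEQ_realpow_zero) (use q in auto)
    then have e2: "eventually (\<lambda>n. q ^ n * d ^ k < \<epsilon>) sequentially" using \<epsilon> by (auto dest: order_tendstoD)
    obtain n where n: "r ^ n * d < \<delta>" "q ^ n * d ^ k < \<epsilon>"
      using eventually_conj[OF e1 e2] by (auto simp: eventually_sequentially)
    have "hausdorff_content (real k) \<delta> X \<le> ennreal (\<Sum>I\<in>words D n. rpow (diameter (word_map \<phi> I ` X)) (real k))"
    proof (intro hausdorff_content_finite_cover)
      show "X \<subseteq> (\<Union>I\<in>words D n. word_map \<phi> I ` X)"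
        using self_similar_words[OF self, of n] by simp
      show "diameter (word_map \<phi> I ` X) \<le> \<delta>" if "I \<in> words D n" for I
        using bd(2)[OF that] n(1) by linarith
    qed (use bd(1) D \<delta> in auto)
    also have "\<dots> \<le> ennreal (\<Sum>I\<in>words D n. (r ^ n * d) powr real k)"
      using bd k0 bd(1) by (intro ennreal_leI sum_mono) (auto simp: rpow_def intro!: powr_mono2 diameter_ge_0)
    also have "(\<Sum>I\<in>words D n. (r ^ n * d) powr real k) = q ^ n * d ^ k"
      using r d D by (simp add: card_words powr_realpow q_def power_mult_distrib
          power_mult[symmetric] mult.commute[of n])
    also have "ennreal \<dots> \<le> ennreal \<epsilon>" using n by (intro ennreal_leI) auto
    finally show "hausdorff_content (real k) \<delta> X \<le> ennreal \<epsilon>" .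
  qed
  then show ?thesis unfolding hausdorff_dim_def by (intro cInf_greatest) (auto intro!: exI[of _ "real k"])
qed

section \<open>Maps whose derivative scales all vectors equally\<close>

text \<open>As long as a ball around \<open>f x\<close> lies in the image, the inverse is \<open>1 / \<mu>\<close>-Lipschitz on it by the mean
value theorem, so its points come from a compact subset of \<open>ball x \<rho>\<close>. If the ball is smaller than
claimed, then its closure lies in the image too, and the image, being open, extends further.\<close>

lemma expanding_image_contains_ball:
  fixes f :: "'a::euclidean_space \<Rightarrow> 'a"
  assumes \<mu>: "0 < \<mu>" and \<rho>: "0 < \<rho>" and inj: "inj_on f (ball x \<rho>)"
    and deriv: "\<And>y. y \<in> ball x \<rho> \<Longrightarrow> \<exists>A. (f has_derivative A) (at y) \<and> (\<forall>v. \<mu> * norm v \<le> norm (A v))"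
  shows "ball (f x) (\<mu> * \<rho>) \<subseteq> f ` ball x \<rho>"
    and "\<And>y. y \<in> ball x \<rho> \<Longrightarrow> dist (f x) (f y) < \<mu> * \<rho> \<Longrightarrow> \<mu> * dist x y \<le> dist (f x) (f y)"
proof -
  define W where "W = f ` ball x \<rho>"
  define g where "g = inv_into (ball x \<rho>) f"
  have gf: "g (f y) = y" if "y \<in> ball x \<rho>" for y
    using inv_into_f_f[OF inj that] by (simp add: g_def)
  have cont: "continuous_on (ball x \<rho>) f"
    using deriv by (meson continuous_at_imp_continuous_on has_derivative_continuous)
  have openW: "open W" unfolding W_def using cont inj by (intro invariance_of_domain) auto
  have "\<forall>w\<in>W. \<exists>G. (g has_derivative G) (at w) \<and> onorm G \<le> 1 / \<mu>"
  proof
    fix w assume "w \<in> W"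
    obtain y where y: "y \<in> ball x \<rho>" "w = f y" using \<open>w \<in> W\<close> by (auto simp: W_def)
    obtain A where A: "(f has_derivative A) (at y)" "\<And>v. \<mu> * norm v \<le> norm (A v)"
      using deriv[OF y(1)] by blast
    have linA: "linear A" using A(1) has_derivative_linear by blast
    have "v = 0" if "A v = 0" for v
    proof -
      have "\<mu> * norm v \<le> 0" using A(2)[of v] that by simp
      then show ?thesis using \<mu> by (simp add: mult_le_0_iff)
    qed
    then have "inj A" using linA by (simp add: linear_injective_0)
    then obtain G where G: "linear G" "A \<circ> G = id" using linear_injective_isomorphism[OF linA]
      by (auto simp: fun_eq_iff)
    have "(g has_derivative G) (at (f y))"
      by (rule has_derivative_inverse_strong[OF open_ball y(1) cont gf A(1) G(2)])
    moreover have "onorm G \<le> 1 / \<mu>"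
    proof (rule onorm_le)
      fix v have "A (G v) = v" using G(2) by (metis comp_apply id_apply)
      then have "\<mu> * norm (G v) \<le> norm v" using A(2)[of "G v"] by simp
      then show "norm (G v) \<le> 1 / \<mu> * norm v" using \<mu> by (simp add: field_simps)
    qed
    ultimately show "\<exists>G. (g has_derivative G) (at w) \<and> onorm G \<le> 1 / \<mu>" using y by blast
  qed
  from bchoice[OF this] obtain G where G: "\<And>w. w \<in> W \<Longrightarrow> (g has_derivative G w) (at w)" "\<And>w. w \<in> W \<Longrightarrow> onorm (G w) \<le> 1 / \<mu>"
    by blast
  have inverse_bound: "dist x (g p) \<le> dist (f x) p / \<mu>" if R: "ball (f x) R \<subseteq> W" "p \<in> ball (f x) R" for R p
  proof -
    have "norm (g (f x) - g p) \<le> 1 / \<mu> * norm (f x - p)"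
    proof (rule differentiable_bound[of "ball (f x) R" g G])
      show "(g has_derivative G w) (at w within ball (f x) R)" if "w \<in> ball (f x) R" for w
        using G(1)[of w] R that by (metis has_derivative_at_withinI subsetD)
      show "f x \<in> ball (f x) R" using order_le_less_trans[OF zero_le_dist, of "f x" p R] R(2) by simp
    qed (use G(2) R in auto)
    then show ?thesis using gf[of x] \<rho> by (simp add: dist_norm)
  qed
  show sub: "ball (f x) (\<mu> * \<rho>) \<subseteq> f ` ball x \<rho>"
  proof (rule ccontr)
    assume "\<not> ball (f x) (\<mu> * \<rho>) \<subseteq> f ` ball x \<rho>"
    then obtain p where p: "p \<in> ball (f x) (\<mu> * \<rho>)" "p \<in> - W"
      unfolding W_def by blast
    \<comment> \<open>\<open>q\<close> is the first point of the complement that a growing ball around \<open>f x\<close> meets\<close>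
    obtain q where q: "q \<in> - W" "\<And>y. y \<in> - W \<Longrightarrow> dist (f x) q \<le> dist (f x) y"
    proof (rule distance_attains_inf)
      show "closed (- W)" using openW by (simp add: closed_Compl)
    qed (use p(2) in auto)
    define R where "R = dist (f x) q"
    have fxW: "f x \<in> W" using \<rho> by (simp add: W_def)
    then have R0: "0 < R" using q(1) by (auto simp: R_def)
    have R1: "R < \<mu> * \<rho>" using q(2)[OF p(2)] p(1) by (simp add: R_def)
    have RW: "ball (f x) R \<subseteq> W" using q(2) by (force simp: R_def)
    have sub: "cball x (R / \<mu>) \<subseteq> ball x \<rho>"
    proof -
      have "R / \<mu> < \<rho>" using R1 \<mu> by (simp add: pos_divide_less_eq mult.commute)
      then show ?thesis by auto
    qed
    have "compact (f ` cball x (R / \<mu>))"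
      by (intro compact_continuous_image continuous_on_subset[OF cont sub]) auto
    moreover have "ball (f x) R \<subseteq> f ` cball x (R / \<mu>)"
    proof
      fix w assume w: "w \<in> ball (f x) R"
      then obtain y where y: "y \<in> ball x \<rho>" "w = f y" using RW by (auto simp: W_def)
      have "dist x y \<le> dist (f x) w / \<mu>" using inverse_bound[OF RW w] gf y by simp
      also have "\<dots> \<le> R / \<mu>" using w \<mu> by (intro divide_right_mono) auto
      finally show "w \<in> f ` cball x (R / \<mu>)" using y by auto
    qed
    ultimately have "closure (ball (f x) R) \<subseteq> f ` cball x (R / \<mu>)"
      by (meson closure_minimal compact_imp_closed)
    then have "q \<in> f ` cball x (R / \<mu>)" using R0 by (auto simp: R_def)
    then show False using sub q(1) by (auto simp: W_def)
  qed
  show "\<mu> * dist x y \<le> dist (f x) (f y)" if "y \<in> ball x \<rho>" "dist (f x) (f y) < \<mu> * \<rho>" for y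
    using inverse_bound[of "\<mu> * \<rho>" "f y"] sub that gf \<mu> by (simp add: W_def field_simps)
qed

text \<open>Conformality at a point, with the factor made explicit because factors multiply under composition.\<close>

definition scales_at :: "real \<Rightarrow> ('a::euclidean_space \<Rightarrow> 'a) \<Rightarrow> 'a \<Rightarrow> bool" where
  "scales_at \<kappa> f x \<longleftrightarrow> (\<exists>A. (f has_derivative A) (at x) \<and> (\<forall>v. norm (A v) = \<kappa> * norm v))"

lemma scales_at_id: "scales_at 1 id x"
  unfolding scales_at_def by (rule exI[of _ id]) (auto simp: id_def)

lemma scales_at_comp:
  assumes "scales_at \<kappa> f (g x)" "scales_at \<mu> g x"
  shows "scales_at (\<kappa> * \<mu>) (f \<circ> g) x"
proof -
  obtain A G where "(f has_derivative A) (at (g x))" "\<And>v. norm (A v) = \<kappa> * norm v"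
    "(g has_derivative G) (at x)" "\<And>v. norm (G v) = \<mu> * norm v"
    using assms by (auto simp: scales_at_def)
  then show ?thesis unfolding scales_at_def
    by (intro exI[of _ "A \<circ> G"]) (auto intro: diff_chain_at)
qed

lemma deriv_norm_eqI:
  assumes "scales_at \<kappa> f x" shows "deriv_norm f x = \<kappa>"
proof -
  obtain A where A: "(f has_derivative A) (at x)" "\<And>v. norm (A v) = \<kappa> * norm v"
    using assms by (auto simp: scales_at_def)
  obtain b :: 'a where "b \<in> Basis" using nonempty_Basis by blast
  then have b: "norm (A b) = \<kappa>" "norm b = 1" using A(2)[of b] by auto
  have "onorm A = \<kappa>"
  proof (rule antisym)
    show "onorm A \<le> \<kappa>" by (rule onorm_le) (simp add: A(2))
    show "\<kappa> \<le> onorm A"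
      using onorm[OF has_derivative_bounded_linear[OF A(1)], of b] b by simp
  qed
  then show ?thesis using frechet_derivative_at[OF A(1)] by (simp add: deriv_norm_def)
qed

text \<open>The Lipschitz bound limits the difference quotients of \<open>f\<close> at \<open>x\<close>, and these approach the scaling
factor in every direction.\<close>

lemma scales_at_le_lipschitz:
  assumes f: "scales_at \<kappa> f x" and S: "open S" "x \<in> S"
    and lip: "\<And>y. y \<in> S \<Longrightarrow> dist (f x) (f y) \<le> r * dist x y"
  shows "\<kappa> \<le> r"
proof (rule field_le_epsilon)
  fix e :: real assume e: "0 < e"
  obtain A where A: "(f has_derivative A) (at x)" "\<And>v. norm (A v) = \<kappa> * norm v"
    using f by (auto simp: scales_at_def)
  obtain \<delta> where \<delta>: "0 < \<delta>" "\<And>y. norm (y - x) < \<delta> \<Longrightarrow> norm (f y - f x - A (y - x)) \<le> e * norm (y - x)"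
    using A(1) e unfolding has_derivative_at_alt by blast
  obtain \<eta> where \<eta>: "0 < \<eta>" "ball x \<eta> \<subseteq> S" using S open_contains_ball by blast
  obtain b :: 'a where b: "b \<in> Basis" using nonempty_Basis by blast
  define t where "t = min \<delta> \<eta> / 2"
  have t: "0 < t" "t < \<delta>" "t < \<eta>" using \<delta>(1) \<eta>(1) by (auto simp: t_def)
  define y where "y = x + t *\<^sub>R b"
  have ny: "norm (y - x) = t" "dist x y = t" using t b by (auto simp: y_def dist_norm)
  have "\<kappa> * t = norm (A (y - x))" using A(2)[of "y - x"] ny by simp
  also have "\<dots> \<le> norm (f y - f x) + norm (f y - f x - A (y - x))"
    using norm_triangle_ineq4[of "f y - f x" "f y - f x - A (y - x)"] by simp
  also have "\<dots> \<le> r * t + e * t"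
    using lip[of y] \<delta>(2)[of y] \<eta>(2) t ny by (intro add_mono) (auto simp: dist_norm norm_minus_commute subset_eq)
  finally have "\<kappa> * t \<le> (r + e) * t" by (simp add: algebra_simps)
  then show "\<kappa> \<le> r + e" using t by simp
qed

section \<open>Bounded distortion\<close>

text \<open>The set \<open>N\<close> is invariant, so words of arbitrary length act on it. The two step
inequalities compare the two-point ratio and the scaling factor of a single map at \<open>y\<close> with the
scaling factor at \<open>x\<close>; both are instances of one multiplicative estimate whose error is
summable along a word.\<close>

locale conformal_words =
  fixes D :: "'i set" and \<phi> :: "'i \<Rightarrow> 'a::euclidean_space \<Rightarrow> 'a" and N :: "'a set"
    and a r H \<alpha> d :: real
  assumes finite_alphabet: "finite D"
    and invariant: "i \<in> D \<Longrightarrow> \<phi> i ` N \<subseteq> N"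
    and inj: "i \<in> D \<Longrightarrow> inj_on (\<phi> i) N"
    and contracts: "i \<in> D \<Longrightarrow> x \<in> N \<Longrightarrow> y \<in> N \<Longrightarrow> dist (\<phi> i x) (\<phi> i y) \<le> r * dist x y"
    and r: "0 < r" "r < 1"
    and scales: "i \<in> D \<Longrightarrow> x \<in> N \<Longrightarrow> scales_at (deriv_norm (\<phi> i) x) (\<phi> i) x"
    and deriv_lower: "i \<in> D \<Longrightarrow> x \<in> N \<Longrightarrow> a \<le> deriv_norm (\<phi> i) x" and a: "0 < a"
    and deriv_upper: "i \<in> D \<Longrightarrow> x \<in> N \<Longrightarrow> deriv_norm (\<phi> i) x \<le> r"
    and dist_step: "i \<in> D \<Longrightarrow> x \<in> N \<Longrightarrow> y \<in> N \<Longrightarrow>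
      dist (\<phi> i x) (\<phi> i y) \<le> (1 + H * dist x y powr \<alpha>) * (deriv_norm (\<phi> i) x * dist x y)"
    and deriv_step: "i \<in> D \<Longrightarrow> x \<in> N \<Longrightarrow> y \<in> N \<Longrightarrow>
      deriv_norm (\<phi> i) y \<le> (1 + H * dist x y powr \<alpha>) * deriv_norm (\<phi> i) x"
    and H: "0 \<le> H" and \<alpha>: "0 < \<alpha>"
    and diam: "x \<in> N \<Longrightarrow> y \<in> N \<Longrightarrow> dist x y \<le> d"
begin

definition wt :: "'i list \<Rightarrow> 'a \<Rightarrow> real" where
  "wt I x = deriv_norm (word_map \<phi> I) x"

definition B :: real where
  "B = exp (H * d powr \<alpha> / (1 - r powr \<alpha>))"

lemma word_map_N: "set I \<subseteq> D \<Longrightarrow> x \<in> N \<Longrightarrow> word_map \<phi> I x \<in> N"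
  by (rule word_map_in[OF invariant])

lemma word_map_dist: "set I \<subseteq> D \<Longrightarrow> x \<in> N \<Longrightarrow> y \<in> N \<Longrightarrow>
    dist (word_map \<phi> I x) (word_map \<phi> I y) \<le> r ^ length I * dist x y"
  by (rule word_map_contracts[OF invariant contracts less_imp_le[OF r(1)]])

lemma word_map_inj: "set I \<subseteq> D \<Longrightarrow> inj_on (word_map \<phi> I) N"
proof (induction I)
  case (Cons i I)
  then have i: "i \<in> D" and I: "set I \<subseteq> D" by auto
  have "inj_on (\<phi> i) (word_map \<phi> I ` N)"
    using inj[OF i] by (rule inj_on_subset) (rule image_subsetI, rule word_map_N[OF I])
  with Cons.IH[OF I] show ?case
    unfolding word_map_Cons_comp by (rule comp_inj_on)
qed (auto simp: inj_on_def)

lemma scales_word: "set I \<subseteq> D \<Longrightarrow> x \<in> N \<Longrightarrow> scales_at (wt I x) (word_map \<phi> I) x"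
proof -
  assume I: "set I \<subseteq> D" and x: "x \<in> N"
  have "\<exists>\<kappa>. scales_at \<kappa> (word_map \<phi> I) x" using I
  proof (induction I)
    case Nil
    show ?case using scales_at_id[of x] by (auto simp: word_map_def id_def)
  next
    case (Cons i I)
    then obtain \<kappa> where "scales_at \<kappa> (word_map \<phi> I) x" by auto
    moreover have "scales_at (deriv_norm (\<phi> i) (word_map \<phi> I x)) (\<phi> i) (word_map \<phi> I x)"
      using Cons.prems x by (intro scales word_map_N) auto
    ultimately have "scales_at (deriv_norm (\<phi> i) (word_map \<phi> I x) * \<kappa>) (\<phi> i \<circ> word_map \<phi> I) x"
      by (intro scales_at_comp)
    then show ?case unfolding word_map_Cons_comp by blast
  qed
  then show ?thesis using deriv_norm_eqI unfolding wt_def by metis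
qed

lemma wt_Nil: "wt [] x = 1"
  using deriv_norm_eqI[OF scales_at_id] by (simp add: wt_def word_map_def)

lemma wt_append:
  assumes "set I \<subseteq> D" "set J \<subseteq> D" "x \<in> N"
  shows "wt (I @ J) x = wt I (word_map \<phi> J x) * wt J x"
proof -
  have "scales_at (wt I (word_map \<phi> J x) * wt J x) (word_map \<phi> I \<circ> word_map \<phi> J) x"
    using assms by (intro scales_at_comp scales_word word_map_N)
  also have "word_map \<phi> I \<circ> word_map \<phi> J = word_map \<phi> (I @ J)"
    by (auto simp: word_map_append)
  finally show ?thesis using deriv_norm_eqI unfolding wt_def by metis
qed

lemma wt_Cons:
  assumes "i \<in> D" "set I \<subseteq> D" "x \<in> N"
  shows "wt (i # I) x = deriv_norm (\<phi> i) (word_map \<phi> I x) * wt I x"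
proof -
  have "word_map \<phi> [i] = \<phi> i" by (auto simp: word_map_def)
  then show ?thesis using wt_append[of "[i]" I x] assms by (simp add: wt_def)
qed

lemma wt_bounds:
  assumes "set I \<subseteq> D" "x \<in> N"
  shows "0 < wt I x" "wt I x \<le> r ^ length I"
proof -
  have "0 < wt I x \<and> wt I x \<le> r ^ length I" using assms(1)
  proof (induction I)
    case (Cons i I)
    then have N: "word_map \<phi> I x \<in> N" and i: "i \<in> D" using assms(2) by (auto intro: word_map_N)
    have "0 < deriv_norm (\<phi> i) (word_map \<phi> I x)" using deriv_lower[OF i N] a by linarith
    moreover have IH: "0 < wt I x" "wt I x \<le> r ^ length I" using Cons by auto
    moreover have "deriv_norm (\<phi> i) (word_map \<phi> I x) * wt I x \<le> r * r ^ length I"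
      using deriv_upper[OF i N] IH r by (intro mult_mono) auto
    ultimately show ?case
      using wt_Cons[of i I x] Cons.prems assms(2) by simp
  qed (simp add: wt_Nil)
  then show "0 < wt I x" "wt I x \<le> r ^ length I" by auto
qed

text \<open>The images of \<open>x\<close> and \<open>y\<close> approach each other exponentially fast, so the error factors of successive
letters are bounded by a geometric series in the exponent.\<close>

lemma step_factor:
  assumes "set I \<subseteq> D" "x \<in> N" "y \<in> N"
  shows "1 + H * dist (word_map \<phi> I x) (word_map \<phi> I y) powr \<alpha>
    \<le> exp (H * dist x y powr \<alpha> * (r powr \<alpha>) ^ length I)"
proof -
  have "dist (word_map \<phi> I x) (word_map \<phi> I y) powr \<alpha> \<le> (r ^ length I * dist x y) powr \<alpha>"
    using word_map_dist[OF assms] \<alpha> by (intro powr_mono2) auto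
  also have "\<dots> = dist x y powr \<alpha> * (r powr \<alpha>) ^ length I"
  proof -
    have "(r ^ n) powr \<alpha> = (r powr \<alpha>) ^ n" for n
      using r by (induction n) (simp_all add: powr_mult)
    then show ?thesis using r by (simp add: powr_mult)
  qed
  finally have "H * dist (word_map \<phi> I x) (word_map \<phi> I y) powr \<alpha> \<le> H * dist x y powr \<alpha> * (r powr \<alpha>) ^ length I"
    using H by (simp add: mult_left_mono mult.assoc)
  then show ?thesis using exp_ge_add_one_self[of "H * dist x y powr \<alpha> * (r powr \<alpha>) ^ length I"] by linarith
qed

lemma distortion_exponent:
  assumes "x \<in> N" "y \<in> N"
  shows "exp (H * dist x y powr \<alpha> * (\<Sum>j<n. (r powr \<alpha>) ^ j)) \<le> B"
proof -
  have ra: "0 < r powr \<alpha>" "r powr \<alpha> < 1" using r \<alpha> powr_less_mono2[of \<alpha> r 1] by auto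
  have "(\<Sum>j<n. (r powr \<alpha>) ^ j) = (1 - (r powr \<alpha>) ^ n) / (1 - r powr \<alpha>)"
    using ra by (subst sum_gp_strict) auto
  also have "\<dots> \<le> 1 / (1 - r powr \<alpha>)" using ra by (intro divide_right_mono) auto
  finally have "(H * dist x y powr \<alpha>) * (\<Sum>j<n. (r powr \<alpha>) ^ j) \<le> (H * d powr \<alpha>) * (1 / (1 - r powr \<alpha>))"
    using H ra diam[OF assms] \<alpha> by (intro mult_mono powr_mono2 sum_nonneg) auto
  then show ?thesis by (simp add: B_def)
qed

text \<open>Both estimates multiply the step inequalities along the word. The second one needs no segment
between \<open>x\<close> and \<open>y\<close> inside \<open>N\<close>, which may be disconnected.\<close>

lemma distortion:
  assumes I: "set I \<subseteq> D" and xy: "x \<in> N" "y \<in> N"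
  shows "wt I y \<le> B * wt I x"
    and "dist (word_map \<phi> I x) (word_map \<phi> I y) \<le> B * (wt I x * dist x y)"
proof -
  let ?E = "\<lambda>n. exp (H * dist x y powr \<alpha> * (\<Sum>j<n. (r powr \<alpha>) ^ j))"
  have "wt I y \<le> ?E (length I) * wt I x \<and>
    dist (word_map \<phi> I x) (word_map \<phi> I y) \<le> ?E (length I) * (wt I x * dist x y)"
    using I
  proof (induction I)
    case Nil
    then show ?case by (simp add: wt_Nil)
  next
    case (Cons i I)
    then have i: "i \<in> D" and I: "set I \<subseteq> D" by auto
    let ?p = "word_map \<phi> I x" and ?q = "word_map \<phi> I y"
    have N: "?p \<in> N" "?q \<in> N" using xy I by (auto intro: word_map_N)
    let ?e = "exp (H * dist x y powr \<alpha> * (r powr \<alpha>) ^ length I)"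
    have E: "?E (length (i # I)) = ?e * ?E (length I)"
      by (simp add: algebra_simps flip: exp_add)
    have dp: "0 < deriv_norm (\<phi> i) ?p" using deriv_lower[OF i N(1)] a by linarith
    note wp = wt_bounds(1)[OF I xy(1)] wt_bounds(1)[OF I xy(2)]
    note sf = step_factor[OF I xy]
    have "wt (i # I) y = deriv_norm (\<phi> i) ?q * wt I y" using i I xy by (intro wt_Cons)
    also have "\<dots> \<le> (?e * deriv_norm (\<phi> i) ?p) * (?E (length I) * wt I x)"
    proof (rule mult_mono)
      have "deriv_norm (\<phi> i) ?q \<le> (1 + H * dist ?p ?q powr \<alpha>) * deriv_norm (\<phi> i) ?p"
        by (rule deriv_step[OF i N])
      also have "\<dots> \<le> ?e * deriv_norm (\<phi> i) ?p" using sf dp by (intro mult_right_mono) auto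
      finally show "deriv_norm (\<phi> i) ?q \<le> ?e * deriv_norm (\<phi> i) ?p" .
    qed (use Cons I wp dp in auto)
    also have "\<dots> = ?E (length (i # I)) * wt (i # I) x"
      unfolding E using i I xy by (simp add: wt_Cons)
    finally have *: "wt (i # I) y \<le> ?E (length (i # I)) * wt (i # I) x" .
    have "dist (\<phi> i ?p) (\<phi> i ?q) \<le> (1 + H * dist ?p ?q powr \<alpha>) * (deriv_norm (\<phi> i) ?p * dist ?p ?q)"
      by (rule dist_step[OF i N])
    also have "\<dots> \<le> ?e * (deriv_norm (\<phi> i) ?p * (?E (length I) * (wt I x * dist x y)))"
      using sf dp Cons I H by (intro mult_mono mult_left_mono) auto
    also have "\<dots> = ?E (length (i # I)) * (wt (i # I) x * dist x y)"
      unfolding E using i I xy by (simp add: wt_Cons)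
    finally show ?case using * by simp
  qed
  moreover have "?E (length I) * t \<le> B * t" if "0 \<le> t" for t
    using distortion_exponent[OF xy] that by (rule mult_right_mono)
  moreover have "0 \<le> wt I x" using wt_bounds(1)[OF I xy(1)] by simp
  moreover have "0 \<le> wt I x * dist x y" using wt_bounds(1)[OF I xy(1)] by simp
  ultimately show "wt I y \<le> B * wt I x"
    and "dist (word_map \<phi> I x) (word_map \<phi> I y) \<le> B * (wt I x * dist x y)"
    by (blast intro: order_trans)+
qed

lemma B_pos: "0 < B"
  by (simp add: B_def)

text \<open>Bounded distortion lets the derivative of a word expand by at least \<open>wt I x / B\<close> on the whole ball,
whatever the length of the word. A point \<open>y\<close> of \<open>N\<close> whose image falls into the ball of the first
statement lies in \<open>ball x \<rho>\<close> by injectivity, which gives the lower bound for distances.\<close>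

lemma
  assumes I: "set I \<subseteq> D" and \<rho>: "0 < \<rho>" "ball x \<rho> \<subseteq> N"
  shows image_contains_ball: "ball (word_map \<phi> I x) (wt I x / B * \<rho>) \<subseteq> word_map \<phi> I ` ball x \<rho>"
    and dist_lower: "\<And>y. y \<in> N \<Longrightarrow> wt I x / B * min \<rho> (dist x y) \<le> dist (word_map \<phi> I x) (word_map \<phi> I y)"
proof -
  let ?f = "word_map \<phi> I" and ?m = "wt I x / B"
  have x: "x \<in> N" using \<rho> by auto
  have m: "0 < ?m" using wt_bounds(1)[OF I x] B_pos by simp
  have inj: "inj_on ?f (ball x \<rho>)" using word_map_inj[OF I] \<rho>(2) by (rule inj_on_subset)
  have deriv: "\<exists>A. (?f has_derivative A) (at y) \<and> (\<forall>v. ?m * norm v \<le> norm (A v))" if "y \<in> ball x \<rho>" for y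
  proof -
    have y: "y \<in> N" using that \<rho> by auto
    obtain A where A: "(?f has_derivative A) (at y)" "\<And>v. norm (A v) = wt I y * norm v"
      using scales_word[OF I y] by (auto simp: scales_at_def)
    have "?m \<le> wt I y" using distortion(1)[OF I y x] B_pos by (simp add: field_simps)
    then have "?m * norm v \<le> norm (A v)" for v unfolding A(2) by (rule mult_right_mono) simp
    then show ?thesis using A(1) by blast
  qed
  show sub: "ball (?f x) (?m * \<rho>) \<subseteq> ?f ` ball x \<rho>"
    by (rule expanding_image_contains_ball(1)[OF m \<rho>(1) inj deriv])
  show "?m * min \<rho> (dist x y) \<le> dist (?f x) (?f y)" if y: "y \<in> N" for y
  proof (cases "dist (?f x) (?f y) < ?m * \<rho>")
    case True
    then have "?f y \<in> ?f ` ball x \<rho>" using sub by auto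
    then obtain y' where y': "y' \<in> ball x \<rho>" "?f y = ?f y'" by blast
    then have "y' \<in> N" using \<rho>(2) by blast
    then have "y = y'" by (rule inj_onD[OF word_map_inj[OF I] y'(2) y])
    then have "y \<in> ball x \<rho>" using y' by simp
    from expanding_image_contains_ball(2)[OF m \<rho>(1) inj deriv this True]
    have "?m * dist x y \<le> dist (?f x) (?f y)" .
    moreover have "?m * min \<rho> (dist x y) \<le> ?m * dist x y" using m by (intro mult_left_mono) auto
    ultimately show ?thesis by linarith
  next
    case False
    moreover have "?m * min \<rho> (dist x y) \<le> ?m * \<rho>" using m by (intro mult_left_mono) auto
    ultimately show ?thesis by linarith
  qed
qed

end

section \<open>Cylinders meeting a ball, and positivity of the Hausdorff measure\<close>

lemma card_disjoint_balls_le: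
  fixes g :: "'b \<Rightarrow> 'a::euclidean_space"
  assumes Q: "finite Q" and t: "0 < t" and R: "0 \<le> R"
    and sub: "\<And>j. j \<in> Q \<Longrightarrow> ball (g j) t \<subseteq> ball p R"
    and disj: "disjoint_family_on (\<lambda>j. ball (g j) t) Q"
  shows "real (card Q) * t ^ DIM('a) \<le> R ^ DIM('a)"
proof -
  have fin: "ball y s \<in> fmeasurable lborel" for y :: 'a and s
    using emeasure_bounded_finite[of "ball y s"] by (intro fmeasurableI) (simp_all add: borel_open)
  have "(\<Sum>j\<in>Q. measure lborel (ball (g j) t)) = measure lborel (\<Union>j\<in>Q. ball (g j) t)"
    by (rule measure_finite_Union[symmetric])
      (use Q disj fin in \<open>auto simp: fmeasurable_def less_top\<close>)
  also have "\<dots> \<le> measure lborel (ball p R)"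
  proof (rule measure_mono_fmeasurable[OF _ _ fin])
    show "(\<Union>j\<in>Q. ball (g j) t) \<subseteq> ball p R" using sub by blast
    show "(\<Union>j\<in>Q. ball (g j) t) \<in> sets lborel"
      by (simp, intro borel_open open_UN) auto
  qed
  finally have "real (card Q) * (unit_ball_vol (DIM('a)) * t ^ DIM('a)) \<le> unit_ball_vol (DIM('a)) * R ^ DIM('a)"
    using t R by (simp add: content_ball)
  then have "unit_ball_vol (DIM('a)) * (real (card Q) * t ^ DIM('a)) \<le> unit_ball_vol (DIM('a)) * R ^ DIM('a)"
    by (simp add: mult_ac)
  then show ?thesis using unit_ball_vol_pos[of "DIM('a)"] by (simp add: mult_le_cancel_left_pos)
qed

lemma powr_add_le: "0 \<le> (x::real) \<Longrightarrow> 0 \<le> y \<Longrightarrow> 0 < s \<Longrightarrow> (x + y) powr s \<le> 2 powr s * (x powr s + y powr s)"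
proof -
  assume xy: "0 \<le> x" "0 \<le> y" and s: "0 < s"
  have "(x + y) powr s \<le> (2 * max x y) powr s" using xy s by (intro powr_mono2) auto
  also have "\<dots> = 2 powr s * max x y powr s" using xy by (simp add: powr_mult)
  also have "\<dots> \<le> 2 powr s * (x powr s + y powr s)"
    by (intro mult_left_mono) (auto simp: max_def)
  finally show ?thesis .
qed

text \<open>The open set \<open>U\<close> of the open set condition is taken inside \<open>N\<close>. The ratio of a word is measured
at the base point \<open>x0\<close>.\<close>

locale conformal_attractor = conformal_words D \<phi> N a r H \<alpha> d
  for D :: "'i set" and \<phi> :: "'i \<Rightarrow> 'a::euclidean_space \<Rightarrow> 'a" and N a r H \<alpha> d +
  fixes X U :: "'a set" and x0 :: 'a and \<epsilon> :: real
  assumes compact: "compact X" and x0: "x0 \<in> X" and self_similar: "X = (\<Union>i\<in>D. \<phi> i ` X)"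
    and \<epsilon>: "0 < \<epsilon>" and ball_N: "x \<in> X \<Longrightarrow> ball x \<epsilon> \<subseteq> N"
    and U: "open U" "U \<noteq> {}" "U \<subseteq> N" "i \<in> D \<Longrightarrow> \<phi> i ` U \<subseteq> U"
    and U_disjoint: "i \<in> D \<Longrightarrow> j \<in> D \<Longrightarrow> i \<noteq> j \<Longrightarrow> \<phi> i ` U \<inter> \<phi> j ` U = {}"
begin

lemma X_N: "X \<subseteq> N"
proof
  fix x assume "x \<in> X"
  then show "x \<in> N" using ball_N[of x] \<epsilon> by auto
qed

lemma x0_N: "x0 \<in> N"
  using x0 X_N by blast

lemma X_invariant: "i \<in> D \<Longrightarrow> \<phi> i ` X \<subseteq> X"
  by (subst (2) self_similar) blast

lemma word_map_X: "set I \<subseteq> D \<Longrightarrow> x \<in> X \<Longrightarrow> word_map \<phi> I x \<in> X"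
  by (rule word_map_in[OF X_invariant])

abbreviation w :: "'i list \<Rightarrow> real" where "w I \<equiv> wt I x0"

lemma w_append:
  assumes IJ: "set I \<subseteq> D" "set J \<subseteq> D"
  shows "w (I @ J) \<le> B * (w I * w J)" "w I * w J \<le> B * w (I @ J)"
proof -
  note N = word_map_N[OF IJ(2) x0_N]
  have eq: "w (I @ J) = wt I (word_map \<phi> J x0) * w J" using IJ x0_N by (rule wt_append)
  have wJ: "0 \<le> w J" using wt_bounds(1)[OF IJ(2) x0_N] by simp
  show "w (I @ J) \<le> B * (w I * w J)"
    using mult_right_mono[OF distortion(1)[OF IJ(1) x0_N N] wJ] by (simp add: eq mult.assoc)
  show "w I * w J \<le> B * w (I @ J)"
    using mult_right_mono[OF distortion(1)[OF IJ(1) N x0_N] wJ] by (simp add: eq mult.assoc)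
qed

sublocale qm: quasi_multiplicative D w B r
proof
  show "D \<noteq> {}" using self_similar x0 by auto
qed (use finite_alphabet wt_bounds x0_N wt_Nil w_append r in auto)

lemma w_snoc: "set J \<subseteq> D \<Longrightarrow> i \<in> D \<Longrightarrow> a * w J \<le> B * w (J @ [i])"
proof -
  assume J: "set J \<subseteq> D" and i: "i \<in> D"
  have "w [i] = deriv_norm (\<phi> i) x0" using wt_Cons[of i "[]" x0] i x0_N by (simp add: wt_Nil)
  then have "a * w J \<le> w [i] * w J"
    using deriv_lower[OF i x0_N] wt_bounds(1)[OF J x0_N] by (intro mult_right_mono) auto
  also have "\<dots> \<le> B * w (J @ [i])" using w_append(2)[of J "[i]"] J i by (simp add: mult.commute)
  finally show ?thesis .
qed

lemma d_nonneg: "0 \<le> d"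
  using diam[OF x0_N x0_N] by simp

lemma dist_upper:
  assumes "set I \<subseteq> D" "x \<in> N" "y \<in> N"
  shows "dist (word_map \<phi> I x) (word_map \<phi> I y) \<le> B\<^sup>2 * d * w I"
proof -
  have "dist (word_map \<phi> I x) (word_map \<phi> I y) \<le> B * (wt I x * dist x y)"
    by (rule distortion(2)[OF assms])
  also have "\<dots> \<le> B * ((B * w I) * d)"
    using distortion(1)[OF assms(1) x0_N assms(2)] diam[OF assms(2,3)] B_pos wt_bounds(1)[OF assms(1) x0_N]
    by (intro mult_left_mono mult_mono) auto
  finally show ?thesis by (simp add: power2_eq_square mult_ac)
qed

text \<open>At the first letter in which the two words differ the images are disjoint, and the common prefix
acts injectively.\<close>

lemma word_images_disjoint:
  assumes par: "I \<parallel> J" and IJ: "set I \<subseteq> D" "set J \<subseteq> D"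
  shows "word_map \<phi> I ` U \<inter> word_map \<phi> J ` U = {}"
proof -
  obtain P i I' j J' where ij: "i \<noteq> j" and I: "I = P @ i # I'" and J: "J = P @ j # J'"
    using parallel_decomp[OF par] by blast
  have DU: "word_map \<phi> I' u \<in> U" "word_map \<phi> J' u \<in> U" if "u \<in> U" for u
    using that IJ U(4) by (auto simp: I J intro!: word_map_in[of D])
  show ?thesis
  proof (intro equals0I)
    fix y assume "y \<in> word_map \<phi> I ` U \<inter> word_map \<phi> J ` U"
    then obtain u v where uv: "u \<in> U" "v \<in> U" "y = word_map \<phi> I u" "y = word_map \<phi> J v" by blast
    let ?p = "\<phi> i (word_map \<phi> I' u)" and ?q = "\<phi> j (word_map \<phi> J' v)"
    have D: "i \<in> D" "j \<in> D" "set P \<subseteq> D" using IJ by (auto simp: I J)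
    have p: "?p \<in> \<phi> i ` U" and q: "?q \<in> \<phi> j ` U" using DU uv by auto
    then have "?p \<in> N" "?q \<in> N" using U(4)[OF D(1)] U(4)[OF D(2)] U(3) by blast+
    moreover have "word_map \<phi> P ?p = word_map \<phi> P ?q"
      using uv(3,4) by (simp add: I J word_map_append)
    ultimately have "?p = ?q" using inj_onD[OF word_map_inj[OF D(3)]] by blast
    then show False using p q U_disjoint[OF D(1,2) ij] by (metis disjoint_iff)
  qed
qed

definition stopping :: "real \<Rightarrow> 'a \<Rightarrow> 'i list set" where
  "stopping \<rho> p = {J. set J \<subseteq> D \<and> w J < \<rho> \<and> (\<forall>k<length J. \<rho> \<le> w (take k J)) \<and>
     word_map \<phi> J ` X \<inter> ball p \<rho> \<noteq> {}}"

lemma stopping_length: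
  assumes J: "J \<in> stopping \<rho> p" and L: "r ^ L < \<rho>"
  shows "length J \<le> L"
proof (rule ccontr)
  assume "\<not> length J \<le> L"
  then have "\<rho> \<le> w (take L J)" and D: "set (take L J) \<subseteq> D" and len: "length (take L J) = L"
    using J by (auto simp: stopping_def dest: in_set_takeD)
  then show False using wt_bounds(2)[OF D x0_N] L by simp
qed

lemma finite_stopping:
  assumes "0 < \<rho>" shows "finite (stopping \<rho> p)"
proof -
  obtain L where L: "r ^ L < \<rho>" using real_arch_pow_inv[OF assms r(2)] by blast
  have "stopping \<rho> p \<subseteq> {J. set J \<subseteq> D \<and> length J \<le> L}"
    using stopping_length[OF _ L] by (auto simp: stopping_def)
  then show ?thesis using finite_lists_length_le[OF finite_alphabet] by (rule finite_subset)
qed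

text \<open>The number of cylinders of size about \<open>\<rho>\<close> near a ball of radius \<open>\<rho>\<close> is bounded: the open
sets \<open>word_map \<phi> J ` U\<close> are disjoint because stopping words are incomparable, each
contains a ball of radius \<open>c \<rho>\<close>, and these balls lie in \<open>ball p (C \<rho>)\<close>. Compare
volumes.\<close>

lemma card_stopping:
  obtains M where "0 < M" "\<And>\<rho> p. 0 < \<rho> \<Longrightarrow> \<rho> \<le> 1 \<Longrightarrow> real (card (stopping \<rho> p)) \<le> M"
proof -
  obtain u \<eta> where u: "u \<in> U" and \<eta>: "0 < \<eta>" "ball u \<eta> \<subseteq> U"
    using U(1,2) by (meson ex_in_conv open_contains_ball)
  define c where "c = a * \<eta> / B ^ 3"
  define C where "C = 1 + B\<^sup>2 * d + c"
  have c: "0 < c" using a \<eta> B_pos by (simp add: c_def)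
  have C: "0 < C" using c d_nonneg by (simp add: C_def add_pos_nonneg)
  have uN: "u \<in> N" using u U by blast
  have bound: "real (card (stopping \<rho> p)) \<le> (C / c) ^ DIM('a)" if \<rho>: "0 < \<rho>" "\<rho> \<le> 1" for \<rho> p
  proof -
    have contained: "ball (word_map \<phi> J u) (c * \<rho>) \<subseteq> word_map \<phi> J ` U \<and>
        ball (word_map \<phi> J u) (c * \<rho>) \<subseteq> ball p (C * \<rho>)" if J: "J \<in> stopping \<rho> p" for J
    proof
      have JD: "set J \<subseteq> D" using J by (simp add: stopping_def)
      have "J \<noteq> []" using J \<rho> by (auto simp: stopping_def wt_Nil)
      then obtain J' i where J': "J = J' @ [i]" by (metis rev_exhaust)
      have "\<forall>k<length J. \<rho> \<le> w (take k J)" using J by (simp add: stopping_def)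
      then have "\<rho> \<le> w J'" unfolding J' by (auto dest: spec[of _ "length J'"])
      then have "a * \<rho> \<le> a * w J'" using a by simp
      also have "\<dots> \<le> B * w J" unfolding J' using JD J' by (intro w_snoc) auto
      also have "\<dots> \<le> B * (B * wt J u)"
        using distortion(1)[OF JD uN x0_N] B_pos by (intro mult_left_mono) auto
      finally have "a * \<rho> * \<eta> / B ^ 3 \<le> B * (B * wt J u) * \<eta> / B ^ 3"
        using \<eta> B_pos by (intro divide_right_mono mult_right_mono) auto
      then have "c * \<rho> \<le> wt J u / B * \<eta>"
        using B_pos by (simp add: c_def power3_eq_cube field_simps)
      moreover have "ball (word_map \<phi> J u) (wt J u / B * \<eta>) \<subseteq> word_map \<phi> J ` ball u \<eta>"
        using \<eta> U by (intro image_contains_ball JD) auto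
      ultimately show "ball (word_map \<phi> J u) (c * \<rho>) \<subseteq> word_map \<phi> J ` U"
        using \<eta>(2) by (meson image_mono order_trans subset_ball)
      obtain x where x: "x \<in> X" "dist p (word_map \<phi> J x) < \<rho>"
        using J by (auto simp: stopping_def)
      have "dist (word_map \<phi> J x) (word_map \<phi> J u) \<le> B\<^sup>2 * d * w J"
        using x X_N uN by (intro dist_upper JD) auto
      also have "\<dots> \<le> B\<^sup>2 * d * \<rho>"
        using J d_nonneg by (intro mult_left_mono) (auto simp: stopping_def)
      finally have "dist p (word_map \<phi> J u) \<le> \<rho> + B\<^sup>2 * d * \<rho>"
        using x(2) dist_triangle[of p "word_map \<phi> J u" "word_map \<phi> J x"] by linarith
      then show "ball (word_map \<phi> J u) (c * \<rho>) \<subseteq> ball p (C * \<rho>)"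
        by (subst ball_subset_ball_iff) (simp add: C_def algebra_simps dist_commute)
    qed
    have par: "J \<parallel> J'" if J: "J \<in> stopping \<rho> p" "J' \<in> stopping \<rho> p" "J \<noteq> J'" for J J'
    proof -
      have *: "\<not> prefix J J'" if "J \<in> stopping \<rho> p" "J' \<in> stopping \<rho> p" "J \<noteq> J'" for J J'
      proof
        assume "prefix J J'"
        then obtain R where R: "J' = J @ R" by (auto simp: prefix_def)
        then have "length J < length J'" "take (length J) J' = J" using that(3) by auto
        then have "\<rho> \<le> w J" using that(2) by (force simp: stopping_def)
        then show False using that(1) by (simp add: stopping_def)
      qed
      show ?thesis using * J by (auto simp: parallel_def)
    qed
    have "disjoint_family_on (\<lambda>J. ball (word_map \<phi> J u) (c * \<rho>)) (stopping \<rho> p)"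
      unfolding disjoint_family_on_def
    proof (intro ballI impI)
      fix J J' assume J: "J \<in> stopping \<rho> p" "J' \<in> stopping \<rho> p" "J \<noteq> J'"
      have "word_map \<phi> J ` U \<inter> word_map \<phi> J' ` U = {}"
        using J by (intro word_images_disjoint par) (auto simp: stopping_def)
      then show "ball (word_map \<phi> J u) (c * \<rho>) \<inter> ball (word_map \<phi> J' u) (c * \<rho>) = {}"
        using contained[OF J(1)] contained[OF J(2)] by blast
    qed
    then have "real (card (stopping \<rho> p)) * (c * \<rho>) ^ DIM('a) \<le> (C * \<rho>) ^ DIM('a)"
      using contained finite_stopping[OF \<rho>(1)] c C \<rho> by (intro card_disjoint_balls_le[where p = p]) auto
    then show ?thesis using c \<rho> by (simp add: power_mult_distrib power_divide field_simps)
  qed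
  show thesis using that[of "(C / c) ^ DIM('a)"] bound C c by simp
qed

text \<open>A ball of radius \<open>\<rho>\<close> meets boundedly many stopping cylinders, each of mass at most a multiple
of \<open>\<rho>\<^sup>s\<close>. The mass of the ball is expressed through the words of one large length. For \<open>\<rho> > 1\<close> there may
be no stopping words, but the total mass 1 is a sufficient bound.\<close>

lemma mass_of_ball:
  assumes m: "quasi_bernoulli D m C" and mw: "\<And>I. set I \<subseteq> D \<Longrightarrow> m I \<le> C' * w I powr s"
    and s: "0 < s"
  shows "\<exists>A>0. \<forall>p \<rho>. 0 < \<rho> \<longrightarrow> (\<exists>L. \<forall>n\<ge>L.
    (\<Sum>K\<in>words D n. if word_map \<phi> K ` X \<inter> ball p \<rho> \<noteq> {} then m K else 0) \<le> A * \<rho> powr s)"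
proof -
  interpret qb: quasi_bernoulli D m C by (rule m)
  obtain M where M: "0 < M" "\<And>\<rho> p. 0 < \<rho> \<Longrightarrow> \<rho> \<le> 1 \<Longrightarrow> real (card (stopping \<rho> p)) \<le> M"
    by (rule card_stopping) blast
  have C'0: "0 < C'" using mw[of "[]"] by (simp add: qb.nil wt_Nil)
  define A where "A = max 1 (M * (C * C'))"
  have "\<exists>L. \<forall>n\<ge>L. (\<Sum>K\<in>words D n. if word_map \<phi> K ` X \<inter> ball p \<rho> \<noteq> {} then m K else 0) \<le> A * \<rho> powr s"
    if \<rho>: "0 < \<rho>" for p \<rho>
  proof (cases "\<rho> \<le> 1")
    case False
    have "(\<Sum>K\<in>words D n. if word_map \<phi> K ` X \<inter> ball p \<rho> \<noteq> {} then m K else 0) \<le> A * \<rho> powr s" for n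
    proof -
      have "(\<Sum>K\<in>words D n. if word_map \<phi> K ` X \<inter> ball p \<rho> \<noteq> {} then m K else 0) \<le> (\<Sum>K\<in>words D n. m K)"
        by (intro sum_mono) (auto simp: words_def less_imp_le qb.pos)
      also have "\<dots> \<le> 1 * 1" by (simp add: qb.sum_words_eq_1)
      also have "\<dots> \<le> A * \<rho> powr s"
        using False s by (intro mult_mono) (auto simp: A_def ge_one_powr_ge_zero)
      finally show ?thesis .
    qed
    then show ?thesis by blast
  next
    case True
    obtain L where L: "r ^ L < \<rho>" using real_arch_pow_inv[OF \<rho> r(2)] by blast
    let ?Q = "stopping \<rho> p"
    have "(\<Sum>K\<in>words D n. if word_map \<phi> K ` X \<inter> ball p \<rho> \<noteq> {} then m K else 0) \<le> A * \<rho> powr s"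
      if n: "L \<le> n" for n
    proof -
      have "(\<Sum>K\<in>words D n. if word_map \<phi> K ` X \<inter> ball p \<rho> \<noteq> {} then m K else 0) \<le>
        (\<Sum>K\<in>words D n. \<Sum>J\<in>?Q. if qb.reads 0 J K then m K else 0)"
      proof (intro sum_mono)
        fix K assume "K \<in> words D n"
        then have K: "set K \<subseteq> D" "length K = n" by (auto simp: words_def)
        have m0: "0 < m K" by (rule qb.pos[OF K(1)])
        have nn: "0 \<le> (if qb.reads 0 J K then m K else 0)" for J using m0 by simp
        show "(if word_map \<phi> K ` X \<inter> ball p \<rho> \<noteq> {} then m K else 0) \<le>
          (\<Sum>J\<in>?Q. if qb.reads 0 J K then m K else 0)"
        proof (cases "word_map \<phi> K ` X \<inter> ball p \<rho> \<noteq> {}")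
          case True
          then obtain x where x: "x \<in> X" "word_map \<phi> K x \<in> ball p \<rho>" by blast
          have "r ^ n \<le> r ^ L" using n r by (intro power_decreasing) auto
          then have "w (take n K) < \<rho>" using wt_bounds(2)[OF K(1) x0_N] L K by simp
          define k where "k = (LEAST k. w (take k K) < \<rho>)"
          have k: "w (take k K) < \<rho>" unfolding k_def by (rule LeastI) fact
          have kn: "k \<le> n" unfolding k_def by (rule Least_le) fact
          have k': "\<rho> \<le> w (take l K)" if "l < k" for l
            using not_less_Least[of l "\<lambda>k. w (take k K) < \<rho>"] that by (simp add: k_def not_less)
          have D: "set (take k K) \<subseteq> D" "set (drop k K) \<subseteq> D"
            using K by (auto dest: in_set_takeD in_set_dropD)
          have "word_map \<phi> K x = word_map \<phi> (take k K) (word_map \<phi> (drop k K) x)"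
            by (simp flip: word_map_append)
          then have "word_map \<phi> K x \<in> word_map \<phi> (take k K) ` X"
            using word_map_X[OF D(2) x(1)] by simp
          then have Q: "take k K \<in> ?Q"
            using x k k' D kn K unfolding stopping_def by (auto simp: min_def)
          have "m K = (if qb.reads 0 (take k K) K then m K else 0)"
            using kn K by (simp add: qb.reads_def min_def)
          also have "\<dots> \<le> (\<Sum>J\<in>?Q. if qb.reads 0 J K then m K else 0)"
            by (rule member_le_sum[OF Q nn finite_stopping[OF \<rho>]])
          finally show ?thesis using True by simp
        next
          case False
          then show ?thesis using sum_nonneg[of ?Q, OF nn] by simp
        qed
      qed
      also have "\<dots> = (\<Sum>J\<in>?Q. \<Sum>K\<in>words D n. if qb.reads 0 J K then m K else 0)"
        by (rule sum.swap)
      also have "\<dots> \<le> (\<Sum>J\<in>?Q. C * (C' * \<rho> powr s))"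
      proof (intro sum_mono)
        fix J assume J: "J \<in> ?Q"
        then have JD: "set J \<subseteq> D" and w: "w J < \<rho>" by (auto simp: stopping_def)
        have "length J \<le> n" using stopping_length[OF J L] n by simp
        then have "(\<Sum>K\<in>words D n. if qb.reads 0 J K then m K else 0) \<le> C * m J"
          using qb.mass_read_le[of "[]" J 0 n] JD by (simp add: qb.nil cong: if_cong)
        also have "\<dots> \<le> C * (C' * w J powr s)"
          using mw[OF JD] qb.C_ge_1 by (intro mult_left_mono) auto
        also have "\<dots> \<le> C * (C' * \<rho> powr s)"
          using w wt_bounds(1)[OF JD x0_N] s C'0 qb.C_ge_1
          by (intro mult_left_mono powr_mono2) auto
        finally show "(\<Sum>K\<in>words D n. if qb.reads 0 J K then m K else 0) \<le> C * (C' * \<rho> powr s)" .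
      qed
      also have "\<dots> = real (card ?Q) * (C * (C' * \<rho> powr s))" by simp
      also have "\<dots> \<le> M * (C * (C' * \<rho> powr s))"
        using M(2)[OF \<rho> True] C'0 qb.C_ge_1 by (intro mult_right_mono) auto
      also have "\<dots> = (M * (C * C')) * \<rho> powr s" by simp
      also have "\<dots> \<le> A * \<rho> powr s" by (intro mult_right_mono) (auto simp: A_def)
      finally show ?thesis .
    qed
    then show ?thesis by blast
  qed
  then show ?thesis by (intro exI[of _ A]) (auto simp: A_def)
qed

text \<open>The mass distribution principle. Covering sets are enlarged to open balls so that
compactness leaves finitely many of them, and then one length of words serves for all. The enlargement \<open>t k\<close>
is positive even for covering sets of diameter 0, at a total cost of at most \<open>c\<close>.\<close>

theorem hausdorff_measure_pos:
  assumes m: "quasi_bernoulli D m C" and mw: "\<And>I. set I \<subseteq> D \<Longrightarrow> m I \<le> C' * w I powr s"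
    and s: "0 < s"
  shows "0 < hausdorff_measure s X"
proof -
  interpret qb: quasi_bernoulli D m C by (rule m)
  obtain A where A: "0 < A" "\<And>p \<rho>. 0 < \<rho> \<Longrightarrow> \<exists>L. \<forall>n\<ge>L.
    (\<Sum>K\<in>words D n. if word_map \<phi> K ` X \<inter> ball p \<rho> \<noteq> {} then m K else 0) \<le> A * \<rho> powr s"
    using mass_of_ball[OF m mw s] by blast
  define c where "c = 1 / (A * 2 powr s * 2)"
  have c: "0 < c" using A by (simp add: c_def)
  have "ennreal c \<le> hausdorff_content s 1 X"
  proof (rule ccontr)
    assume "\<not> ennreal c \<le> hausdorff_content s 1 X"
    then have "hausdorff_content s 1 X < ennreal c" by simp
    then obtain V where V: "X \<subseteq> (\<Union>k::nat. V k)" "\<And>k. bounded (V k)"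
      and small: "(\<Sum>k. if V k = {} then 0 else ennreal (rpow (diameter (V k)) s)) < ennreal c"
      unfolding hausdorff_content_def INF_less_iff by auto
    define t where "t k = (c * (1 / 2) ^ Suc k) powr (1 / s)" for k
    have t: "0 < t k" "t k powr s = c * (1 / 2) ^ Suc k" for k
      using c s by (simp_all add: t_def powr_powr)
    define y where "y k = (SOME y. y \<in> V k)" for k
    define \<rho> where "\<rho> k = diameter (V k) + t k" for k
    have d0: "0 \<le> diameter (V k)" for k using diameter_ge_0[OF V(2)] .
    have \<rho>: "0 < \<rho> k" for k using d0[of k] t(1)[of k] by (simp add: \<rho>_def)
    have "X \<subseteq> (\<Union>k\<in>UNIV. ball (y k) (\<rho> k))"
    proof
      fix x assume "x \<in> X"
      then obtain k where k: "x \<in> V k" using V(1) by blast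
      then have "y k \<in> V k" unfolding y_def by (rule someI)
      then have "dist (y k) x \<le> diameter (V k)" using diameter_bounded_bound[OF V(2)] k by blast
      then have "x \<in> ball (y k) (\<rho> k)" using t(1)[of k] by (simp add: \<rho>_def)
      then show "x \<in> (\<Union>k\<in>UNIV. ball (y k) (\<rho> k))" by blast
    qed
    then obtain F where F: "finite F" "X \<subseteq> (\<Union>k\<in>F. ball (y k) (\<rho> k))"
      using compactE_image[OF compact, of UNIV "\<lambda>k. ball (y k) (\<rho> k)"] by auto
    have "\<forall>k. \<exists>L. \<forall>n\<ge>L. (\<Sum>K\<in>words D n. if word_map \<phi> K ` X \<inter> ball (y k) (\<rho> k) \<noteq> {} then m K else 0)
       \<le> A * \<rho> k powr s"
      using A(2)[OF \<rho>] by blast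
    from choice[OF this] obtain L where L: "\<And>k n. L k \<le> n \<Longrightarrow>
      (\<Sum>K\<in>words D n. if word_map \<phi> K ` X \<inter> ball (y k) (\<rho> k) \<noteq> {} then m K else 0) \<le> A * \<rho> k powr s"
      by blast
    define n where "n = (\<Sum>k\<in>F. L k)"
    have Ln: "L k \<le> n" if "k \<in> F" for k using member_le_sum[OF that, of L] F(1) by (simp add: n_def)
    have "1 = (\<Sum>K\<in>words D n. m K)" by (simp add: qb.sum_words_eq_1)
    also have "\<dots> \<le> (\<Sum>K\<in>words D n. \<Sum>k\<in>F. if word_map \<phi> K ` X \<inter> ball (y k) (\<rho> k) \<noteq> {} then m K else 0)"
    proof (intro sum_mono)
      fix K assume "K \<in> words D n"
      then have K: "set K \<subseteq> D" by (auto simp: words_def)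
      have m0: "0 < m K" by (rule qb.pos[OF K])
      obtain k where k: "k \<in> F" "word_map \<phi> K x0 \<in> ball (y k) (\<rho> k)"
        using F(2) word_map_X[OF K x0] by blast
      have "m K = (if word_map \<phi> K ` X \<inter> ball (y k) (\<rho> k) \<noteq> {} then m K else 0)" using k(2) x0 by auto
      also have "\<dots> \<le> (\<Sum>k\<in>F. if word_map \<phi> K ` X \<inter> ball (y k) (\<rho> k) \<noteq> {} then m K else 0)"
        by (rule member_le_sum[OF k(1) _ F(1)]) (use m0 in auto)
      finally show "m K \<le> (\<Sum>k\<in>F. if word_map \<phi> K ` X \<inter> ball (y k) (\<rho> k) \<noteq> {} then m K else 0)" .
    qed
    also have "\<dots> = (\<Sum>k\<in>F. \<Sum>K\<in>words D n. if word_map \<phi> K ` X \<inter> ball (y k) (\<rho> k) \<noteq> {} then m K else 0)"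
      by (rule sum.swap)
    also have "\<dots> \<le> (\<Sum>k\<in>F. A * \<rho> k powr s)" using Ln by (intro sum_mono L) auto
    also have "\<dots> \<le> (\<Sum>k\<in>F. A * (2 powr s * (diameter (V k) powr s + t k powr s)))"
      unfolding \<rho>_def using A d0 t(1) s by (intro sum_mono mult_left_mono powr_add_le) (auto simp: less_imp_le)
    also have "\<dots> = A * 2 powr s * ((\<Sum>k\<in>F. diameter (V k) powr s) + (\<Sum>k\<in>F. c * (1 / 2) ^ Suc k))"
      unfolding t(2) by (simp only: sum.distrib[symmetric] sum_distrib_left mult.assoc)
    also have "\<dots> < A * 2 powr s * (c + c)"
    proof -
      have "ennreal (\<Sum>k\<in>F. diameter (V k) powr s) = (\<Sum>k\<in>F. ennreal (diameter (V k) powr s))"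
        by (rule sum_ennreal[symmetric]) simp
      also have "\<dots> = (\<Sum>k\<in>F. if V k = {} then 0 else ennreal (rpow (diameter (V k)) s))"
        by (intro sum.cong refl) (use s in \<open>auto simp: rpow_pos diameter_def\<close>)
      also have "\<dots> \<le> (\<Sum>k. if V k = {} then 0 else ennreal (rpow (diameter (V k)) s))"
        by (intro sum_le_suminf F) auto
      also note small
      finally have 1: "(\<Sum>k\<in>F. diameter (V k) powr s) < c"
        by (subst (asm) ennreal_less_iff) (auto intro: sum_nonneg)
      have half: "(\<lambda>k. c * (1 / 2) ^ Suc k) sums c" using sums_mult[OF power_half_series, of c] by simp
      then have "(\<Sum>k\<in>F. c * (1 / 2) ^ Suc k) \<le> (\<Sum>k. c * (1 / 2) ^ Suc k)"
        using c F(1) by (intro sum_le_suminf) (auto dest: sums_summable)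
      then have 2: "(\<Sum>k\<in>F. c * (1 / 2) ^ Suc k) \<le> c" using sums_unique[OF half] by simp
      show ?thesis using A(1) 1 2 by (intro mult_strict_left_mono) auto
    qed
    also have "\<dots> = 1" using A(1) by (simp add: c_def)
    finally show False by simp
  qed
  then have "ennreal c \<le> hausdorff_measure s X"
    using hausdorff_content_le_measure[of 1 s X] by auto
  then show ?thesis using c by (metis ennreal_less_zero_iff less_le_trans ennreal_0 ennreal_lessI zero_less_iff_neq_zero)
qed

end

section \<open>Conformal iterated function systems with the open set condition\<close>

lemma conformal_on_scales_at:
  assumes "conformal_on V f" "x \<in> V"
  shows "scales_at (deriv_norm f x) f x"
proof -
  obtain f' where f': "(f has_derivative blinfun_apply (f' x)) (at x)"
    "\<And>y. norm (blinfun_apply (f' x) y) = norm (f' x) * norm y"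
    using assms by (auto simp: conformal_on_def)
  then have "scales_at (norm (f' x)) f x" by (auto simp: scales_at_def)
  then show ?thesis using deriv_norm_eqI by metis
qed

lemma conformal_ifs_derivative_bounds:
  fixes \<phi> :: "'i \<Rightarrow> 'a::euclidean_space \<Rightarrow> 'a"
  assumes "conformal_ifs D \<phi> K V" "D \<noteq> {}" "V \<noteq> {}"
  obtains a where "0 < a" "\<And>i x. i \<in> D \<Longrightarrow> x \<in> V \<Longrightarrow> a \<le> deriv_norm (\<phi> i) x"
proof -
  have D: "finite D" using assms(1) by (auto simp: conformal_ifs_def ifs_def)
  have inf: "0 < (INF x\<in>V. deriv_norm (\<phi> i) x)" if "i \<in> D" for i
    using assms(1) that by (auto simp: conformal_ifs_def)
  define a where "a = Min ((\<lambda>i. INF x\<in>V. deriv_norm (\<phi> i) x) ` D)"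
  have "a \<in> (\<lambda>i. INF x\<in>V. deriv_norm (\<phi> i) x) ` D"
    unfolding a_def using D assms(2) by (intro Min_in) auto
  then have "0 < a" using inf by auto
  moreover have "a \<le> deriv_norm (\<phi> i) x" if i: "i \<in> D" and x: "x \<in> V" for i x
  proof -
    have "a \<le> (INF x\<in>V. deriv_norm (\<phi> i) x)" unfolding a_def using D i by (intro Min_le) auto
    also have "\<dots> \<le> deriv_norm (\<phi> i) x"
    proof (rule cINF_lower[OF _ x])
      show "bdd_below ((\<lambda>x. deriv_norm (\<phi> i) x) ` V)"
      proof (rule bdd_belowI2)
        fix y assume "y \<in> V"
        then have "scales_at (deriv_norm (\<phi> i) y) (\<phi> i) y"
          using assms(1) i by (auto simp: conformal_ifs_def intro: conformal_on_scales_at)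
        then obtain A :: "'a \<Rightarrow> 'a" where A: "\<And>v. norm (A v) = deriv_norm (\<phi> i) y * norm v"
          by (auto simp: scales_at_def)
        obtain b :: 'a where "b \<in> Basis" using nonempty_Basis by blast
        then show "0 \<le> deriv_norm (\<phi> i) y" using A[of b] norm_ge_zero[of "A b"] by simp
      qed
    qed
    finally show ?thesis .
  qed
  ultimately show thesis using that by blast
qed

text \<open>The words of a conformal system act on a small neighbourhood \<open>N\<close> of \<open>K\<close>, which, unlike
  \<open>V\<close>, is invariant under the maps. Two points of \<open>N\<close> at distance less than \<open>\<epsilon>\<close> are joined by a
  segment inside \<open>V\<close>, so the mean value theorem applies; for distant points the
  two-point estimate holds because the constant \<open>H\<close> is large. The last property moves the open set of
  the open set condition close to \<open>K\<close>.\<close>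

lemma conformal_ifs_neighbourhood:
  assumes conf: "conformal_ifs D \<phi> K V" and D: "D \<noteq> {}" and K: "K \<noteq> {}"
  obtains N a r H \<alpha> d \<epsilon> where "conformal_words D \<phi> N a r H \<alpha> d" "N \<subseteq> V" "open N"
    "0 < \<epsilon>" "\<And>x. x \<in> K \<Longrightarrow> ball x \<epsilon> \<subseteq> N"
    "\<And>x. x \<in> V \<Longrightarrow> \<exists>n. \<forall>I\<in>words D n.
       (\<forall>J. suffix J I \<longrightarrow> word_map \<phi> J x \<in> V) \<longrightarrow> word_map \<phi> I x \<in> N"
proof -
  have finD: "finite D" and cpt: "compact K" and KV: "K \<subseteq> V" and V: "open V"
    and KK: "\<And>i. i \<in> D \<Longrightarrow> \<phi> i ` K \<subseteq> K"
    and inj: "\<And>i. i \<in> D \<Longrightarrow> inj_on (\<phi> i) V" and co: "\<And>i. i \<in> D \<Longrightarrow> conformal_on V (\<phi> i)"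
    and ct: "\<And>i. i \<in> D \<Longrightarrow> contraction_on V (\<phi> i)"
    using conf by (auto simp: conformal_ifs_def ifs_def)
  obtain \<alpha> c where \<alpha>: "0 < \<alpha>" and c: "0 < c" and hoelder: "\<And>i x y. i \<in> D \<Longrightarrow> x \<in> V \<Longrightarrow> y \<in> V \<Longrightarrow>
      \<bar>deriv_norm (\<phi> i) x - deriv_norm (\<phi> i) y\<bar> \<le> c * dist x y powr \<alpha>"
    using conf by (auto simp: conformal_ifs_def)
  obtain r where r: "0 < r" "r < 1" and lip: "\<And>i x y. i \<in> D \<Longrightarrow> x \<in> V \<Longrightarrow> y \<in> V \<Longrightarrow> dist (\<phi> i x) (\<phi> i y) \<le> r * dist x y"
    by (rule uniform_contraction_ratio[OF finD D ct]) blast+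
  have "V \<noteq> {}" using K KV by blast
  then obtain a where a: "0 < a" and lower: "\<And>i x. i \<in> D \<Longrightarrow> x \<in> V \<Longrightarrow> a \<le> deriv_norm (\<phi> i) x"
    using conformal_ifs_derivative_bounds[OF conf D] by metis
  have sc: "scales_at (deriv_norm (\<phi> i) x) (\<phi> i) x" if "i \<in> D" "x \<in> V" for i x
    using co that by (intro conformal_on_scales_at) auto
  obtain \<delta> where \<delta>: "0 < \<delta>" "\<And>x y. x \<in> K \<Longrightarrow> y \<in> - V \<Longrightarrow> \<delta> \<le> dist x y"
    using separate_compact_closed[OF cpt, of "- V"] V KV closed_Compl by blast
  define \<epsilon> where "\<epsilon> = \<delta> / 2"
  have \<epsilon>: "0 < \<epsilon>" using \<delta> by (simp add: \<epsilon>_def)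
  define N where "N = (\<Union>y\<in>K. ball y \<epsilon>)"
  have near: "x \<in> V" if "y \<in> K" "dist y x < 2 * \<epsilon>" for x y
    using \<delta>(2)[OF that(1), of x] that(2) by (auto simp: \<epsilon>_def)
  have NV: "N \<subseteq> V" using near \<epsilon> by (force simp: N_def)
  have KN: "ball x \<epsilon> \<subseteq> N" if "x \<in> K" for x using that by (auto simp: N_def)
  have inv: "\<phi> i ` N \<subseteq> N" if i: "i \<in> D" for i
  proof
    fix z assume "z \<in> \<phi> i ` N"
    then obtain x y where xy: "y \<in> K" "dist y x < \<epsilon>" "z = \<phi> i x" by (auto simp: N_def)
    have "x \<in> V" by (rule near[OF xy(1)]) (use xy(2) \<epsilon> in linarith)
    then have "dist (\<phi> i y) (\<phi> i x) \<le> r * dist y x" using xy KV i by (intro lip) auto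
    also have "\<dots> \<le> dist y x" using r by (simp add: mult_left_le_one_le)
    finally have "dist (\<phi> i y) (\<phi> i x) < \<epsilon>" using xy(2) by simp
    moreover have "\<phi> i y \<in> K" using KK[OF i] xy(1) by blast
    ultimately show "z \<in> N" using xy(3) by (auto simp: N_def)
  qed
  have "bounded N"
  proof -
    obtain b where b: "\<And>x. x \<in> K \<Longrightarrow> norm x \<le> b" using compact_imp_bounded[OF cpt] by (auto simp: bounded_iff)
    have "norm x \<le> b + \<epsilon>" if xN: "x \<in> N" for x
    proof -
      obtain y where y: "y \<in> K" "dist y x < \<epsilon>" using xN by (auto simp: N_def)
      then show ?thesis using b[OF y(1)] norm_triangle_ineq2[of x y] by (simp add: dist_norm norm_minus_commute[of y])
    qed
    then show ?thesis by (auto simp: bounded_iff)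
  qed
  then have diam: "dist x y \<le> diameter N" if "x \<in> N" "y \<in> N" for x y
    using diameter_bounded_bound that by blast
  define H where "H = c / a + 1 / (a * \<epsilon> powr \<alpha>)"
  have H0: "0 \<le> H" using a c by (simp add: H_def)
  have ca: "c \<le> H * a" using a by (simp add: H_def field_simps)
  have H1: "1 \<le> H * \<epsilon> powr \<alpha> * a"
  proof -
    have "1 = 1 / (a * \<epsilon> powr \<alpha>) * \<epsilon> powr \<alpha> * a" using a \<epsilon> by simp
    also have "\<dots> \<le> H * \<epsilon> powr \<alpha> * a" using a c by (intro mult_right_mono) (auto simp: H_def)
    finally show ?thesis .
  qed
  have hoelder': "deriv_norm (\<phi> i) y \<le> (1 + H * dist x y powr \<alpha>) * deriv_norm (\<phi> i) x"
    if "i \<in> D" "x \<in> V" "y \<in> V" for i x y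
  proof -
    have "deriv_norm (\<phi> i) y \<le> deriv_norm (\<phi> i) x + c * dist x y powr \<alpha>"
      using hoelder[OF that] by linarith
    also have "c * dist x y powr \<alpha> \<le> (H * a) * dist x y powr \<alpha>"
      by (intro mult_right_mono ca) auto
    also have "(H * a) * dist x y powr \<alpha> = (H * dist x y powr \<alpha>) * a" by simp
    also have "\<dots> \<le> (H * dist x y powr \<alpha>) * deriv_norm (\<phi> i) x"
      using lower[OF that(1,2)] H0 by (intro mult_left_mono) auto
    finally show ?thesis by (simp add: algebra_simps)
  qed
  have step: "dist (\<phi> i x) (\<phi> i y) \<le> (1 + H * dist x y powr \<alpha>) * (deriv_norm (\<phi> i) x * dist x y)"
    if i: "i \<in> D" and xy: "x \<in> N" "y \<in> N" for i x y
  proof (cases "dist x y < \<epsilon>")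
    case True
    let ?S = "closed_segment x y"
    obtain k where k: "k \<in> K" "dist k x < \<epsilon>" using xy(1) by (auto simp: N_def)
    have seg: "p \<in> V \<and> dist x p \<le> dist x y" if "p \<in> ?S" for p
    proof -
      have "dist x p \<le> dist x y" using dist_in_closed_segment[OF that] by (simp add: dist_commute)
      then have "dist k p < 2 * \<epsilon>" using k(2) True dist_triangle[of k p x] by linarith
      then show ?thesis using near[OF k(1)] \<open>dist x p \<le> dist x y\<close> by blast
    qed
    let ?M = "(1 + H * dist x y powr \<alpha>) * deriv_norm (\<phi> i) x"
    have "\<forall>p\<in>?S. \<exists>A. (\<phi> i has_derivative A) (at p within ?S) \<and> onorm A \<le> ?M"
    proof
      fix p assume p: "p \<in> ?S"
      obtain A where A: "(\<phi> i has_derivative A) (at p)" "\<And>v. norm (A v) = deriv_norm (\<phi> i) p * norm v"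
        using sc[OF i, of p] seg[OF p] by (auto simp: scales_at_def)
      have xV: "x \<in> V" using xy NV by blast
      have "deriv_norm (\<phi> i) p \<le> (1 + H * dist x p powr \<alpha>) * deriv_norm (\<phi> i) x"
        using seg[OF p] xV i by (intro hoelder') auto
      also have "\<dots> \<le> ?M"
        using seg[OF p] H0 lower[OF i xV] a \<alpha>
        by (intro mult_right_mono add_left_mono mult_left_mono powr_mono2) auto
      finally have "onorm A \<le> ?M"
        by (intro onorm_le) (simp add: A(2) mult_right_mono)
      then show "\<exists>A. (\<phi> i has_derivative A) (at p within ?S) \<and> onorm A \<le> ?M"
        using has_derivative_at_withinI[OF A(1)] by blast
    qed
    from bchoice[OF this] obtain A where A: "\<And>p. p \<in> ?S \<Longrightarrow> (\<phi> i has_derivative A p) (at p within ?S)"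
      "\<And>p. p \<in> ?S \<Longrightarrow> onorm (A p) \<le> ?M" by blast
    have "norm (\<phi> i x - \<phi> i y) \<le> ?M * norm (x - y)"
      by (rule differentiable_bound[OF convex_closed_segment A]) auto
    then show ?thesis by (simp add: dist_norm mult.assoc)
  next
    case False
    have V: "x \<in> V" "y \<in> V" using xy NV by auto
    have "dist (\<phi> i x) (\<phi> i y) \<le> r * dist x y" using lip[OF i V] .
    also have "\<dots> \<le> 1 * dist x y" using r by (intro mult_right_mono) auto
    also have "\<dots> \<le> (H * \<epsilon> powr \<alpha> * a) * dist x y" using H1 by (intro mult_right_mono) auto
    also have "\<dots> \<le> ((1 + H * dist x y powr \<alpha>) * deriv_norm (\<phi> i) x) * dist x y"
    proof (intro mult_right_mono mult_mono)
      have "H * \<epsilon> powr \<alpha> \<le> H * dist x y powr \<alpha>"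
        using False \<epsilon> \<alpha> H0 by (intro mult_left_mono powr_mono2) auto
      then show "H * \<epsilon> powr \<alpha> \<le> 1 + H * dist x y powr \<alpha>" by simp
    qed (use lower[OF i V(1)] a H0 in auto)
    finally show ?thesis by (simp add: mult.assoc)
  qed
  have words: "conformal_words D \<phi> N a r H \<alpha> (diameter N)"
  proof
    fix i x y assume i: "i \<in> D" and x: "x \<in> N"
    have xV: "x \<in> V" using x NV by blast
    show "scales_at (deriv_norm (\<phi> i) x) (\<phi> i) x" by (rule sc[OF i xV])
    show "a \<le> deriv_norm (\<phi> i) x" by (rule lower[OF i xV])
    show "deriv_norm (\<phi> i) x \<le> r"
      by (rule scales_at_le_lipschitz[OF sc[OF i xV] V xV]) (rule lip[OF i xV])
    assume y: "y \<in> N"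
    have yV: "y \<in> V" using y NV by blast
    show "dist (\<phi> i x) (\<phi> i y) \<le> r * dist x y" by (rule lip[OF i xV yV])
    show "dist (\<phi> i x) (\<phi> i y) \<le> (1 + H * dist x y powr \<alpha>) * (deriv_norm (\<phi> i) x * dist x y)"
      by (rule step[OF i x y])
    show "deriv_norm (\<phi> i) y \<le> (1 + H * dist x y powr \<alpha>) * deriv_norm (\<phi> i) x"
      by (rule hoelder'[OF i xV yV])
  next
    fix i assume "i \<in> D"
    then show "inj_on (\<phi> i) N" using inj_on_subset[OF inj NV] by blast
  qed (fact finD inv r a H0 \<alpha> diam)+
  have attracted: "\<exists>n. \<forall>I\<in>words D n. (\<forall>J. suffix J I \<longrightarrow> word_map \<phi> J x \<in> V) \<longrightarrow> word_map \<phi> I x \<in> N"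
    if x: "x \<in> V" for x
  proof -
    obtain y where y: "y \<in> K" using K by blast
    obtain n where n: "r ^ n < \<epsilon> / (dist y x + 1)"
      using real_arch_pow_inv[of "\<epsilon> / (dist y x + 1)" r] r \<epsilon> by (auto simp: add_nonneg_pos)
    have close: "dist (word_map \<phi> I y) (word_map \<phi> I x) \<le> r ^ length I * dist y x"
      if "set I \<subseteq> D" "\<forall>J. suffix J I \<longrightarrow> word_map \<phi> J x \<in> V" for I
      using that
    proof (induction I)
      case (Cons i I)
      have I: "set I \<subseteq> D" and i: "i \<in> D" using Cons.prems by auto
      have suf: "word_map \<phi> J x \<in> V" if "suffix J I" for J
        using Cons.prems(2) that by (simp add: suffix_Cons)
      have yK: "word_map \<phi> I y \<in> K" using KK I y by (rule word_map_in)
      have "dist (\<phi> i (word_map \<phi> I y)) (\<phi> i (word_map \<phi> I x)) \<le> r * dist (word_map \<phi> I y) (word_map \<phi> I x)"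
        using yK KV suf[of I] i by (intro lip) auto
      also have "\<dots> \<le> r * (r ^ length I * dist y x)"
        using Cons.IH[OF I] suf r by (intro mult_left_mono) auto
      finally show ?case by simp
    qed simp
    have "word_map \<phi> I x \<in> N" if I: "I \<in> words D n" "\<forall>J. suffix J I \<longrightarrow> word_map \<phi> J x \<in> V" for I
    proof -
      have ID: "set I \<subseteq> D" "length I = n" using I by (auto simp: words_def)
      have "dist (word_map \<phi> I y) (word_map \<phi> I x) \<le> r ^ n * dist y x"
        using close[OF ID(1) I(2)] ID(2) by simp
      also have "\<dots> \<le> r ^ n * (dist y x + 1)" using r by (intro mult_left_mono) auto
      also have "\<dots> < \<epsilon>" using n by (subst (asm) pos_less_divide_eq) (auto simp: add_nonneg_pos)
      finally show ?thesis using word_map_in[OF KK ID(1) y] by (auto simp: N_def)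
    qed
    then show ?thesis by blast
  qed
  have "open N" by (auto simp: N_def)
  then show thesis using that[OF words NV _ \<epsilon> KN attracted] by blast
qed

text \<open>The given open set \<open>G\<close> may lie far from \<open>K\<close>, but it contains the forward orbits of its points, which are
attracted into \<open>N\<close>. So \<open>G \<inter> N\<close> is non-empty and inherits the open set condition.\<close>

theorem conformal_attractor_exists:
  assumes conf: "conformal_ifs D \<phi> K V" and osc: "open_set_condition D \<phi> V" and X: "attractor D \<phi> K X"
  obtains N a r H \<alpha> d U x0 \<epsilon> where "conformal_attractor D \<phi> N a r H \<alpha> d X U x0 \<epsilon>"
proof -
  have cX: "compact X" "X \<noteq> {}" and XK: "X \<subseteq> K" and self: "X = (\<Union>i\<in>D. \<phi> i ` X)"
    using X by (auto simp: attractor_def)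
  then have D: "D \<noteq> {}" and K: "K \<noteq> {}" by auto
  obtain x0 where x0: "x0 \<in> X" using cX by blast
  obtain G where G: "G \<noteq> {}" "open G" "G \<subseteq> V" "\<And>i. i \<in> D \<Longrightarrow> \<phi> i ` G \<subseteq> G"
    "\<And>i j. i \<in> D \<Longrightarrow> j \<in> D \<Longrightarrow> i \<noteq> j \<Longrightarrow> \<phi> i ` G \<inter> \<phi> j ` G = {}"
    using osc unfolding open_set_condition_def by metis
  obtain N a r H \<alpha> d \<epsilon> where cw: "conformal_words D \<phi> N a r H \<alpha> d" and N: "N \<subseteq> V" "open N"
    and \<epsilon>: "0 < \<epsilon>" "\<And>x. x \<in> K \<Longrightarrow> ball x \<epsilon> \<subseteq> N"
    and attracted: "\<And>x. x \<in> V \<Longrightarrow> \<exists>n. \<forall>I\<in>words D n.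
       (\<forall>J. suffix J I \<longrightarrow> word_map \<phi> J x \<in> V) \<longrightarrow> word_map \<phi> I x \<in> N"
    by (rule conformal_ifs_neighbourhood[OF conf D K]) (rule that)
  interpret cw: conformal_words D \<phi> N a r H \<alpha> d by (rule cw)
  obtain u where u: "u \<in> G" using G(1) by blast
  obtain i where i: "i \<in> D" using D by blast
  obtain n where n: "\<forall>I\<in>words D n. (\<forall>J. suffix J I \<longrightarrow> word_map \<phi> J u \<in> V) \<longrightarrow> word_map \<phi> I u \<in> N"
    using attracted[of u] u G(3) by blast
  define I where "I = replicate n i"
  have inO: "word_map \<phi> J u \<in> G" if "set J \<subseteq> D" for J
    using G(4) that u by (rule word_map_in)
  have ID: "set I \<subseteq> D" "I \<in> words D n" using i by (auto simp: I_def words_def)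
  have "word_map \<phi> I u \<in> N"
  proof -
    have "word_map \<phi> J u \<in> V" if "suffix J I" for J
      using inO[of J] ID(1) set_mono_suffix[OF that] G(3) by blast
    then show ?thesis using n ID(2) by blast
  qed
  then have ne: "G \<inter> N \<noteq> {}" using inO[OF ID(1)] by blast
  have "conformal_attractor D \<phi> N a r H \<alpha> d X (G \<inter> N) x0 \<epsilon>"
  proof
    show "\<phi> i ` (G \<inter> N) \<subseteq> G \<inter> N" if "i \<in> D" for i
      using G(4)[OF that] cw.invariant[OF that] by blast
    show "\<phi> i ` (G \<inter> N) \<inter> \<phi> j ` (G \<inter> N) = {}" if "i \<in> D" "j \<in> D" "i \<noteq> j" for i j
      using G(5)[OF that] by blast
  qed (use cX x0 self \<epsilon> XK N G ne in \<open>auto intro: open_Int\<close>)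
  then show thesis by (rule that)
qed

section \<open>Similarity dimension and Hausdorff dimension\<close>

lemma bounded_growth_rate_0:
  assumes "0 < l" "\<And>n. l \<le> g n" "\<And>n. g n \<le> u"
  shows "(\<lambda>n. 1 / real n * ln (g n)) \<longlonglongrightarrow> 0"
proof (rule tendsto_sandwich)
  have "(\<lambda>n. 1 / real n * c) \<longlonglongrightarrow> 0 * c" for c
    by (intro tendsto_intros lim_1_over_n)
  then show "(\<lambda>n. 1 / real n * ln l) \<longlonglongrightarrow> 0" "(\<lambda>n. 1 / real n * ln u) \<longlonglongrightarrow> 0" by simp_all
  have "0 < g n" "0 < u" for n using assms(1) assms(2)[of n] assms(3)[of n] by linarith+
  then show "\<forall>\<^sub>F n in sequentially. 1 / real n * ln l \<le> 1 / real n * ln (g n)"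
    "\<forall>\<^sub>F n in sequentially. 1 / real n * ln (g n) \<le> 1 / real n * ln u"
    using assms by (auto intro!: always_eventually divide_right_mono)
qed

lemma exponential_growth_rate_not_0:
  assumes l: "0 < l" and q: "1 < q" and g: "\<And>n. q ^ n * l \<le> g n"
  shows "\<not> (\<lambda>n. 1 / real n * ln (g n)) \<longlonglongrightarrow> 0"
proof
  assume lim: "(\<lambda>n. 1 / real n * ln (g n)) \<longlonglongrightarrow> 0"
  have "(\<lambda>n. ln q + 1 / real n * ln l) \<longlonglongrightarrow> ln q + 0 * ln l"
    by (intro tendsto_intros lim_1_over_n)
  moreover have "\<exists>N. \<forall>n\<ge>N. ln q + 1 / real n * ln l \<le> 1 / real n * ln (g n)"
  proof (intro exI[of _ 1] allI impI)
    fix n :: nat assume n: "1 \<le> n"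
    have "0 < q ^ n * l" using l q by simp
    moreover from this have "0 < g n" using g[of n] by linarith
    ultimately have "ln (q ^ n * l) \<le> ln (g n)" using g[of n] by simp
    then have "real n * ln q + ln l \<le> ln (g n)" using l q by (simp add: ln_mult ln_realpow)
    then have "1 / real n * (real n * ln q + ln l) \<le> 1 / real n * ln (g n)" by (intro mult_left_mono) auto
    then show "ln q + 1 / real n * ln l \<le> 1 / real n * ln (g n)" using n by (simp add: field_simps)
  qed
  ultimately have "ln q + 0 * ln l \<le> 0" using lim by (intro LIMSEQ_le) auto
  then show False using q by simp
qed

lemma exponential_decay_rate_not_0:
  assumes u: "0 < u" and q: "0 < q" "q < 1" and g: "\<And>n. g n \<le> q ^ n * u" "\<And>n. 0 < g n"
  shows "\<not> (\<lambda>n. 1 / real n * ln (g n)) \<longlonglongrightarrow> 0"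
proof
  assume "(\<lambda>n. 1 / real n * ln (g n)) \<longlonglongrightarrow> 0"
  then have "(\<lambda>n. - (1 / real n * ln (g n))) \<longlonglongrightarrow> - 0" by (rule tendsto_minus)
  moreover have "- (1 / real n * ln (g n)) = 1 / real n * ln (inverse (g n))" for n
    using g(2)[of n] by (simp add: ln_inverse)
  moreover have "inverse q ^ n * inverse u \<le> inverse (g n)" for n
    using le_imp_inverse_le[OF g(1) g(2)] by (simp add: power_inverse)
  moreover have "1 < inverse q" using q by (simp add: one_less_inverse_iff)
  ultimately show False
    using exponential_growth_rate_not_0[of "inverse u" "inverse q" "\<lambda>n. inverse (g n)"] u by simp
qed

lemma word_series_cong:
  assumes "\<And>I. I \<in> words_star D \<Longrightarrow> \<Psi> I = \<Psi>' I"
  shows "word_series D \<Psi> s = word_series D \<Psi>' s"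
  unfolding word_series_def
  by (intro arg_cong[where f = suminf] ext sum.cong refl) (simp add: assms words_in_words_star)

lemma limsup_set_cong:
  assumes "\<And>I. I \<in> words_star D \<Longrightarrow> \<Psi> I = \<Psi>' I"
  shows "limsup_set D \<phi> X \<Psi> z = limsup_set D \<phi> X \<Psi>' z"
  unfolding limsup_set_def using assms by (simp cong: conj_cong)

context conformal_attractor
begin

lemma powr_wt_compare:
  assumes s: "0 \<le> s" and I: "set I \<subseteq> D" and x: "x \<in> N"
  shows "wt I x powr s \<le> B powr s * w I powr s" "w I powr s \<le> B powr s * wt I x powr s"
proof -
  note p = wt_bounds(1)[OF I x] wt_bounds(1)[OF I x0_N] B_pos
  have "wt I x powr s \<le> (B * w I) powr s" "w I powr s \<le> (B * wt I x) powr s"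
    using s p distortion(1)[OF I x0_N x] distortion(1)[OF I x x0_N] by (auto intro!: powr_mono2)
  then show "wt I x powr s \<le> B powr s * w I powr s" "w I powr s \<le> B powr s * wt I x powr s"
    using p by (simp_all add: powr_mult)
qed

lemma partition_sum_bounds:
  assumes s: "0 \<le> s" and Z: "\<And>n. B powr - s \<le> qm.Z s n" "\<And>n. qm.Z s n \<le> B powr s" and x: "x \<in> X"
  shows "B powr (- 2 * s) \<le> (\<Sum>I\<in>words D n. wt I x powr s)"
    "(\<Sum>I\<in>words D n. wt I x powr s) \<le> B powr (2 * s)"
proof -
  have xN: "x \<in> N" using x X_N by blast
  have "(\<Sum>I\<in>words D n. wt I x powr s) \<le> (\<Sum>I\<in>words D n. B powr s * w I powr s)"
    using xN by (intro sum_mono powr_wt_compare s) (auto simp: words_def)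
  also have "\<dots> = B powr s * qm.Z s n" by (simp add: qm.Z_def sum_distrib_left)
  also have "\<dots> \<le> B powr s * B powr s" by (intro mult_left_mono Z) auto
  finally show "(\<Sum>I\<in>words D n. wt I x powr s) \<le> B powr (2 * s)" by (simp flip: powr_add)
  have "B powr - s \<le> qm.Z s n" by (rule Z)
  also have "\<dots> \<le> (\<Sum>I\<in>words D n. B powr s * wt I x powr s)"
    unfolding qm.Z_def using xN by (intro sum_mono powr_wt_compare s) (auto simp: words_def)
  also have "\<dots> = B powr s * (\<Sum>I\<in>words D n. wt I x powr s)" by (simp add: sum_distrib_left)
  finally have "B powr - s * B powr - s \<le> B powr - s * (B powr s * (\<Sum>I\<in>words D n. wt I x powr s))"
    by (intro mult_left_mono) auto
  also have "\<dots> = (\<Sum>I\<in>words D n. wt I x powr s)"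
    using B_pos by (simp add: powr_minus)
  finally have "B powr - s * B powr - s \<le> (\<Sum>I\<in>words D n. wt I x powr s)" .
  moreover have "B powr (- 2 * s) = B powr - s * B powr - s" by (simp flip: powr_add)
  ultimately show "B powr (- 2 * s) \<le> (\<Sum>I\<in>words D n. wt I x powr s)" by simp
qed

lemma power_powr_swap: "(r ^ n) powr t = (r powr t) ^ n"
  using r by (induction n) (simp_all add: powr_mult)

text \<open>Uniformly bounded partition sums give pressure 0. Changing the exponent from \<open>s\<close> to \<open>t\<close> changes the
partition sums exponentially fast in \<open>n\<close>, so \<open>s\<close> is the only zero.\<close>

lemma similarity_dim_eq:
  assumes s: "0 \<le> s" and Z: "\<And>n. B powr - s \<le> qm.Z s n" "\<And>n. qm.Z s n \<le> B powr s"
  shows "similarity_dim D \<phi> X = s"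
  unfolding similarity_dim_def
proof (rule the_equality)
  let ?f = "\<lambda>t n x. \<Sum>I\<in>words D n. wt I x powr t"
  have unfold: "has_pressure D \<phi> X t p \<longleftrightarrow>
      (\<lambda>n. 1 / real n * ln (INF x\<in>X. ?f t n x)) \<longlonglongrightarrow> p \<and>
      (\<lambda>n. 1 / real n * ln (SUP x\<in>X. ?f t n x)) \<longlonglongrightarrow> p" for t p
    by (simp add: has_pressure_def wt_def)
  note bnd = partition_sum_bounds[OF s Z]
  have X: "X \<noteq> {}" using x0 by auto
  have l: "0 < B powr (- 2 * s)" using B_pos by simp
  have bb: "bdd_below (?f s n ` X)" "bdd_above (?f s n ` X)" for n
    using bnd by (auto intro!: bdd_belowI2 bdd_aboveI2)
  show "has_pressure D \<phi> X s 0"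
    unfolding unfold
  proof (intro conjI bounded_growth_rate_0[OF l])
    fix n
    show inf: "B powr (- 2 * s) \<le> (INF x\<in>X. ?f s n x)" using bnd X by (intro cINF_greatest) auto
    show sup: "(SUP x\<in>X. ?f s n x) \<le> B powr (2 * s)" using bnd X by (intro cSUP_least) auto
    show "(INF x\<in>X. ?f s n x) \<le> B powr (2 * s)"
      using cINF_lower[OF bb(1) x0] bnd(2)[OF x0] by (rule order_trans)
    show "B powr (- 2 * s) \<le> (SUP x\<in>X. ?f s n x)"
      using bnd(1)[OF x0] cSUP_upper[OF x0 bb(2)] by (rule order_trans)
  qed
  fix t assume t: "has_pressure D \<phi> X t 0"
  have wp: "0 < wt I x" "wt I x \<le> r ^ n" if "I \<in> words D n" "x \<in> X" for I x n
    using wt_bounds[of I x] that X_N by (auto simp: words_def)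
  show "t = s"
  proof (rule ccontr)
    assume "t \<noteq> s"
    then consider "t < s" | "s < t" by linarith
    then show False
    proof cases
      case 1
      have low: "(r powr (t - s)) ^ n * B powr (- 2 * s) \<le> (INF x\<in>X. ?f t n x)" for n
      proof (rule cINF_greatest[OF X])
        fix x assume x: "x \<in> X"
        have "(r powr (t - s)) ^ n * B powr (- 2 * s) \<le> (r powr (t - s)) ^ n * ?f s n x"
          by (intro mult_left_mono bnd x) auto
        also have "\<dots> = (\<Sum>I\<in>words D n. (r ^ n) powr (t - s) * wt I x powr s)"
          by (simp add: sum_distrib_left power_powr_swap)
        also have "\<dots> \<le> (\<Sum>I\<in>words D n. wt I x powr (t - s) * wt I x powr s)"
          using wp[OF _ x] 1 by (intro sum_mono mult_right_mono powr_mono2') auto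
        also have "\<dots> = ?f t n x" by (simp flip: powr_add)
        finally show "(r powr (t - s)) ^ n * B powr (- 2 * s) \<le> ?f t n x" .
      qed
      have "1 < r powr (t - s)" using 1 r powr_less_mono'[of r "t - s" 0] by simp
      from exponential_growth_rate_not_0[OF l this low] show False
        using t unfolding unfold by blast
    next
      case 2
      have up: "?f t n x \<le> (r powr (t - s)) ^ n * B powr (2 * s)" if x: "x \<in> X" for n x
      proof -
        have "?f t n x = (\<Sum>I\<in>words D n. wt I x powr (t - s) * wt I x powr s)" by (simp flip: powr_add)
        also have "\<dots> \<le> (\<Sum>I\<in>words D n. (r ^ n) powr (t - s) * wt I x powr s)"
          using wp[OF _ x] 2 by (intro sum_mono mult_right_mono powr_mono2) (auto simp: less_imp_le)
        also have "\<dots> = (r powr (t - s)) ^ n * ?f s n x"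
          by (simp add: sum_distrib_left power_powr_swap)
        also have "\<dots> \<le> (r powr (t - s)) ^ n * B powr (2 * s)"
          by (intro mult_left_mono bnd x) auto
        finally show ?thesis .
      qed
      have above: "(SUP x\<in>X. ?f t n x) \<le> (r powr (t - s)) ^ n * B powr (2 * s)" for n
        using up X by (intro cSUP_least) auto
      have sup_pos: "0 < (SUP x\<in>X. ?f t n x)" for n
      proof -
        have "bdd_above (?f t n ` X)" using up by (auto intro!: bdd_aboveI2)
        then have "?f t n x0 \<le> (SUP x\<in>X. ?f t n x)" using cSUP_upper[OF x0] by blast
        moreover have "0 < ?f t n x0" using qm.Z_pos[of t n] by (simp add: qm.Z_def)
        ultimately show ?thesis by linarith
      qed
      have q: "0 < r powr (t - s)" "r powr (t - s) < 1"
        using 2 r powr_less_mono2[of "t - s" r 1] by auto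
      have "0 < B powr (2 * s)" using B_pos by simp
      from exponential_decay_rate_not_0[OF this q above sup_pos] show False
        using t unfolding unfold by blast
    qed
  qed
qed

lemma bounded_word_image: "set I \<subseteq> D \<Longrightarrow> bounded (word_map \<phi> I ` X)"
  using compact_imp_bounded[OF compact] by (rule bounded_subset) (auto intro: word_map_X)

lemma diameter_upper:
  assumes I: "set I \<subseteq> D" shows "diameter (word_map \<phi> I ` X) \<le> B\<^sup>2 * d * w I"
proof (rule diameter_le)
  show "word_map \<phi> I ` X \<noteq> {} \<or> 0 \<le> B\<^sup>2 * d * w I" using x0 by auto
  fix p q assume "p \<in> word_map \<phi> I ` X" "q \<in> word_map \<phi> I ` X"
  then show "norm (p - q) \<le> B\<^sup>2 * d * w I"
    using dist_upper[OF I] X_N unfolding dist_norm by blast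
qed

text \<open>The cylinders of length \<open>n\<close> cover \<open>X\<close>, and \<open>\<Sum> w\<^sup>t \<le> r\<^sup>n\<^sup>(\<^sup>t\<^sup>-\<^sup>s\<^sup>) \<Sum> w\<^sup>s\<close>.\<close>

lemma hausdorff_measure_above_critical:
  assumes s: "0 \<le> s" and Z: "\<And>n. qm.Z s n \<le> B powr s" and t: "s < t"
  shows "hausdorff_measure t X = 0"
proof (rule hausdorff_measure_eq_0I)
  fix \<delta> \<epsilon>' :: real assume \<delta>: "0 < \<delta>" and \<epsilon>': "0 < \<epsilon>'"
  define E where "E = B\<^sup>2 * d"
  have E: "0 \<le> E" using d_nonneg by (simp add: E_def)
  have q: "0 < r powr (t - s)" "r powr (t - s) < 1" using t r powr_less_mono2[of "t - s" r 1] by auto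
  have "(\<lambda>n. E * r ^ n) \<longlonglongrightarrow> E * 0" by (intro tendsto_intros LIMSEQ_realpow_zero) (use r in auto)
  then have e1: "\<forall>\<^sub>F n in sequentially. E * r ^ n < \<delta>" using \<delta> by (auto dest: order_tendstoD)
  have "(\<lambda>n. E powr t * B powr s * (r powr (t - s)) ^ n) \<longlonglongrightarrow> E powr t * B powr s * 0"
    by (intro tendsto_intros LIMSEQ_realpow_zero) (use q in auto)
  then have e2: "\<forall>\<^sub>F n in sequentially. E powr t * B powr s * (r powr (t - s)) ^ n < \<epsilon>'"
    using \<epsilon>' by (auto dest: order_tendstoD)
  obtain n where n: "E * r ^ n < \<delta>" "E powr t * B powr s * (r powr (t - s)) ^ n < \<epsilon>'"
    using eventually_conj[OF e1 e2] by (auto simp: eventually_sequentially)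
  have wI: "0 < w I" "w I \<le> r ^ n" "diameter (word_map \<phi> I ` X) \<le> E * w I" "bounded (word_map \<phi> I ` X)"
    if "I \<in> words D n" for I
    using that wt_bounds[of I x0] x0_N diameter_upper[of I] bounded_word_image[of I]
    by (auto simp: words_def E_def)
  have "hausdorff_content t \<delta> X \<le> ennreal (\<Sum>I\<in>words D n. rpow (diameter (word_map \<phi> I ` X)) t)"
  proof (rule hausdorff_content_finite_cover[OF \<delta>])
    show "X \<subseteq> (\<Union>I\<in>words D n. word_map \<phi> I ` X)"
      using self_similar_words[OF self_similar, of n] by simp
    show "diameter (word_map \<phi> I ` X) \<le> \<delta>" if "I \<in> words D n" for I
    proof -
      have "diameter (word_map \<phi> I ` X) \<le> E * w I" by (rule wI(3)[OF that])
      also have "\<dots> \<le> E * r ^ n" using E by (intro mult_left_mono wI that)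
      finally show ?thesis using n(1) by simp
    qed
  qed (use finite_alphabet wI in auto)
  also have "(\<Sum>I\<in>words D n. rpow (diameter (word_map \<phi> I ` X)) t) \<le>
    (\<Sum>I\<in>words D n. E powr t * ((r ^ n) powr (t - s) * w I powr s))"
  proof (rule sum_mono)
    fix I assume I: "I \<in> words D n"
    have "rpow (diameter (word_map \<phi> I ` X)) t \<le> (E * w I) powr t"
      using s t wI[OF I] by (auto simp: rpow_pos intro!: powr_mono2 diameter_ge_0)
    also have "\<dots> = E powr t * (w I powr (t - s) * w I powr s)"
      using E wI(1)[OF I] by (simp add: powr_mult flip: powr_add)
    also have "\<dots> \<le> E powr t * ((r ^ n) powr (t - s) * w I powr s)"
      using wI[OF I] t by (intro mult_left_mono mult_right_mono powr_mono2) auto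
    finally show "rpow (diameter (word_map \<phi> I ` X)) t \<le> E powr t * ((r ^ n) powr (t - s) * w I powr s)" .
  qed
  also have "(\<Sum>I\<in>words D n. E powr t * ((r ^ n) powr (t - s) * w I powr s)) = E powr t * (r powr (t - s)) ^ n * qm.Z s n"
    by (simp add: qm.Z_def sum_distrib_left power_powr_swap mult.assoc)
  also have "\<dots> \<le> E powr t * (r powr (t - s)) ^ n * B powr s"
    by (intro mult_left_mono Z) auto
  also have "\<dots> \<le> \<epsilon>'" using n(2) by (simp add: mult_ac)
  finally show "hausdorff_content t \<delta> X \<le> ennreal \<epsilon>'" by (simp add: ennreal_leI)
qed

lemma two_points:
  assumes "0 < hausdorff_dim X" obtains x y where "x \<in> X" "y \<in> X" "x \<noteq> y"
proof (rule ccontr)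
  assume "\<not> thesis"
  then have X: "X = {x0}" using x0 that by blast
  have "hausdorff_measure t X = 0" if t: "0 < t" for t
  proof (rule hausdorff_measure_eq_0I)
    fix \<delta> \<epsilon>' :: real assume \<delta>: "0 < \<delta>"
    have "hausdorff_content t \<delta> X \<le> ennreal (rpow (diameter X) t)"
      using \<delta> by (intro hausdorff_content_single) (auto simp: X)
    then show "hausdorff_content t \<delta> X \<le> ennreal \<epsilon>'" using t by (simp add: X rpow_pos)
  qed
  then have "hausdorff_dim X \<le> 0" by (intro hausdorff_dim_le) auto
  then show False using assms by simp
qed

text \<open>Positive dimension provides two distinct points of \<open>X\<close>, and the words do not bring them together faster than
their ratio.\<close>

lemma diameter_lower:
  assumes "0 < hausdorff_dim X"
  shows "\<exists>e>0. \<forall>I. set I \<subseteq> D \<longrightarrow> e * w I \<le> diameter (word_map \<phi> I ` X)"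
proof -
  obtain x y where xy: "x \<in> X" "y \<in> X" "x \<noteq> y" using two_points[OF assms] by metis
  define e where "e = min \<epsilon> (dist x y) / B\<^sup>2"
  have e: "0 < e" using xy \<epsilon> B_pos by (simp add: e_def)
  have "e * w I \<le> diameter (word_map \<phi> I ` X)" if I: "set I \<subseteq> D" for I
  proof -
    have N: "x \<in> N" "y \<in> N" using xy X_N by auto
    have "e * w I \<le> e * (B * wt I x)" using distortion(1)[OF I N(1) x0_N] e by (intro mult_left_mono) auto
    also have "\<dots> = wt I x / B * min \<epsilon> (dist x y)"
      using B_pos by (simp add: e_def power2_eq_square field_simps)
    also have "\<dots> \<le> dist (word_map \<phi> I x) (word_map \<phi> I y)"
      by (rule dist_lower[OF I \<epsilon> ball_N[OF xy(1)] N(2)])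
    also have "\<dots> \<le> diameter (word_map \<phi> I ` X)"
      using xy by (intro diameter_bounded_bound bounded_word_image I) auto
    finally show ?thesis .
  qed
  then show ?thesis using e by blast
qed

section \<open>The divergence part\<close>

text \<open>An address of \<open>z\<close>, given by its finite prefixes; it is the centre of the shrinking targets.\<close>

lemma coding:
  assumes "z \<in> X"
  obtains c where "\<And>n. set (c n) \<subseteq> D" "\<And>n. length (c n) = n" "\<And>k n. k \<le> n \<Longrightarrow> take k (c n) = c k"
    "\<And>n. \<exists>i\<in>D. c (Suc n) = c n @ [i]" "\<And>n. z \<in> word_map \<phi> (c n) ` X"
proof -
  have "\<forall>x\<in>X. \<exists>p. fst p \<in> D \<and> snd p \<in> X \<and> x = \<phi> (fst p) (snd p)"
  proof
    fix x assume "x \<in> X"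
    then have "x \<in> (\<Union>i\<in>D. \<phi> i ` X)" using self_similar by blast
    then obtain i y where "i \<in> D" "y \<in> X" "x = \<phi> i y" by blast
    then show "\<exists>p. fst p \<in> D \<and> snd p \<in> X \<and> x = \<phi> (fst p) (snd p)" by (intro exI[of _ "(i, y)"]) simp
  qed
  from bchoice[OF this] obtain g where
    g: "\<And>x. x \<in> X \<Longrightarrow> fst (g x) \<in> D" "\<And>x. x \<in> X \<Longrightarrow> snd (g x) \<in> X" "\<And>x. x \<in> X \<Longrightarrow> x = \<phi> (fst (g x)) (snd (g x))"
    by blast
  define y where "y n = ((\<lambda>x. snd (g x)) ^^ n) z" for n
  have yX: "y n \<in> X" for n by (induction n) (use assms g(2) in \<open>auto simp: y_def\<close>)
  define c where "c n = map (\<lambda>k. fst (g (y k))) [0..<n]" for n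
  have zc: "z = word_map \<phi> (c n) (y n)" for n
  proof (induction n)
    case (Suc n)
    have "y n = \<phi> (fst (g (y n))) (y (Suc n))" using g(3)[OF yX[of n]] by (simp add: y_def)
    then show ?case using Suc by (simp add: c_def word_map_append)
  qed (simp add: c_def y_def)
  show thesis
  proof (rule that)
    show "z \<in> word_map \<phi> (c n) ` X" for n using zc yX by blast
    show "\<exists>i\<in>D. c (Suc n) = c n @ [i]" for n using g(1) yX by (auto simp: c_def)
    show "take k (c n) = c k" if "k \<le> n" for k n using that by (simp add: c_def take_map take_upt)
  qed (use g(1) yX in \<open>auto simp: c_def\<close>)
qed

text \<open>Reading \<open>c (\<kappa> n)\<close> behind a word \<open>I\<close> of length \<open>n\<close> puts the point into the cylinder of \<open>I @ c (\<kappa> n)\<close>, which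
contains \<open>word_map \<phi> I z\<close>. By the choice of \<open>\<kappa> n\<close> the diameter of that cylinder is at most the radius at \<open>I\<close>.
The approximation problem thus becomes a shrinking target problem for words. The masses of the targets are at
least comparable with \<open>\<theta> n\<^sup>s\<close>, and the sum of \<open>\<theta> n\<^sup>s\<close> diverges since the partition sums are bounded.\<close>

lemma complement_of_limsup_set_null:
  assumes s: "0 < s" and m: "quasi_bernoulli D m C"
    and mw: "\<And>I. set I \<subseteq> D \<Longrightarrow> w I powr s \<le> c1 * m I" "\<And>I. set I \<subseteq> D \<Longrightarrow> m I \<le> c1 * w I powr s"
    and Z: "\<And>n. qm.Z s n \<le> B powr s"
    and e: "0 < e" "\<And>I. set I \<subseteq> D \<Longrightarrow> e * w I \<le> diameter (word_map \<phi> I ` X)"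
    and z: "z \<in> X" and \<theta>: "\<And>n. 1 \<le> n \<Longrightarrow> 0 \<le> \<theta> n" "antimono_on {1..} \<theta>"
    and div: "word_series D (\<lambda>I. diameter (word_map \<phi> I ` X) * \<theta> (length I)) s = \<infinity>"
  shows "hausdorff_measure s (X - limsup_set D \<phi> X (\<lambda>I. diameter (word_map \<phi> I ` X) * \<theta> (length I)) z) = 0"
proof -
  interpret qb: quasi_bernoulli D m C by (rule m)
  let ?\<Psi> = "\<lambda>I. diameter (word_map \<phi> I ` X) * \<theta> (length I)"
  define E where "E = B\<^sup>2 * d"
  have E: "0 \<le> E" using d_nonneg by (simp add: E_def)
  have c1: "0 < c1" using mw(1)[of "[]"] by (simp add: wt_Nil qb.nil)
  have diamE: "diameter (word_map \<phi> I ` X) \<le> E * w I" if "set I \<subseteq> D" for I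
    using diameter_upper[OF that] by (simp add: E_def)
  have wpos: "0 < w I" if "set I \<subseteq> D" for I using wt_bounds(1)[OF that x0_N] .
  have not_summable: "\<not> summable (\<lambda>n. \<theta> (Suc n) powr s)"
  proof
    assume sum: "summable (\<lambda>n. \<theta> (Suc n) powr s)"
    have "word_series D ?\<Psi> s \<le> (\<Sum>n. ennreal (E powr s * B powr s * \<theta> (Suc n) powr s))"
      unfolding word_series_def
    proof (intro suminf_le allI)
      fix n
      have "(\<Sum>I\<in>words D (Suc n). rpow (?\<Psi> I) s) \<le> (\<Sum>I\<in>words D (Suc n). E powr s * \<theta> (Suc n) powr s * w I powr s)"
      proof (rule sum_mono)
        fix I assume "I \<in> words D (Suc n)"
        then have I: "set I \<subseteq> D" "length I = Suc n" by (auto simp: words_def)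
        have "rpow (?\<Psi> I) s \<le> (E * w I * \<theta> (Suc n)) powr s"
          using s I \<theta>(1)[of "Suc n"] diamE[OF I(1)] diameter_ge_0[OF bounded_word_image[OF I(1)]]
          by (auto simp: rpow_pos intro!: powr_mono2 mult_right_mono)
        also have "\<dots> = E powr s * \<theta> (Suc n) powr s * w I powr s"
          using E \<theta>(1)[of "Suc n"] wpos[OF I(1)] by (simp add: powr_mult)
        finally show "rpow (?\<Psi> I) s \<le> E powr s * \<theta> (Suc n) powr s * w I powr s" .
      qed
      also have "\<dots> = E powr s * \<theta> (Suc n) powr s * qm.Z s (Suc n)" by (simp add: qm.Z_def sum_distrib_left)
      also have "\<dots> \<le> E powr s * \<theta> (Suc n) powr s * B powr s" by (intro mult_left_mono Z) auto
      finally have "(\<Sum>I\<in>words D (Suc n). rpow (?\<Psi> I) s) \<le> E powr s * B powr s * \<theta> (Suc n) powr s"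
        by (simp add: mult_ac)
      then show "(\<Sum>I\<in>words D (Suc n). ennreal (rpow (?\<Psi> I) s)) \<le> ennreal (E powr s * B powr s * \<theta> (Suc n) powr s)"
        by (subst sum_ennreal) (auto simp: rpow_nonneg intro: ennreal_leI)
    qed auto
    also have "\<dots> = ennreal (\<Sum>n. E powr s * B powr s * \<theta> (Suc n) powr s)"
      using sum by (intro suminf_ennreal2 summable_mult) auto
    finally have "word_series D ?\<Psi> s < \<infinity>"
      by (rule le_less_trans) simp
    then show False using div by simp
  qed
  have \<theta>_pos: "0 < \<theta> n" if n: "1 \<le> n" for n
  proof (rule ccontr)
    assume "\<not> 0 < \<theta> n"
    then have "\<theta> k = 0" if "n \<le> k" for k
      using \<theta>(1)[of k] monotone_onD[OF \<theta>(2), of n k] n that by force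
    then have "\<theta> (Suc k) powr s = 0" if "k \<notin> {..<n}" for k using that by simp
    then have "summable (\<lambda>k. \<theta> (Suc k) powr s)" by (intro summable_finite[of "{..<n}"]) auto
    then show False using not_summable by simp
  qed
  obtain c where c: "\<And>n. set (c n) \<subseteq> D" "\<And>n. length (c n) = n" "\<And>k n. k \<le> n \<Longrightarrow> take k (c n) = c k"
    and c_Suc: "\<And>n. \<exists>i\<in>D. c (Suc n) = c n @ [i]" and zc: "\<And>n. z \<in> word_map \<phi> (c n) ` X"
    using coding[OF z] by metis
  \<comment> \<open>\<open>E\<close>, \<open>B\<close> and \<open>e\<close> convert ratios into diameters; the summand 1 keeps \<open>G\<close> positive\<close>
  define G where "G = (E * B + 1) / e"
  have G: "0 < G" using E B_pos e by (simp add: G_def add_nonneg_pos)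
  define \<kappa> where "\<kappa> n = (LEAST k. G * w (c k) \<le> \<theta> n)" for n
  have \<kappa>: "G * w (c (\<kappa> n)) \<le> \<theta> n" if n: "1 \<le> n" for n
  proof -
    obtain k where "r ^ k < \<theta> n / G" using real_arch_pow_inv[of "\<theta> n / G" r] \<theta>_pos[OF n] G r by auto
    then have "w (c k) \<le> \<theta> n / G" using wt_bounds(2)[OF c(1)[of k] x0_N] c(2)[of k] by simp
    then have "G * w (c k) \<le> \<theta> n" using G by (simp add: field_simps)
    then show ?thesis unfolding \<kappa>_def by (rule LeastI)
  qed
  \<comment> \<open>the first term covers \<open>\<kappa> n = 0\<close>, where the target is everything and has mass 1\<close>
  define \<tau> where "\<tau> = min (1 / \<theta> 1 powr s) ((a / (B * G)) powr s / c1)"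
  have \<tau>: "0 < \<tau>" using \<theta>_pos[of 1] a B_pos G c1 by (simp add: \<tau>_def)
  have m_lower: "\<tau> * \<theta> n powr s \<le> m (c (\<kappa> n))" if n: "1 \<le> n" for n
  proof (cases "\<kappa> n")
    case 0
    have "\<theta> n \<le> \<theta> 1" using monotone_onD[OF \<theta>(2), of 1 n] n by simp
    then have "\<theta> n powr s \<le> \<theta> 1 powr s" using s \<theta>_pos[OF n] by (intro powr_mono2) auto
    then have "1 / \<theta> 1 powr s * \<theta> n powr s \<le> 1" using \<theta>_pos[of 1] by (simp add: field_simps)
    moreover have "\<tau> * \<theta> n powr s \<le> 1 / \<theta> 1 powr s * \<theta> n powr s"
      by (intro mult_right_mono) (auto simp: \<tau>_def)
    ultimately show ?thesis using c(2)[of 0] 0 by (simp add: qb.nil)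
  next
    case (Suc k)
    then have "\<not> G * w (c k) \<le> \<theta> n" using not_less_Least[of k "\<lambda>k. G * w (c k) \<le> \<theta> n"] by (simp add: \<kappa>_def)
    then have "a / (B * G) * \<theta> n \<le> a / (B * G) * (G * w (c k))"
      using a B_pos G by (intro mult_left_mono) auto
    also have "\<dots> = a * w (c k) / B" using G B_pos by (simp add: field_simps)
    also have "\<dots> \<le> w (c (\<kappa> n))"
    proof -
      obtain i where "i \<in> D" "c (Suc k) = c k @ [i]" using c_Suc by blast
      then show ?thesis using w_snoc[OF c(1)[of k]] B_pos Suc by (simp add: field_simps)
    qed
    finally have "(a / (B * G) * \<theta> n) powr s \<le> w (c (\<kappa> n)) powr s"
      using a B_pos G \<theta>_pos[OF n] s by (intro powr_mono2) auto
    also have "\<dots> \<le> c1 * m (c (\<kappa> n))" by (rule mw(1)[OF c(1)])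
    also have "(a / (B * G) * \<theta> n) powr s = (a / (B * G)) powr s * \<theta> n powr s"
      using a B_pos G \<theta>_pos[OF n] by (simp add: powr_mult powr_divide)
    finally have "(a / (B * G)) powr s * \<theta> n powr s \<le> c1 * m (c (\<kappa> n))" .
    then have "(a / (B * G)) powr s / c1 * \<theta> n powr s \<le> m (c (\<kappa> n))"
      using c1 by (simp add: field_simps)
    moreover have "\<tau> * \<theta> n powr s \<le> (a / (B * G)) powr s / c1 * \<theta> n powr s"
      by (intro mult_right_mono) (auto simp: \<tau>_def)
    ultimately show ?thesis by linarith
  qed
  have m_div: "\<not> summable (\<lambda>n. m (c (\<kappa> n)))"
  proof
    assume "summable (\<lambda>n. m (c (\<kappa> n)))"
    then have "summable (\<lambda>n. m (c (\<kappa> (Suc n))))" by (subst summable_Suc_iff)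
    then have "summable (\<lambda>n. \<tau> * \<theta> (Suc n) powr s)"
    proof (rule summable_comparison_test_ev[rotated])
      show "\<forall>\<^sub>F n in sequentially. norm (\<tau> * \<theta> (Suc n) powr s) \<le> m (c (\<kappa> (Suc n)))"
        using m_lower \<tau> by (auto intro!: always_eventually)
    qed
    then show False using not_summable \<tau> by (simp add: summable_cmult_iff)
  qed
  have rs: "0 < r powr s" "r powr s < 1" using s r powr_less_mono2[of s r 1] by auto
  have geom: "(\<Sum>k<n. m (c k)) \<le> c1 / (1 - r powr s)" for n
  proof -
    have "(\<Sum>k<n. m (c k)) \<le> (\<Sum>k<n. c1 * (r powr s) ^ k)"
    proof (rule sum_mono)
      fix k
      have "m (c k) \<le> c1 * w (c k) powr s" by (rule mw(2)[OF c(1)])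
      also have "\<dots> \<le> c1 * (r ^ k) powr s"
        using wt_bounds[OF c(1)[of k] x0_N] c(2)[of k] s c1 by (intro mult_left_mono powr_mono2) auto
      finally show "m (c k) \<le> c1 * (r powr s) ^ k" by (simp add: power_powr_swap)
    qed
    also have "\<dots> = c1 * ((1 - (r powr s) ^ n) / (1 - r powr s))"
      using rs by (simp add: sum_distrib_left[symmetric] sum_gp_strict)
    also have "\<dots> \<le> c1 * (1 / (1 - r powr s))"
      using rs c1 by (intro mult_left_mono divide_right_mono) auto
    finally show ?thesis by simp
  qed
  \<comment> \<open>the points that are missed from length \<open>n0\<close> on\<close>
  define F where "F n0 = {x \<in> X. \<forall>I\<in>words_star D. n0 \<le> length I \<longrightarrow> x \<notin> cball (word_map \<phi> I z) (?\<Psi> I)}" for n0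
  have hit: "x \<in> cball (word_map \<phi> I z) (?\<Psi> I)"
    if I: "set I \<subseteq> D" "1 \<le> length I" and x: "x \<in> word_map \<phi> (I @ c (\<kappa> (length I))) ` X" for I x
  proof -
    let ?v = "c (\<kappa> (length I))"
    obtain y where y: "y \<in> X" "z = word_map \<phi> ?v y" using zc by blast
    obtain x' where x': "x' \<in> X" "x = word_map \<phi> (I @ ?v) x'" using x by blast
    have Iv: "set (I @ ?v) \<subseteq> D" using I c by auto
    have "word_map \<phi> I z = word_map \<phi> (I @ ?v) y" using y by (simp add: word_map_append)
    then have "dist (word_map \<phi> I z) x \<le> E * w (I @ ?v)"
      using dist_upper[OF Iv, of y x'] x' y X_N by (auto simp: E_def)
    also have "\<dots> \<le> E * (B * (w I * w ?v))" using I c E by (intro mult_left_mono w_append) auto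
    also have "\<dots> \<le> (E * B + 1) * w ?v * w I"
      using wpos[OF I(1)] wpos[OF c(1)[of "\<kappa> (length I)"]] by (simp add: algebra_simps)
    also have "\<dots> = e * (G * w ?v) * w I" using e(1) by (simp add: G_def)
    also have "\<dots> \<le> e * \<theta> (length I) * w I"
      using \<kappa>[OF I(2)] e(1) wpos[OF I(1)] by (intro mult_right_mono mult_left_mono) auto
    also have "\<dots> = (e * w I) * \<theta> (length I)" by simp
    also have "\<dots> \<le> ?\<Psi> I" using e(2)[OF I(1)] \<theta>(1)[OF I(2)] by (intro mult_right_mono) auto
    finally show ?thesis by simp
  qed
  have F_cover: "F n0 \<subseteq> (\<Union>K\<in>{K \<in> words D M. qb.avoids n0 (\<lambda>n. c (\<kappa> n)) K}. word_map \<phi> K ` X)"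
    if n0: "1 \<le> n0" for n0 M
  proof
    fix x assume x: "x \<in> F n0"
    then have "x \<in> (\<Union>K\<in>words D M. word_map \<phi> K ` X)"
      using self_similar_words[OF self_similar, of M] by (auto simp: F_def)
    then obtain K y where K: "K \<in> words D M" and y: "y \<in> X" "x = word_map \<phi> K y" by blast
    have "qb.avoids n0 (\<lambda>n. c (\<kappa> n)) K"
      unfolding qb.avoids_def
    proof (intro allI impI notI)
      fix n assume n: "n0 \<le> n" "n + length (c (\<kappa> n)) \<le> length K" "qb.reads n (c (\<kappa> n)) K"
      define I where "I = take n K"
      define R where "R = drop (\<kappa> n) (drop n K)"
      have D: "set I \<subseteq> D" "set R \<subseteq> D"
        using K by (auto simp: I_def R_def words_def dest: in_set_takeD in_set_dropD)
      have len: "length I = n" using n(2) by (simp add: I_def)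
      have "take (\<kappa> n) (drop n K) = c (\<kappa> n)" using n(3) by (simp add: qb.reads_def c(2))
      then have "drop n K = c (\<kappa> n) @ R" unfolding R_def by (metis append_take_drop_id)
      then have "K = (I @ c (\<kappa> n)) @ R" unfolding I_def by (metis append_take_drop_id append.assoc)
      then have "x = word_map \<phi> (I @ c (\<kappa> n)) (word_map \<phi> R y)"
        using y(2) word_map_append[of \<phi> "I @ c (\<kappa> n)" R y] by simp
      then have "x \<in> word_map \<phi> (I @ c (\<kappa> (length I))) ` X"
        using word_map_X[OF D(2) y(1)] len by simp
      then have "x \<in> cball (word_map \<phi> I z) (?\<Psi> I)"
        using D(1) len n(1) n0 by (intro hit) auto
      moreover have "I \<in> words_star D"
        using D(1) len n(1) n0 by (intro words_in_words_star[of I D "n - 1"]) (auto simp: words_def)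
      ultimately show False using x len n(1) by (auto simp: F_def)
    qed
    then show "x \<in> (\<Union>K\<in>{K \<in> words D M. qb.avoids n0 (\<lambda>n. c (\<kappa> n)) K}. word_map \<phi> K ` X)"
      using K y by blast
  qed
  have F_null: "hausdorff_measure s (F n0) = 0" if n0: "1 \<le> n0" for n0
  proof (rule hausdorff_measure_eq_0I)
    fix \<delta> \<epsilon>' :: real assume \<delta>: "0 < \<delta>" and \<epsilon>': "0 < \<epsilon>'"
    define \<eta> where "\<eta> = min \<epsilon>' (\<delta> powr s) / (E powr s * c1 + 1)"
    have den: "0 < E powr s * c1 + 1" using c1 by (simp add: add_nonneg_pos)
    have \<eta>: "0 < \<eta>" using \<delta> \<epsilon>' den by (simp add: \<eta>_def)
    have "\<exists>M. (\<Sum>K\<in>words D M. if qb.avoids n0 (\<lambda>n. c (\<kappa> n)) K then m K else 0) < \<eta>"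
      by (rule qb.avoiding_mass_tendsto_0[OF c geom m_div \<eta>])
    then obtain M where M: "(\<Sum>K\<in>words D M. if qb.avoids n0 (\<lambda>n. c (\<kappa> n)) K then m K else 0) < \<eta>"
      by blast
    define A where "A = {K \<in> words D M. qb.avoids n0 (\<lambda>n. c (\<kappa> n)) K}"
    have finA: "finite A" using finite_alphabet by (simp add: A_def)
    have AD: "set K \<subseteq> D" if "K \<in> A" for K using that by (auto simp: A_def words_def)
    have mA: "(\<Sum>K\<in>A. m K) < \<eta>"
      using M finite_alphabet by (simp add: A_def sum.inter_filter)
    have single: "diameter (word_map \<phi> K ` X) powr s \<le> E powr s * c1 * m K" if K: "K \<in> A" for K
    proof -
      have "diameter (word_map \<phi> K ` X) powr s \<le> (E * w K) powr s"
        using s diamE[OF AD[OF K]] diameter_ge_0[OF bounded_word_image[OF AD[OF K]]] by (intro powr_mono2) auto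
      also have "\<dots> = E powr s * w K powr s" using E wpos[OF AD[OF K]] by (simp add: powr_mult)
      also have "\<dots> \<le> E powr s * (c1 * m K)" by (intro mult_left_mono mw(1) AD K) auto
      finally show ?thesis by simp
    qed
    have total: "(\<Sum>K\<in>A. diameter (word_map \<phi> K ` X) powr s) \<le> min \<epsilon>' (\<delta> powr s)"
    proof -
      have "(\<Sum>K\<in>A. diameter (word_map \<phi> K ` X) powr s) \<le> (\<Sum>K\<in>A. E powr s * c1 * m K)"
        by (intro sum_mono single)
      also have "\<dots> = E powr s * c1 * (\<Sum>K\<in>A. m K)" by (simp add: sum_distrib_left)
      also have "\<dots> \<le> (E powr s * c1 + 1) * \<eta>"
        using mA c1 by (intro mult_mono sum_nonneg) (auto simp: less_imp_le[OF qb.pos] AD)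
      also have "\<dots> = min \<epsilon>' (\<delta> powr s)" using den by (simp add: \<eta>_def)
      finally show ?thesis .
    qed
    have "hausdorff_content s \<delta> (F n0) \<le> ennreal (\<Sum>K\<in>A. rpow (diameter (word_map \<phi> K ` X)) s)"
    proof (rule hausdorff_content_finite_cover[OF \<delta> finA])
      show "F n0 \<subseteq> (\<Union>K\<in>A. word_map \<phi> K ` X)" unfolding A_def by (rule F_cover[OF n0])
      show "bounded (word_map \<phi> K ` X)" if "K \<in> A" for K by (intro bounded_word_image AD that)
      show "diameter (word_map \<phi> K ` X) \<le> \<delta>" if K: "K \<in> A" for K
      proof (rule ccontr)
        assume "\<not> diameter (word_map \<phi> K ` X) \<le> \<delta>"
        then have "\<delta> powr s < diameter (word_map \<phi> K ` X) powr s"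
          using \<delta> s by (intro powr_less_mono2) auto
        also have "\<dots> \<le> (\<Sum>K\<in>A. diameter (word_map \<phi> K ` X) powr s)"
          by (rule member_le_sum[OF K _ finA]) auto
        finally show False using total by simp
      qed
    qed
    also have "(\<Sum>K\<in>A. rpow (diameter (word_map \<phi> K ` X)) s) \<le> \<epsilon>'" using total s by (simp add: rpow_pos)
    finally show "hausdorff_content s \<delta> (F n0) \<le> ennreal \<epsilon>'" by (simp add: ennreal_leI)
  qed
  have "X - limsup_set D \<phi> X ?\<Psi> z \<subseteq> (\<Union>n. F (Suc n))"
  proof
    fix x assume x: "x \<in> X - limsup_set D \<phi> X ?\<Psi> z"
    let ?S = "{I \<in> words_star D. x \<in> cball (word_map \<phi> I z) (?\<Psi> I)}"
    have "finite ?S" using x by (simp add: limsup_set_def)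
    then have "finite (length ` ?S)" by (rule finite_imageI)
    from iffD1[OF finite_nat_set_iff_bounded_le this]
    obtain n where n: "\<And>k. k \<in> length ` ?S \<Longrightarrow> k \<le> n" by blast
    have "x \<in> F (Suc n)"
      unfolding F_def
    proof (intro CollectI conjI ballI impI notI)
      fix I assume "I \<in> words_star D" "Suc n \<le> length I" "x \<in> cball (word_map \<phi> I z) (?\<Psi> I)"
      then have "length I \<le> n" by (intro n imageI) simp
      with \<open>Suc n \<le> length I\<close> show False by simp
    qed (use x in simp)
    then show "x \<in> (\<Union>n. F (Suc n))" by blast
  qed
  then have "hausdorff_measure s (X - limsup_set D \<phi> X ?\<Psi> z) \<le> hausdorff_measure s (\<Union>n. F (Suc n))"
    by (rule hausdorff_measure_mono)
  also have "\<dots> = 0" by (rule hausdorff_measure_UN_null) (simp add: F_null)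
  finally show ?thesis by simp
qed

text \<open>The similarity dimension and the Hausdorff dimension agree, and the Hausdorff measure in
that dimension is positive. So the exponent of the diameter in the approximating function is 1 and the
almost everywhere case of the definition applies.\<close>

theorem approximation_regular_of_positive_dim:
  assumes dim: "0 < hausdorff_dim X"
  shows "approximation_regular D \<phi> X"
proof -
  obtain s where s0: "0 \<le> s" and Z: "\<And>n. B powr - s \<le> qm.Z s n" "\<And>n. qm.Z s n \<le> B powr s"
    using qm.critical_exponent by blast
  note above = hausdorff_measure_above_critical[OF s0 Z(2)]
  have s: "0 < s" using hausdorff_dim_le[OF s0 above] dim by simp
  obtain m where m: "quasi_bernoulli D m (B powr (10 * s))"
    and mw: "\<And>I. set I \<subseteq> D \<Longrightarrow> w I powr s \<le> B powr (3 * s) * m I"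
      "\<And>I. set I \<subseteq> D \<Longrightarrow> m I \<le> B powr (3 * s) * w I powr s"
    by (rule qm.gibbs_measure[OF s0 Z]) (rule that)
  have pos: "0 < hausdorff_measure s X" by (rule hausdorff_measure_pos[OF m mw(2) s])
  have hd: "hausdorff_dim X = s" by (rule hausdorff_dim_eqI[OF s0 pos above])
  have sd: "similarity_dim D \<phi> X = s" by (rule similarity_dim_eq[OF s0 Z])
  have psi: "psi_theta D \<phi> X \<theta> I = diameter (word_map \<phi> I ` X) * \<theta> (length I)"
    if "I \<in> words_star D" for \<theta> I
  proof -
    have "set I \<subseteq> D" using that by (auto simp: words_star_def words_def)
    then have "0 \<le> diameter (word_map \<phi> I ` X)" by (intro diameter_ge_0 bounded_word_image)
    then show ?thesis using s by (simp add: psi_theta_def sd hd)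
  qed
  obtain e where e: "0 < e" "\<And>I. set I \<subseteq> D \<Longrightarrow> e * w I \<le> diameter (word_map \<phi> I ` X)"
    using diameter_lower[OF dim] by blast
  show ?thesis
    unfolding approximation_regular_def approximation_regular_pair_def hd if_P[OF pos]
  proof (intro ballI allI impI, elim conjE)
    fix z \<theta>
    let ?\<Psi> = "\<lambda>I. diameter (word_map \<phi> I ` X) * \<theta> (length I)"
    assume z: "z \<in> X" and \<theta>: "\<forall>n\<ge>1. 0 \<le> \<theta> n" "antimono_on {1..} \<theta>"
      and div: "word_series D (psi_theta D \<phi> X \<theta>) s = \<infinity>"
    have "word_series D ?\<Psi> s = \<infinity>"
    proof -
      have "word_series D (psi_theta D \<phi> X \<theta>) s = word_series D ?\<Psi> s"
        by (rule word_series_cong) (rule psi)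
      with div show ?thesis by (simp only:)
    qed
    then have "hausdorff_measure s (X - limsup_set D \<phi> X ?\<Psi> z) = 0"
      using \<theta>(1) by (intro complement_of_limsup_set_null[OF s m mw Z(2) e z _ \<theta>(2)]) auto
    moreover have "limsup_set D \<phi> X (psi_theta D \<phi> X \<theta>) z = limsup_set D \<phi> X ?\<Psi> z"
      by (rule limsup_set_cong) (rule psi)
    ultimately show "hausdorff_measure s (X - limsup_set D \<phi> X (psi_theta D \<phi> X \<theta>) z) = 0"
      by (simp only:)
  qed
qed

end

theorem theorem1p4:
  fixes D :: "'i set"
    and \<phi> :: "'i \<Rightarrow> 'a::euclidean_space \<Rightarrow> 'a"
    and K X :: "'a set"
  assumes ifs: "ifs D \<phi> K"
    and attractor: "attractor D \<phi> K X"
  shows "(\<forall>\<Psi> :: 'i list \<Rightarrow> real.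
            (\<forall>I\<in>words_star D. 0 \<le> \<Psi> I) \<and> word_series D \<Psi> (hausdorff_dim X) < \<infinity> \<longrightarrow>
            (\<forall>z\<in>X. hausdorff_measure (hausdorff_dim X) (limsup_set D \<phi> X \<Psi> z) = 0))
       \<and> (\<forall>V. conformal_ifs D \<phi> K V \<and> open_set_condition D \<phi> V \<and> 0 < hausdorff_dim X \<longrightarrow>
            approximation_regular D \<phi> X)"
proof (intro conjI allI impI ballI)
  fix \<Psi> :: "'i list \<Rightarrow> real" and z
  assume "(\<forall>I\<in>words_star D. 0 \<le> \<Psi> I) \<and> word_series D \<Psi> (hausdorff_dim X) < \<infinity>"
  then show "hausdorff_measure (hausdorff_dim X) (limsup_set D \<phi> X \<Psi> z) = 0"
    by (intro limsup_set_null[OF ifs attractor attractor_dim_nonneg[OF ifs attractor]]) auto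
next
  fix V
  assume V: "conformal_ifs D \<phi> K V \<and> open_set_condition D \<phi> V \<and> 0 < hausdorff_dim X"
  then have conf: "conformal_ifs D \<phi> K V" and osc: "open_set_condition D \<phi> V"
    and dim: "0 < hausdorff_dim X" by auto
  obtain N a r H \<alpha> d U x0 \<epsilon> where "conformal_attractor D \<phi> N a r H \<alpha> d X U x0 \<epsilon>"
    by (rule conformal_attractor_exists[OF conf osc attractor])
  then show "approximation_regular D \<phi> X"
    using dim by (rule conformal_attractor.approximation_regular_of_positive_dim)
qed

end
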